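(* We have $S_{\square}(n)=0$ for $n\le 3$, $S_{\square}(4)=S_{\square}(5)=1$, $S_{\square}(6)=2$, $S_{\square}(7)=3$, $S_{\square}(8)=4$, $S_{\square}(9)=6$, $S_{\square}(10)=7$, $S_{\square}(11)=8$, $S_{\square}(12)=11$, and $S_{\square}(13)=13$. Moreover, for $n\in\{4,6,7,8,9,10,11,12\}$ every $n$-point set $P\subset\mathbb{R}^2$ with $S_{\square}(P)=S_{\square}(n)$ is, up to similarity, obtained by recursive $2$-extension starting from the unit square, and is similar to one of the following point sets (each of which attains $S_{\square}(n)$, and which are pairwise non-similar): \begin{itemize} \item $n=4$: $\{0,1\}^2$; \item $n=6$: $\{0,1,2\}\times\{0,1\}$, and $\{(0,2),(1,2),(0,1),(1,1),(2,1),(1,0)\}$; \item $n=7$: $(\{0,1,2\}\times\{1,2\})\cup\{(1,0)\}$, and $\{0,1,2\}^2\setminus\{(0,0),(2,2)\}$; \item $n=8$: $(\{1,2\}\times\{0,1,2\})\cup\{(0,1),(3,1)\}$, and $\{0,1,2\}^2\setminus\{(2,0)\}$; \item $n=9$: $\{0,1,2\}^2$; \item $n=10$: $\{0,1,2\}^2\cup\{(3,1)\}$; \item $n=11$: $\{0,1,2,3\}^2\setminus\{(0,0),(0,3),(3,0),(3,3),(2,0)\}$; $\{0,1,2\}^2\cup\{(3,1),(1,-1)\}$; $(\{0,1,2,3\}\times\{0,1,2\})\setminus\{(3,0)\}$; $\{0,1,2\}^2\cup\{(3,1),(2,-1)\}$; and $\{0,1,2\}^2\cup\{(-1,1),(3,1)\}$;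 \item $n=12$: $\{0,1,2,3\}^2\setminus\{(0,0),(0,3),(3,0),(3,3)\}$. \end{itemize}
   Context: An $n$-point set is a subset of $\mathbb{R}^2$ of cardinality $n$. For a finite set $P\subset\mathbb{R}^2$, $S_{\square}(P)$ denotes the number of squares contained in $P$, i.e. the number of $4$-element subsets of $P$ that are the vertex set of a (non-degenerate, arbitrarily oriented) square. $S_{\square}(n)$ denotes the maximum of $S_{\square}(P)$ over all $n$-point sets $P\subset\mathbb{R}^2$. A $2$-extension step applied to a point set $Q$ consists of choosing two distinct points $p_1,p_2\in Q$ and one of the three squares having both $p_1$ and $p_2$ as vertices (two with $p_1p_2$ as an edge, one with $p_1p_2$ as a diagonal), and adding to $Q$ the other two vertices of that square (one or both of which may already belong to $Q$). A set is obtained by recursive $2$-extension starting from the unit square if it arises from the vertex set of a unit square by a finite (possibly empty) sequence of $2$-extension steps. Two point sets are similar if one is mapped onto the other by a similarity of the plane (reflections allowed). *)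

theory Defs
  imports "HOL-Analysis.Analysis"
begin

text \<open>The plane is \<^typ>\<open>real \<times> real\<close>, whose library norm, distance and inner product
  are the Euclidean ones.\<close>

definition is_square :: "(real \<times> real) set \<Rightarrow> bool" where
  "is_square S \<longleftrightarrow> (\<exists>a u v. u \<noteq> 0 \<and> norm u = norm v \<and> u \<bullet> v = 0 \<and> S = {a, a + u, a + u + v, a + v})"

definition is_unit_square :: "(real \<times> real) set \<Rightarrow> bool" where
  "is_unit_square S \<longleftrightarrow> (\<exists>a u v. norm u = 1 \<and> norm v = 1 \<and> u \<bullet> v = 0 \<and> S = {a, a + u, a + u + v, a + v})"

definition num_squares :: "(real \<times> real) set \<Rightarrow> nat" where
  "num_squares P = card {S. S \<subseteq> P \<and> is_square S}"

definition max_squares :: "nat \<Rightarrow> nat" where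
  "max_squares n = Max {num_squares P | P. finite P \<and> card P = n}"

text \<open>The maximum is taken over a finite nonempty set, so \<^const>\<open>Max\<close> is well behaved.\<close>

lemma max_squares_wf:
  "finite {num_squares P | P. finite P \<and> card P = n}"
  "{num_squares P | P. finite P \<and> card P = n} \<noteq> {}"
proof -
  have "num_squares P \<le> 2 ^ n" if "finite P" "card P = n" for P
  proof -
    have "num_squares P \<le> card (Pow P)"
      unfolding num_squares_def using that by (intro card_mono) auto
    then show ?thesis using that by (simp add: card_Pow)
  qed
  then show "finite {num_squares P | P. finite P \<and> card P = n}"
    by (intro finite_subset[OF _ finite_atMost[of "2 ^ n"]]) auto
  have "infinite (UNIV :: (real \<times> real) set)"
    by (simp add: finite_prod infinite_UNIV_char_0)
  then obtain P :: "(real \<times> real) set" where "finite P" "card P = n"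
    by (metis infinite_arbitrarily_large)
  then show "{num_squares P | P. finite P \<and> card P = n} \<noteq> {}"
    by blast
qed

definition similarity :: "(real \<times> real \<Rightarrow> real \<times> real) \<Rightarrow> bool" where
  "similarity f \<longleftrightarrow> (\<exists>c>0. \<forall>x y. dist (f x) (f y) = c * dist x y)"

definition similar :: "(real \<times> real) set \<Rightarrow> (real \<times> real) set \<Rightarrow> bool" where
  "similar P Q \<longleftrightarrow> (\<exists>f. similarity f \<and> f ` P = Q)"

text \<open>The squares having two given distinct points among their vertices are exactly three: two with
  the points as an edge and one with them as a diagonal. So one step adds to \<open>Q\<close> the
  vertices of a square that has at least two vertices in \<open>Q\<close>.\<close>

definition two_extension_step :: "(real \<times> real) set \<Rightarrow> (real \<times> real) set \<Rightarrow> bool" where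
  "two_extension_step Q Q' \<longleftrightarrow>
     (\<exists>p\<^sub>1\<in>Q. \<exists>p\<^sub>2\<in>Q. \<exists>S. p\<^sub>1 \<noteq> p\<^sub>2 \<and> is_square S \<and> p\<^sub>1 \<in> S \<and> p\<^sub>2 \<in> S \<and> Q' = Q \<union> S)"

inductive recursively_extended :: "(real \<times> real) set \<Rightarrow> bool" where
  start: "is_unit_square S \<Longrightarrow> recursively_extended S"
| step: "recursively_extended Q \<Longrightarrow> two_extension_step Q Q' \<Longrightarrow> recursively_extended Q'"

definition extremal_configs :: "nat \<Rightarrow> (real \<times> real) set list" where
  "extremal_configs n =
    (if n = 4 then
       [{0, 1} \<times> {0, 1}]
     else if n = 6 then
       [{0, 1, 2} \<times> {0, 1},
        {(0, 2), (1, 2), (0, 1), (1, 1), (2, 1), (1, 0)}]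
     else if n = 7 then
       [{0, 1, 2} \<times> {1, 2} \<union> {(1, 0)},
        {0, 1, 2} \<times> {0, 1, 2} - {(0, 0), (2, 2)}]
     else if n = 8 then
       [{1, 2} \<times> {0, 1, 2} \<union> {(0, 1), (3, 1)},
        {0, 1, 2} \<times> {0, 1, 2} - {(2, 0)}]
     else if n = 9 then
       [{0, 1, 2} \<times> {0, 1, 2}]
     else if n = 10 then
       [{0, 1, 2} \<times> {0, 1, 2} \<union> {(3, 1)}]
     else if n = 11 then
       [{0, 1, 2, 3} \<times> {0, 1, 2, 3} - {(0, 0), (0, 3), (3, 0), (3, 3), (2, 0)},
        {0, 1, 2} \<times> {0, 1, 2} \<union> {(3, 1), (1, -1)},
        {0, 1, 2, 3} \<times> {0, 1, 2} - {(3, 0)},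
        {0, 1, 2} \<times> {0, 1, 2} \<union> {(3, 1), (2, -1)},
        {0, 1, 2} \<times> {0, 1, 2} \<union> {(-1, 1), (3, 1)}]
     else if n = 12 then
       [{0, 1, 2, 3} \<times> {0, 1, 2, 3} - {(0, 0), (0, 3), (3, 0), (3, 3)}]
     else [])"

end

(* Call two squares linked if they share two vertices. The point degrees of a set with many squares are
   too large for all pairs of squares to be unlinked (convexity), and a linked pair spans one of two
   six-point sets. All squares that meet a given set in two points can be enumerated, so that starting from
   these two sets one obtains finite lists of candidates up to similarity. Going from n - 1 to n points, one
   deletes a point of minimum degree, which is at most 4 S / n for a set with S squares; this shows that it suffices to know
   the sets with 9, 10, 11 and 12 points that have at least 5, 6, 7 and 10 squares, and every extension of
   these by one point, or by two points of a common square, is found by a finite computation over the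
   integers. *)
theory Submission
  imports Defs
begin

section \<open>The squares through given points\<close>

text \<open>A point that closes no square can be put anywhere, so finitely many sets up to
  similarity can only be expected above the maximum for one point fewer. This is the origin of the
  bounds 2, 3, 4 and 5 for six to nine points. For ten and eleven points the later deletions need
  the bounds 6 and 7, which equal the maxima for nine and ten points; the additional alternatives in
  \<open>classify10\<close> and \<open>classify11\<close> account for the free point. The bound 10
  for twelve points is what 14 squares on thirteen points leave after a deletion. The other obstacle
  is a square with at most one vertex in the set found so far, since such squares are not
  enumerable. They are excluded by counting: with three points left, two of them would share three
  vertices; with four left, three of them span a seven-point set of their own; with five left, a
  point is deleted in such a way that a linked pair survives. Integer arithmetic suffices because
  three integral vertices of a square make the fourth integral, and two make the others at worst
  half-integral.\<close>

definition rot :: "real \<times> real \<Rightarrow> real \<times> real" where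
  "rot p = (- snd p, fst p)"

text \<open>The vertices run counterclockwise from \<open>a\<close>. A nondegenerate square has
  exactly four such representations, one for each vertex.\<close>

definition sq :: "real \<times> real \<Rightarrow> real \<times> real \<Rightarrow> (real \<times> real) set" where
  "sq a u = {a, a + u, a + u + rot u, a + rot u}"

lemma rot_simps [simp]:
  "fst (rot p) = - snd p" "snd (rot p) = fst p"
  by (simp_all add: rot_def)

lemma rot_linear: "rot (p + q) = rot p + rot q" "rot (p - q) = rot p - rot q" "rot (- p) = - rot p"
  "rot (rot p) = - p"
  by (simp_all add: prod_eq_iff)

lemma norm_inner_rot:
  assumes "u \<noteq> (0 :: real \<times> real)" "norm u = norm v" "u \<bullet> v = 0"
  shows "v = rot u \<or> v = - rot u"
proof -
  obtain a b c d where uv: "u = (a, b)" "v = (c, d)" by (metis surj_pair)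
  have 1: "a\<^sup>2 + b\<^sup>2 = c\<^sup>2 + d\<^sup>2" using assms(2) by (simp add: uv norm_prod_def)
  have 2: "a * c + b * d = 0" using assms(3) by (simp add: uv inner_prod_def)
  have 3: "a\<^sup>2 + b\<^sup>2 > 0" using assms(1) by (simp add: uv sum_power2_gt_zero_iff zero_prod_def)
  have "(a * c)\<^sup>2 = (b * d)\<^sup>2" using 2 by (metis add_eq_0_iff power2_minus)
  \<comment> \<open>Adding the square of \<open>a * d\<close>, respectively of \<open>b * c\<close>,
    to both sides of the previous equation makes the two norms appear as factors.\<close>
  then have "d\<^sup>2 * (a\<^sup>2 + b\<^sup>2) = a\<^sup>2 * (c\<^sup>2 + d\<^sup>2)" "c\<^sup>2 * (a\<^sup>2 + b\<^sup>2) = b\<^sup>2 * (c\<^sup>2 + d\<^sup>2)"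
    by (simp_all add: algebra_simps power_mult_distrib)
  then have "d\<^sup>2 = a\<^sup>2" "c\<^sup>2 = b\<^sup>2" using 1 3 by auto
  then have cd: "d = a \<or> d = - a" "c = b \<or> c = - b" by (simp_all add: power2_eq_iff)
  have "a * c = - (b * d)" using 2 by simp
  then show ?thesis using cd 3 by (auto simp: uv prod_eq_iff)
qed

lemma rot_eq_0_iff [simp]: "rot u = 0 \<longleftrightarrow> u = 0"
  by (auto simp: prod_eq_iff)

lemma is_square_iff: "is_square S \<longleftrightarrow> (\<exists>a u. u \<noteq> 0 \<and> S = sq a u)"
proof
  assume "is_square S"
  then obtain a u v where uv: "u \<noteq> 0" "norm u = norm v" "u \<bullet> v = 0" "S = {a, a + u, a + u + v, a + v}"
    by (auto simp: is_square_def)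
  from norm_inner_rot[OF uv(1-3)] show "\<exists>a u. u \<noteq> 0 \<and> S = sq a u"
  proof
    assume "v = rot u"
    then show ?thesis using uv unfolding sq_def by blast
  next
    assume v: "v = - rot u"
    \<comment> \<open>A square to the right of the edge \<open>u\<close> lies to the left of its
      opposite edge, which starts at \<open>a - rot u\<close> and has the same direction.\<close>
    have "S = sq (a - rot u) u" unfolding uv(4) v sq_def by (auto simp: prod_eq_iff)
    then show ?thesis using uv(1) by blast
  qed
next
  assume "\<exists>a u. u \<noteq> 0 \<and> S = sq a u"
  then obtain a u where "u \<noteq> 0" "S = sq a u" by blast
  moreover have "norm u = norm (rot u)" by (simp add: norm_prod_def)
  moreover have "u \<bullet> rot u = 0" by (simp add: inner_prod_def)
  ultimately show "is_square S" unfolding is_square_def sq_def by blast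
qed

lemma is_square_sq: "u \<noteq> 0 \<Longrightarrow> is_square (sq a u)"
  using is_square_iff by blast

text \<open>The remaining representations of a square: passing to the next vertex turns the edge
  vector by a right angle.\<close>

lemma sq_turn: "sq a u = sq (a + u) (rot u)" "sq a u = sq (a + u + rot u) (- u)" "sq a u = sq (a + rot u) (- rot u)"
  by (auto simp: sq_def prod_eq_iff)

lemma card_sq: "u \<noteq> 0 \<Longrightarrow> card (sq a u) = 4"
proof -
  assume "u \<noteq> 0"
  then have "fst u \<noteq> 0 \<or> snd u \<noteq> 0" by (simp add: prod_eq_iff)
  then have "distinct [a, a + u, a + u + rot u, a + rot u]" by (auto simp: prod_eq_iff)
  then have "card (set [a, a + u, a + u + rot u, a + rot u]) = 4" by (subst distinct_card) simp_all
  then show ?thesis by (simp add: sq_def)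
qed

lemma card_square: "is_square S \<Longrightarrow> card S = 4"
  by (auto simp: is_square_iff card_sq)

lemma finite_square: "is_square S \<Longrightarrow> finite S"
  by (auto simp: is_square_iff sq_def)

lemma square_at:
  assumes "is_square S" "p \<in> S" obtains u where "u \<noteq> 0" "S = sq p u"
proof -
  obtain a u where u: "u \<noteq> 0" and S: "S = sq a u" using assms by (auto simp: is_square_iff)
  then consider "p = a" | "p = a + u" | "p = a + u + rot u" | "p = a + rot u"
    using assms by (auto simp: sq_def)
  then show thesis
  proof cases
    case 1 then show thesis using that[of u] u S by simp
  next
    case 2 then show thesis using that[of "rot u"] u S sq_turn(1)[of a u] by simp
  next
    case 3 then show thesis using that[of "- u"] u S sq_turn(2)[of a u] by simp
  next
    case 4 then show thesis using that[of "- rot u"] u S sq_turn(3)[of a u] by simp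
  qed
qed

text \<open>This normal form fits completions: the point to be added lies opposite the base, as in
  \<open>fourth\<close>.\<close>

lemma square_opposite:
  assumes "is_square S" "p \<in> S" obtains a u where "u \<noteq> 0" "S = sq a u" "p = a + u + rot u"
proof -
  obtain u where u: "u \<noteq> 0" "S = sq p u" using square_at assms by blast
  then show thesis using sq_turn(2)[of p u] by (intro that[of "- u" "p + u + rot u"]) (auto simp: rot_linear)
qed

text \<open>Seen from \<open>p\<close>, the point \<open>q\<close> is the next, the previous or the
  opposite vertex. Only in the last case do halves occur: the other vertices are the midpoint plus
  or minus half of the turned diagonal.\<close>

lemma square_through_two:
  assumes "is_square S" "p \<in> S" "q \<in> S" "p \<noteq> q"
  shows "S = {p, q, p + rot (q - p), q + rot (q - p)} \<or>
    S = {p, q, p - rot (q - p), q - rot (q - p)} \<or>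
    S = {p, q, (1/2) *\<^sub>R (p + q + rot (q - p)), (1/2) *\<^sub>R (p + q - rot (q - p))}"
proof -
  obtain u where u: "u \<noteq> 0" "S = sq p u" using square_at assms by blast
  then consider "q = p + u" | "q = p + u + rot u" | "q = p + rot u" using assms by (auto simp: sq_def)
  then show ?thesis
  proof cases
    case 1
    then have "q - p = u" by simp
    then show ?thesis unfolding u sq_def by (intro disjI1) (simp add: 1 insert_commute)
  next
    case 2
    have "(1/2) *\<^sub>R (p + q + rot (q - p)) = p + rot u" "(1/2) *\<^sub>R (p + q - rot (q - p)) = p + u"
      by (simp_all add: 2 prod_eq_iff)
    then show ?thesis unfolding u sq_def by (intro disjI2) (simp add: 2 insert_commute)
  next
    case 3
    then have "p - rot (q - p) = p + u" "q - rot (q - p) = p + u + rot u" by (simp_all add: prod_eq_iff)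
    then show ?thesis unfolding u sq_def by (rule_tac disjI2, rule_tac disjI1) (simp only: 3 insert_commute)
  qed
qed

text \<open>Three vertices of a square form an isosceles right triangle, and this leaves no choice
  for the fourth.\<close>

lemma sq_eq_of_three:
  assumes "q \<in> sq p u" "r \<in> sq p u" "q \<in> sq p w" "r \<in> sq p w" "p \<noteq> q" "p \<noteq> r" "q \<noteq> r"
  shows "u = w"
proof -
  obtain u1 u2 where u: "u = (u1, u2)" by (rule prod.exhaust)
  obtain w1 w2 where w: "w = (w1, w2)" by (rule prod.exhaust)
  define x where "x = fst q - fst p" define y where "y = snd q - snd p"
  define z where "z = fst r - fst p" define t where "t = snd r - snd p"
  \<comment> \<open>The six ways in which \<open>q - p\<close> and \<open>r - p\<close> can be two
    different ones among \<open>u\<close>, \<open>u + rot u\<close> and \<open>rot u\<close>, for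
    \<open>u = (a, b)\<close>. Comparing two such descriptions is linear arithmetic.\<close>
  define places where "places a b \<longleftrightarrow>
    (x = a \<and> y = b \<and> z = a - b \<and> t = b + a) \<or> (x = a \<and> y = b \<and> z = - b \<and> t = a)
    \<or> (x = a - b \<and> y = b + a \<and> z = a \<and> t = b) \<or> (x = a - b \<and> y = b + a \<and> z = - b \<and> t = a)
    \<or> (x = - b \<and> y = a \<and> z = a \<and> t = b) \<or> (x = - b \<and> y = a \<and> z = a - b \<and> t = b + a)" for a b
  have pl: "places a b" if "q \<in> sq p (a, b)" "r \<in> sq p (a, b)" for a b
  proof -
    have "q = p + (a, b) \<or> q = p + (a, b) + rot (a, b) \<or> q = p + rot (a, b)"
      "r = p + (a, b) \<or> r = p + (a, b) + rot (a, b) \<or> r = p + rot (a, b)"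
      using that assms(5,6) by (auto simp: sq_def)
    then show ?thesis using assms(7)
      unfolding places_def x_def y_def z_def t_def by (elim disjE) simp_all
  qed
  have "places u1 u2" "places w1 w2" using pl assms u w by blast+
  then have "u1 = w1 \<and> u2 = w2"
    unfolding places_def by (elim disjE conjE) (intro conjI; linarith)+
  then show ?thesis by (simp add: u w)
qed

lemma card_square_Int:
  assumes "is_square S" "is_square T" "S \<noteq> T"
  shows "card (S \<inter> T) \<le> 2"
proof (rule ccontr)
  assume "\<not> ?thesis"
  then have "3 \<le> card (S \<inter> T)" by simp
  then obtain X where "X \<subseteq> S \<inter> T" "card X = 3" by (meson obtain_subset_with_card_n)
  then obtain p q r where X: "{p, q, r} \<subseteq> S \<inter> T" "p \<noteq> q" "p \<noteq> r" "q \<noteq> r"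
    unfolding card_3_iff by blast
  then have in_S: "p \<in> S" "q \<in> S" "r \<in> S" and in_T: "p \<in> T" "q \<in> T" "r \<in> T" by auto
  obtain u where u: "S = sq p u" using square_at[OF assms(1) in_S(1)] by metis
  obtain w where w: "T = sq p w" using square_at[OF assms(2) in_T(1)] by metis
  have "u = w" using sq_eq_of_three in_S in_T X(2-4) u w by metis
  then show False using assms u w by simp
qed

section \<open>Counting squares\<close>

definition sqs :: "(real \<times> real) set \<Rightarrow> (real \<times> real) set set" where
  "sqs P = {S. S \<subseteq> P \<and> is_square S}"

lemma num_squares_sqs: "num_squares P = card (sqs P)"
  by (simp add: num_squares_def sqs_def)

lemma finite_sqs: "finite P \<Longrightarrow> finite (sqs P)"
  unfolding sqs_def by (rule finite_subset[of _ "Pow P"]) auto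

lemma num_squares_mono: "finite P \<Longrightarrow> A \<subseteq> P \<Longrightarrow> num_squares A \<le> num_squares P"
  unfolding num_squares_sqs by (intro card_mono finite_sqs) (auto simp: sqs_def)

definition deg :: "(real \<times> real) set \<Rightarrow> real \<times> real \<Rightarrow> nat" where
  "deg P p = card {S \<in> sqs P. p \<in> S}"

lemma num_squares_remove:
  assumes "finite P"
  shows "num_squares P = num_squares (P - {p}) + deg P p"
proof -
  have "sqs P = sqs (P - {p}) \<union> {S \<in> sqs P. p \<in> S}" by (auto simp: sqs_def)
  moreover have "sqs (P - {p}) \<inter> {S \<in> sqs P. p \<in> S} = {}" by (auto simp: sqs_def)
  ultimately show ?thesis
    unfolding num_squares_sqs deg_def using assms finite_sqs
    by (metis card_Un_disjoint finite_Diff finite_Un)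
qed

lemma sum_indicator_card:
  "finite A \<Longrightarrow> (\<Sum>x\<in>A. if Q x then 1 else 0) = card {x \<in> A. Q x}"
  by (simp flip: sum.inter_filter)

lemma sum_card_incidence:
  assumes "finite P" "finite F"
  shows "(\<Sum>p\<in>P. card {S \<in> F. p \<in> S}) = (\<Sum>S\<in>F. card (S \<inter> P))"
proof -
  have "(\<Sum>p\<in>P. card {S \<in> F. p \<in> S}) = (\<Sum>p\<in>P. \<Sum>S\<in>F. if p \<in> S then 1 else 0)"
    using assms(2) by (simp add: sum_indicator_card)
  also have "\<dots> = (\<Sum>S\<in>F. \<Sum>p\<in>P. if p \<in> S then 1 else 0)" by (rule sum.swap)
  also have "\<dots> = (\<Sum>S\<in>F. card (S \<inter> P))"
    using assms(1) by (intro sum.cong refl) (simp add: sum_indicator_card Int_def conj_commute)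
  finally show ?thesis .
qed

lemma sum_deg:
  assumes "finite P"
  shows "(\<Sum>p\<in>P. deg P p) = 4 * num_squares P"
proof -
  have "(\<Sum>p\<in>P. deg P p) = (\<Sum>S\<in>sqs P. card (S \<inter> P))"
    unfolding deg_def using sum_card_incidence[OF assms finite_sqs[OF assms]] .
  also have "\<dots> = (\<Sum>S\<in>sqs P. 4)"
    by (intro sum.cong) (auto simp: sqs_def Int_absorb2 card_square)
  finally show ?thesis by (simp add: num_squares_sqs)
qed

lemma low_degree:
  assumes "finite P" "P \<noteq> {}"
  obtains p where "p \<in> P" "card P * deg P p \<le> 4 * num_squares P"
proof -
  have "\<exists>p\<in>P. card P * deg P p \<le> 4 * num_squares P"
  proof (rule ccontr)
    assume "\<not> ?thesis"
    then have "\<forall>p\<in>P. 4 * num_squares P < card P * deg P p" by auto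
    then have "(\<Sum>p\<in>P. 4 * num_squares P) < (\<Sum>p\<in>P. card P * deg P p)"
      using assms by (intro sum_strict_mono) auto
    then show False using sum_deg[OF assms(1)] by (simp flip: sum_distrib_left)
  qed
  then show thesis using that by blast
qed

definition linked :: "(real \<times> real) set \<Rightarrow> bool" where
  "linked P \<longleftrightarrow> (\<exists>S\<in>sqs P. \<exists>T\<in>sqs P. S \<noteq> T \<and> 2 \<le> card (S \<inter> T))"

text \<open>Both sides count a point of \<open>P\<close> together with an ordered pair of squares
  through it. Intersecting with \<open>P\<close> admits squares that are not contained in
  \<open>P\<close>; this is used when \<open>P\<close> consists of the points outside a linked
  pair.\<close>

lemma sum_sq_incidence:
  assumes "finite P" "finite F"
  shows "(\<Sum>p\<in>P. (card {S \<in> F. p \<in> S})\<^sup>2) = (\<Sum>S\<in>F. \<Sum>T\<in>F. card (S \<inter> T \<inter> P))"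
proof -
  have c: "card {S \<in> F. p \<in> S} = (\<Sum>S\<in>F. if p \<in> S then 1 else 0)" for p
    using assms(2) by (simp add: sum_indicator_card)
  have "(\<Sum>p\<in>P. (card {S \<in> F. p \<in> S})\<^sup>2) = (\<Sum>p\<in>P. \<Sum>S\<in>F. \<Sum>T\<in>F. if p \<in> S \<inter> T then 1 else 0)"
    unfolding c power2_eq_square sum_product by (intro sum.cong) auto
  also have "\<dots> = (\<Sum>S\<in>F. \<Sum>T\<in>F. \<Sum>p\<in>P. if p \<in> S \<inter> T then 1 else 0)"
    by (subst sum.swap, rule sum.cong[OF refl], subst sum.swap) simp
  also have "\<dots> = (\<Sum>S\<in>F. \<Sum>T\<in>F. card (S \<inter> T \<inter> P))"
    using assms(1) by (intro sum.cong refl) (simp add: sum_indicator_card Int_def conj_commute conj_left_commute)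
  finally show ?thesis .
qed

lemma sum_pairs_le:
  fixes f :: "'a \<Rightarrow> 'a \<Rightarrow> nat"
  assumes "finite F" "\<And>S T. S \<in> F \<Longrightarrow> T \<in> F \<Longrightarrow> S \<noteq> T \<Longrightarrow> f S T \<le> 1"
  shows "(\<Sum>S\<in>F. \<Sum>T\<in>F. f S T) \<le> (\<Sum>S\<in>F. f S S) + card F * (card F - 1)"
proof -
  have "(\<Sum>T\<in>F. f S T) \<le> f S S + (card F - 1)" if "S \<in> F" for S
  proof -
    have "(\<Sum>T\<in>F. f S T) = f S S + (\<Sum>T\<in>F - {S}. f S T)" using assms(1) that by (rule sum.remove)
    also have "(\<Sum>T\<in>F - {S}. f S T) \<le> (\<Sum>T\<in>F - {S}. 1)" using assms that by (intro sum_mono) auto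
    finally show ?thesis using that assms(1) by simp
  qed
  then have "(\<Sum>S\<in>F. \<Sum>T\<in>F. f S T) \<le> (\<Sum>S\<in>F. f S S + (card F - 1))" by (rule sum_mono)
  then show ?thesis by (simp add: sum.distrib)
qed

text \<open>The degrees \<open>d\<close> satisfy \<open>0 \<le> (\<Sum>p\<in>P. (d p - k) * (d p - k - 1))\<close>, while without a
  linked pair the sum of their squares counts at most one point for each ordered pair of squares.\<close>

lemma linked_if_many:
  assumes "finite P" "card P = n" "m \<le> num_squares P"
    and "4 * m + m * (m - 1) + k * (k + 1) * n < (2 * k + 1) * (4 * m)"
  shows "linked P"
proof (rule ccontr)
  assume nl: "\<not> linked P"
  \<comment> \<open>The numerical assumption is about \<open>m\<close>, so exactly \<open>m\<close>
    squares are retained and the degrees below count only these.\<close>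
  obtain F where F: "F \<subseteq> sqs P" "card F = m"
    using assms(3) unfolding num_squares_sqs by (meson obtain_subset_with_card_n)
  then have fin: "finite F" using finite_sqs[OF assms(1)] finite_subset by blast
  define d where "d p = card {S \<in> F. p \<in> S}" for p
  have sub: "S \<subseteq> P" "card S = 4" if "S \<in> F" for S using that F by (auto simp: sqs_def card_square)
  have s1: "(\<Sum>p\<in>P. d p) = 4 * m"
  proof -
    have "(\<Sum>p\<in>P. d p) = (\<Sum>S\<in>F. card (S \<inter> P))" unfolding d_def using sum_card_incidence assms fin by blast
    also have "\<dots> = (\<Sum>S\<in>F. 4)" by (intro sum.cong) (auto simp: sub Int_absorb2)
    finally show ?thesis using F by simp
  qed
  have s2: "(\<Sum>p\<in>P. (d p)\<^sup>2) \<le> 4 * m + m * (m - 1)"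
  proof -
    have "(\<Sum>p\<in>P. (d p)\<^sup>2) = (\<Sum>S\<in>F. \<Sum>T\<in>F. card (S \<inter> T \<inter> P))"
      unfolding d_def using sum_sq_incidence assms fin by blast
    also have "\<dots> \<le> (\<Sum>S\<in>F. card (S \<inter> S \<inter> P)) + card F * (card F - 1)"
    proof (rule sum_pairs_le[OF fin])
      fix S T assume "S \<in> F" "T \<in> F" "S \<noteq> T"
      then have "\<not> 2 \<le> card (S \<inter> T)" using nl F unfolding linked_def by blast
      moreover have "S \<inter> T \<inter> P = S \<inter> T" using sub \<open>S \<in> F\<close> by blast
      ultimately show "card (S \<inter> T \<inter> P) \<le> 1" by simp
    qed
    also have "(\<Sum>S\<in>F. card (S \<inter> S \<inter> P)) = (\<Sum>S\<in>F. 4)" by (intro sum.cong) (auto simp: sub Int_absorb2)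
    finally show ?thesis using F by simp
  qed
  have "0 \<le> (\<Sum>p\<in>P. (int (d p) - int k) * (int (d p) - int k - 1))"
  proof (rule sum_nonneg)
    fix p
    have "int (d p) - int k \<le> 0 \<or> int (d p) - int k - 1 \<ge> 0" by linarith
    then show "0 \<le> (int (d p) - int k) * (int (d p) - int k - 1)"
      by (auto intro: mult_nonneg_nonneg mult_nonpos_nonpos)
  qed
  also have "\<dots> = (\<Sum>p\<in>P. int ((d p)\<^sup>2) - (2 * int k + 1) * int (d p) + int k * (int k + 1))"
    by (intro sum.cong) (auto simp: algebra_simps power2_eq_square)
  also have "\<dots> = int (\<Sum>p\<in>P. (d p)\<^sup>2) - (2 * int k + 1) * int (\<Sum>p\<in>P. d p) + int k * (int k + 1) * int n"
    using assms(2) by (simp add: sum.distrib sum_subtractf sum_distrib_left)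
  also have "\<dots> \<le> int (4 * m + m * (m - 1)) - (2 * int k + 1) * int (4 * m) + int k * (int k + 1) * int n"
    using s2 unfolding s1 by (simp only: of_nat_le_iff add_le_cancel_right diff_right_mono)
  finally have "(2 * int k + 1) * int (4 * m) \<le> int (4 * m + m * (m - 1)) + int k * (int k + 1) * int n" by simp
  then have "int ((2 * k + 1) * (4 * m)) \<le> int (4 * m + m * (m - 1) + k * (k + 1) * n)" by (simp only: of_nat_add of_nat_mult of_nat_numeral of_nat_1)
  then show False using assms(4) by (simp only: of_nat_le_iff)
qed

section \<open>Similarities\<close>

text \<open>A similarity is only required here to come with the two properties used below, so that
  closure under composition and inverses is immediate.\<close>

definition nice :: "(real \<times> real \<Rightarrow> real \<times> real) \<Rightarrow> bool" where
  "nice g \<longleftrightarrow> bij g \<and> similarity g \<and> (\<forall>S. is_square (g ` S) \<longleftrightarrow> is_square S)"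

lemma nice_comp:
  assumes "nice f" "nice g"
  shows "nice (f \<circ> g)"
proof -
  obtain c d where "c > 0" "\<forall>x y. dist (f x) (f y) = c * dist x y"
    "d > 0" "\<forall>x y. dist (g x) (g y) = d * dist x y"
    using assms unfolding nice_def similarity_def by blast
  then have "similarity (f \<circ> g)"
    unfolding similarity_def o_def by (metis mult.assoc mult_pos_pos)
  then show ?thesis using assms unfolding nice_def by (metis bij_comp image_comp)
qed

lemma nice_inv:
  assumes "nice f"
  shows "nice (inv f)"
proof -
  have bij: "bij f" using assms by (simp add: nice_def)
  obtain c where c: "c > 0" "\<forall>x y. dist (f x) (f y) = c * dist x y"
    using assms unfolding nice_def similarity_def by blast
  have "dist (inv f x) (inv f y) = (1 / c) * dist x y" for x y
  proof -
    have "dist x y = c * dist (inv f x) (inv f y)" using c(2) bij by (metis bij_inv_eq_iff)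
    then show ?thesis using c(1) by simp
  qed
  then have "similarity (inv f)" unfolding similarity_def using c(1) by (metis zero_less_divide_1_iff)
  moreover have "is_square (inv f ` S) \<longleftrightarrow> is_square S" for S
    using assms unfolding nice_def by (metis bij image_f_inv_f bij_is_surj)
  ultimately show ?thesis using bij by (simp add: nice_def bij_imp_bij_inv)
qed

text \<open>With \<open>c = a + b i\<close> and \<open>d = t + r i\<close> this is the complex map
  sending \<open>z\<close> to \<open>c z + d\<close> if \<open>s = 1\<close>, and to
  \<open>c\<close> times the conjugate of \<open>z\<close>, plus \<open>d\<close>, if
  \<open>s = -1\<close>.\<close>

definition aff :: "real \<Rightarrow> real \<Rightarrow> real \<Rightarrow> real \<Rightarrow> real \<Rightarrow> real \<times> real \<Rightarrow> real \<times> real" where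
  "aff a b s t r p = (a * fst p - s * (b * snd p) + t, b * fst p + s * (a * snd p) + r)"

lemma similarity_aff:
  assumes "a \<noteq> 0 \<or> b \<noteq> 0" "s = 1 \<or> s = -1"
  shows "similarity (aff a b s t r)"
proof -
  have "dist (aff a b s t r p) (aff a b s t r q) = sqrt (a\<^sup>2 + b\<^sup>2) * dist p q" for p q
  proof -
    define x y where "x = fst p - fst q" and "y = snd p - snd q"
    have "(a * x - s * (b * y))\<^sup>2 + (b * x + s * (a * y))\<^sup>2 = (a\<^sup>2 + b\<^sup>2) * (x\<^sup>2 + y\<^sup>2)"
      using assms(2) by (auto simp: power2_eq_square algebra_simps)
    then show ?thesis
      unfolding x_def y_def dist_prod_def aff_def dist_real_def
      by (simp add: algebra_simps flip: real_sqrt_mult)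
  qed
  moreover have "sqrt (a\<^sup>2 + b\<^sup>2) > 0" using assms(1) by (auto simp: sum_power2_gt_zero_iff)
  ultimately show ?thesis unfolding similarity_def by blast
qed

lemma is_square_aff:
  assumes "a \<noteq> 0 \<or> b \<noteq> 0" "s = 1 \<or> s = -1" "is_square S"
  shows "is_square (aff a b s t r ` S)"
proof -
  obtain p u where u: "u \<noteq> 0" "S = sq p u" using assms(3) is_square_iff by blast
  define w where "w = aff a b s 0 0 u"
  have w: "w \<noteq> 0"
  proof
    assume "w = 0"
    then have "a * fst u = s * (b * snd u)" "b * fst u = - (s * (a * snd u))"
      by (auto simp: w_def aff_def prod_eq_iff)
    \<comment> \<open>Eliminating one coordinate leaves the other one multiplied by the determinant
      of the linear part, up to the sign \<open>s\<close>.\<close>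
    then have "(a\<^sup>2 + b\<^sup>2) * fst u = 0" "s * ((a\<^sup>2 + b\<^sup>2) * snd u) = 0"
      by (algebra, algebra)
    moreover have "a\<^sup>2 + b\<^sup>2 \<noteq> 0" using assms(1) by (simp add: sum_power2_eq_zero_iff)
    ultimately show False using u(1) assms(2) by (auto simp: prod_eq_iff)
  qed
  show ?thesis
  proof (cases "s = 1")
    case True
    have "aff a b s t r ` S = sq (aff a b s t r p) w"
      unfolding u(2) sq_def w_def image_insert image_empty
      by (simp add: aff_def rot_def True algebra_simps)
    then show ?thesis using w is_square_sq by metis
  next
    case False
    then have s: "s = -1" using assms(2) by simp
    \<comment> \<open>A reflection reverses the orientation, so the image lies to the right of
      \<open>w\<close> and has to be based at a neighbouring vertex.\<close>
    have "aff a b s t r ` S = {aff a b s t r p, aff a b s t r p + w, aff a b s t r p + w - rot w, aff a b s t r p - rot w}"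
      unfolding u(2) sq_def w_def image_insert image_empty
      by (simp add: aff_def rot_def s algebra_simps)
    also have "\<dots> = sq (aff a b s t r p - rot w) w"
      unfolding sq_def by (simp add: insert_commute algebra_simps)
    finally show ?thesis using w is_square_sq by metis
  qed
qed

lemma nice_aff:
  assumes "a \<noteq> 0 \<or> b \<noteq> 0" "s = 1 \<or> s = -1"
  shows "nice (aff a b s t r)"
proof -
  define n where "n = a\<^sup>2 + b\<^sup>2"
  have n: "n \<noteq> 0" using assms(1) by (simp add: n_def sum_power2_eq_zero_iff)
  \<comment> \<open>The inverse has the same form: subtract the translation, divide by
    \<open>a + b i\<close> (hence \<open>n\<close>, its squared modulus), and conjugate if
    \<open>s = -1\<close>.\<close>
  define g where "g = aff (a / n) (- s * b / n) s (- (a * t + b * r) / n) (- s * (a * r - b * t) / n)"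
  have 1: "g (aff a b s t r p) = p" for p
  proof -
    have "(a * (a * fst p - s * (b * snd p) + t) + b * (b * fst p + s * (a * snd p) + r)) = n * fst p + (a * t + b * r)"
      "s * (a * (b * fst p + s * (a * snd p) + r) - b * (a * fst p - s * (b * snd p) + t)) = n * snd p + s * (a * r - b * t)"
      using assms(2) by (auto simp: n_def power2_eq_square algebra_simps)
    then show ?thesis using n assms(2) unfolding g_def aff_def
      by (auto simp: prod_eq_iff divide_simps)
  qed
  have 2: "aff a b s t r (g p) = p" for p
    using n assms(2) unfolding g_def aff_def
    by (auto simp: prod_eq_iff divide_simps) (auto simp: n_def power2_eq_square algebra_simps)
  have "bij (aff a b s t r)" using 1 2 by (intro o_bij[of g]) auto
  moreover have "is_square (aff a b s t r ` S) \<longleftrightarrow> is_square S" for S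
  proof
    assume "is_square (aff a b s t r ` S)"
    moreover have "a / n \<noteq> 0 \<or> - s * b / n \<noteq> 0" using assms n by auto
    ultimately have "is_square (g ` aff a b s t r ` S)" unfolding g_def using assms(2) is_square_aff by blast
    then show "is_square S" by (simp add: image_comp o_def 1)
  qed (use assms is_square_aff in blast)
  ultimately show ?thesis using similarity_aff[OF assms] by (simp add: nice_def)
qed

lemma num_squares_nice:
  assumes "nice g"
  shows "num_squares (g ` A) = num_squares A"
proof -
  have inj: "inj g" and sq: "\<And>S. is_square (g ` S) \<longleftrightarrow> is_square S"
    using assms by (auto simp: nice_def bij_is_inj)
  have "sqs (g ` A) = image g ` sqs A"
  proof (intro equalityI subsetI)
    fix T assume "T \<in> sqs (g ` A)"
    then have T: "T \<subseteq> g ` A" "is_square T" by (auto simp: sqs_def)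
    then obtain S where "S \<subseteq> A" "T = g ` S" by (auto simp: subset_image_iff)
    then show "T \<in> image g ` sqs A" using T sq by (auto simp: sqs_def)
  next
    fix T assume "T \<in> image g ` sqs A"
    then show "T \<in> sqs (g ` A)" using sq by (auto simp: sqs_def)
  qed
  moreover have "inj_on (image g) (sqs A)" using inj by (auto simp: inj_on_def inj_image_eq_iff)
  ultimately show ?thesis unfolding num_squares_sqs by (simp add: card_image)
qed

section \<open>Integral point lists\<close>

type_synonym ipt = "int \<times> int"

text \<open>In the functions below, nested conditionals replace conjunctions, since the simplifier then does
  not evaluate the remaining tests after a failed one.\<close>

fun mem :: "int \<Rightarrow> int \<Rightarrow> ipt list \<Rightarrow> bool" where
  "mem x y [] \<longleftrightarrow> False"
| "mem x y ((a, b) # Q) \<longleftrightarrow> (if a = x then if b = y then True else mem x y Q else mem x y Q)"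

text \<open>Exactly one of the four edge vectors of a square lies in the half-open quadrant
  \<open>u > 0\<close>, \<open>v \<ge> 0\<close>. Each square is therefore counted at a single
  ordered pair.\<close>

definition based :: "ipt list \<Rightarrow> ipt \<Rightarrow> ipt \<Rightarrow> bool" where
  "based Q p q = (case p of (a, b) \<Rightarrow> case q of (c, d) \<Rightarrow> let u = c - a; v = d - b in
     if u > 0 then if v \<ge> 0 then if mem (a - v) (b + u) Q then mem (c - v) (d + u) Q
     else False else False else False)"

definition sqcount :: "ipt list \<Rightarrow> nat" where
  "sqcount Q = length (concat (map (\<lambda>p. filter (based Q p) Q) Q))"

definition fourth :: "ipt list \<Rightarrow> ipt \<Rightarrow> ipt \<Rightarrow> ipt list" where
  "fourth Q p q = (case p of (a, b) \<Rightarrow> case q of (c, d) \<Rightarrow> let u = c - a; v = d - b in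
     if (if u = 0 then v = 0 else False) then []
     else if mem (a - v) (b + u) Q
       then if mem (c - v) (d + u) Q then [] else [(c - v, d + u)] else [])"

text \<open>Repetitions are kept on purpose: the multiplicity of a point bounds the number of
  squares that it closes.\<close>

definition completions :: "ipt list \<Rightarrow> ipt list" where
  "completions Q = concat (map (\<lambda>p. concat (map (fourth Q p) Q)) Q)"

definition dbl :: "ipt list \<Rightarrow> ipt list" where
  "dbl Q = map (\<lambda>(x, y). (2 * x, 2 * y)) Q"

text \<open>One summand for each of the three squares through \<open>p\<close> and \<open>q\<close>,
  testing its other two vertices. In the diagonal case these are halves of integral sums, so the
  sums are looked up in the doubled list.\<close>

definition bridges :: "ipt list \<Rightarrow> ipt \<Rightarrow> ipt \<Rightarrow> nat" where
  "bridges Q p q = (case p of (a, b) \<Rightarrow> case q of (c, d) \<Rightarrow> let u = c - a; v = d - b in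
     (if mem (a - v) (b + u) Q then if mem (c - v) (d + u) Q then 1 else 0 else 0)
     + ((if mem (a + v) (b - u) Q then if mem (c + v) (d - u) Q then 1 else 0 else 0)
     + (if mem (a + c - v) (b + d + u) (dbl Q) then
          if mem (a + c + v) (b + d - u) (dbl Q) then 1 else 0 else 0)))"

fun pairs :: "'a list \<Rightarrow> ('a \<times> 'a) list" where
  "pairs [] = []"
| "pairs (x # xs) = map (Pair x) xs @ pairs xs"

text \<open>Unordered pairs suffice, since exchanging the two points only exchanges the squares on
  the two sides. The results are in doubled coordinates. Squares that add just one point are
  discarded here, as \<open>completions\<close> produces them.\<close>

definition new_pairs :: "ipt list \<Rightarrow> (ipt \<times> ipt) list" where
  "new_pairs Q = (let Q2 = dbl Q in concat (map (\<lambda>((a, b), (c, d)).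
     let u = c - a; v = d - b in
     filter (\<lambda>((x, y), (z, w)). if mem x y Q2 then False else \<not> mem z w Q2)
       [((2 * a - 2 * v, 2 * b + 2 * u), (2 * c - 2 * v, 2 * d + 2 * u)),
        ((2 * a + 2 * v, 2 * b - 2 * u), (2 * c + 2 * v, 2 * d - 2 * u)),
        ((a + c - v, b + d + u), (a + c + v, b + d - u))]) (pairs Q)))"

text \<open>The filter bounds the number of squares from above, so no extension with at least
  \<open>m\<close> squares is lost. A point that closes several squares occurs several times, hence
  the repeated certificates in the tables.\<close>

definition one_ext :: "nat \<Rightarrow> ipt list \<Rightarrow> ipt list list" where
  "one_ext m Q = (let C = completions Q; k = sqcount Q in
     map (\<lambda>v. Q @ [v]) (filter (\<lambda>v. m \<le> k + count_list C v) C))"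

definition two_ext :: "nat \<Rightarrow> ipt list \<Rightarrow> ipt list list" where
  "two_ext m Q = (let Q2 = dbl Q; C = completions Q2; k = sqcount Q in
     map (\<lambda>(v, w). Q2 @ [v, w])
       (filter (\<lambda>(v, w). m \<le> k + count_list C v + count_list C w + bridges Q2 v w) (new_pairs Q)))"

text \<open>For the situation that every further square uses both new points: neither of them may
  close a square with old points alone, and only the bridges add to the count.\<close>

definition two_ext_iso :: "nat \<Rightarrow> ipt list \<Rightarrow> ipt list list" where
  "two_ext_iso m Q = (let Q2 = dbl Q; C = completions Q2; k = sqcount Q in
     map (\<lambda>(v, w). Q2 @ [v, w])
       (filter (\<lambda>(v, w). if count_list C v = 0 then if count_list C w = 0
          then m \<le> k + bridges Q2 v w else False else False) (new_pairs Q)))"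

definition image_point :: "int \<Rightarrow> int \<Rightarrow> int \<Rightarrow> int \<Rightarrow> int \<Rightarrow> ipt \<Rightarrow> ipt" where
  "image_point a b s t r p = (case p of (x, y) \<Rightarrow> (a * x - s * (b * y) + t, b * x + s * (a * y) + r))"

section \<open>The embedding of integral lists into the plane\<close>

lemma mem_iff: "mem x y Q \<longleftrightarrow> (x, y) \<in> set Q"
  by (induction Q) (auto split: if_splits)

definition emb :: "ipt \<Rightarrow> real \<times> real" where
  "emb p = (real_of_int (fst p), real_of_int (snd p))"

definition pts :: "ipt list \<Rightarrow> (real \<times> real) set" where
  "pts Q = emb ` set Q"

definition irot :: "ipt \<Rightarrow> ipt" where
  "irot p = (- snd p, fst p)"

lemma emb_eq_iff [simp]: "emb p = emb q \<longleftrightarrow> p = q"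
  by (auto simp: emb_def prod_eq_iff)

lemma emb_hom: "emb (p + q) = emb p + emb q" "emb (p - q) = emb p - emb q" "emb (irot p) = rot (emb p)"
  by (simp_all add: emb_def irot_def rot_def)

lemma emb_in_pts [simp]: "emb p \<in> pts Q \<longleftrightarrow> p \<in> set Q"
  by (auto simp: pts_def)

lemma finite_pts [simp]: "finite (pts Q)"
  by (simp add: pts_def)

lemma card_pts: "distinct Q \<Longrightarrow> card (pts Q) = length Q"
  unfolding pts_def by (subst card_image) (auto simp: inj_on_def distinct_card)

lemma pts_append [simp]: "pts (Q @ R) = pts Q \<union> pts R"
  by (auto simp: pts_def)

lemma pts_Cons [simp]: "pts (v # Q) = insert (emb v) (pts Q)" "pts [] = {}"
  by (auto simp: pts_def)

lemma count_list_concat: "count_list (concat xss) v = (\<Sum>xs\<leftarrow>xss. count_list xs v)"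
  by (induction xss) auto

lemma card_eq_sum_sum:
  assumes "finite A" "finite B"
  shows "card {(p, q). p \<in> A \<and> q \<in> B \<and> R p q} = (\<Sum>p\<in>A. \<Sum>q\<in>B. if R p q then 1 else 0)"
proof -
  have "{(p, q). p \<in> A \<and> q \<in> B \<and> R p q} = (SIGMA p:A. {q \<in> B. R p q})" by auto
  then show ?thesis using assms by (simp add: card_SigmaI sum_indicator_card)
qed

text \<open>Codes for the squares closed by \<open>v\<close>: \<open>p\<close> is the vertex
  opposite \<open>v\<close>, and \<open>q\<close> follows \<open>p\<close> counterclockwise.\<close>

definition completing :: "ipt list \<Rightarrow> ipt \<Rightarrow> (ipt \<times> ipt) set" where
  "completing Q v = {(p, q). p \<in> set Q \<and> q \<in> set Q \<and>
     (p \<noteq> q \<and> p + irot (q - p) \<in> set Q \<and> q + irot (q - p) \<notin> set Q \<and> q + irot (q - p) = v)}"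

lemma count_completions:
  assumes "distinct Q"
  shows "count_list (completions Q) v = card (completing Q v)"
proof -
  let ?R = "\<lambda>p q. p \<noteq> q \<and> p + irot (q - p) \<in> set Q \<and> q + irot (q - p) \<notin> set Q \<and> q + irot (q - p) = v"
  have "count_list (fourth Q p q) v = (if ?R p q then 1 else 0)" for p q
    by (cases p; cases q) (auto simp: fourth_def Let_def mem_iff irot_def algebra_simps)
  then have "count_list (completions Q) v = (\<Sum>p\<leftarrow>Q. \<Sum>q\<leftarrow>Q. if ?R p q then 1 else 0)"
    unfolding completions_def count_list_concat map_map o_def by simp
  also have "\<dots> = (\<Sum>p\<in>set Q. \<Sum>q\<in>set Q. if ?R p q then 1 else 0)"
    using assms by (simp add: sum_list_distinct_conv_sum_set)
  also have "\<dots> = card (completing Q v)"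
    unfolding completing_def by (rule card_eq_sum_sum[symmetric]) auto
  finally show ?thesis .
qed

lemma finite_completing: "finite (completing Q v)"
  by (rule finite_subset[of _ "set Q \<times> set Q"]) (auto simp: completing_def)

text \<open>The point \<open>x\<close> is an arbitrary real point at the outset. The other three
  vertices of the square are integral, and they determine \<open>x\<close> by sums and differences;
  therefore \<open>x\<close> is integral as well.\<close>

lemma completing_square:
  assumes "x \<notin> pts Q" "T \<in> sqs (insert x (pts Q))" "x \<in> T"
  obtains v p q where "x = emb v" "(p, q) \<in> completing Q v" "T = sq (emb p) (emb (q - p))"
proof -
  have T: "is_square T" "T \<subseteq> insert x (pts Q)" using assms by (auto simp: sqs_def)
  obtain a u where u: "u \<noteq> 0" "T = sq a u" "x = a + u + rot u"
    using square_opposite[OF T(1) assms(3)] by metis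
  have "a \<noteq> x" "a + u \<noteq> x" "a + rot u \<noteq> x"
    using u(1) unfolding u(3) by (auto simp: prod_eq_iff)
  then have "a \<in> pts Q" "a + u \<in> pts Q" "a + rot u \<in> pts Q" using T(2) u(2) by (auto simp: sq_def)
  then obtain p q r where p: "p \<in> set Q" "a = emb p" and q: "q \<in> set Q" "a + u = emb q"
    and r: "r \<in> set Q" "a + rot u = emb r" by (auto simp: pts_def)
  have u': "u = emb (q - p)" using p q by (simp add: emb_hom) (metis add_diff_cancel_left')
  have r': "r = p + irot (q - p)"
    using r(2) unfolding p(2) u' emb_hom(3)[symmetric] emb_hom(1)[symmetric] by simp
  have x: "x = emb (q + irot (q - p))" unfolding u(3) q(2) by (simp add: u' emb_hom)
  moreover have "p \<noteq> q" using u(1) u' by (auto simp: emb_def zero_prod_def)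
  ultimately have "(p, q) \<in> completing Q (q + irot (q - p))"
    using p q r r' assms(1) by (auto simp: completing_def)
  then show thesis using that x u(2) u' p(2) by blast
qed

lemma deg_le_count:
  assumes "distinct Q" "emb v \<notin> pts Q"
  shows "deg (insert (emb v) (pts Q)) (emb v) \<le> count_list (completions Q) v"
proof -
  have "{S \<in> sqs (insert (emb v) (pts Q)). emb v \<in> S} \<subseteq> (\<lambda>(p, q). sq (emb p) (emb (q - p))) ` completing Q v"
  proof
    fix S assume "S \<in> {S \<in> sqs (insert (emb v) (pts Q)). emb v \<in> S}"
    then obtain w p q where "emb v = emb w" "(p, q) \<in> completing Q w" "S = sq (emb p) (emb (q - p))"
      using completing_square[OF assms(2)] by blast
    then show "S \<in> (\<lambda>(p, q). sq (emb p) (emb (q - p))) ` completing Q v" by force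
  qed
  then show ?thesis
    unfolding deg_def count_completions[OF assms(1)] by (rule surj_card_le[OF finite_completing])
qed

text \<open>An edge vector in this quadrant makes the base the lowest vertex, and the leftmost one
  if two are lowest. So the base is determined by the square, and then so is the edge
  vector.\<close>

lemma sq_quadrant_unique:
  assumes "sq a u = sq c w" "fst u > 0" "snd u \<ge> 0" "fst w > 0" "snd w \<ge> 0"
  shows "a = c \<and> u = w"
proof -
  have ac: "a \<in> sq c w" "c \<in> sq a u" "a + u \<in> sq c w" "c + w \<in> sq a u"
    using assms(1) by (auto simp: sq_def)
  have low: "snd y < snd x \<or> (snd y = snd x \<and> fst y < fst x) \<or> x = y"
    if "x \<in> sq y z" "fst z > 0" "snd z \<ge> 0" for x y z
    using that by (auto simp: sq_def)
  have "a = c" using low[OF ac(1) assms(4,5)] low[OF ac(2) assms(2,3)] by auto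
  have "u = w \<or> u = w + rot w \<or> u = rot w" "w = u \<or> w = u + rot u \<or> w = rot u"
    using ac(3,4) assms(2,4) unfolding \<open>a = c\<close> by (auto simp: sq_def)
  then have "fst u = fst w \<and> snd u = snd w"
    unfolding prod_eq_iff fst_add snd_add rot_simps using assms(2-) by linarith
  then have "u = w" by (simp add: prod_eq_iff)
  with \<open>a = c\<close> show ?thesis by simp
qed

lemma square_quadrant:
  assumes "is_square S"
  obtains a u where "fst u > 0" "snd u \<ge> 0" "S = sq a u"
proof -
  obtain a u where u: "u \<noteq> 0" "S = sq a u" using assms is_square_iff by blast
  then consider "fst u > 0" "snd u \<ge> 0" | "fst (rot u) > 0" "snd (rot u) \<ge> 0"
    | "fst (- u) > 0" "snd (- u) \<ge> 0" | "fst (- rot u) > 0" "snd (- rot u) \<ge> 0"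
    by (fastforce simp: prod_eq_iff)
  then show thesis using that u sq_turn[of a u] by cases metis+
qed

lemma num_squares_pts:
  assumes "distinct Q"
  shows "num_squares (pts Q) = sqcount Q"
proof -
  define B where "B = {(p, q). p \<in> set Q \<and> q \<in> set Q \<and> based Q p q}"
  have based: "based Q p q \<longleftrightarrow> fst (q - p) > 0 \<and> snd (q - p) \<ge> 0 \<and> p + irot (q - p) \<in> set Q \<and> q + irot (q - p) \<in> set Q" for p q
    by (cases p; cases q) (simp add: based_def Let_def mem_iff irot_def algebra_simps)
  have "sqcount Q = card B"
    using assms unfolding sqcount_def B_def
    by (subst card_eq_sum_sum)
      (simp_all add: length_concat sum_list_distinct_conv_sum_set o_def distinct_length_filter sum_indicator_card Int_def conj_commute)
  also have "\<dots> = card ((\<lambda>(p, q). sq (emb p) (emb (q - p))) ` B)"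
  proof (rule card_image[symmetric], rule inj_onI)
    fix z z' assume z: "z \<in> B" "z' \<in> B"
      and eq: "(\<lambda>(p, q). sq (emb p) (emb (q - p))) z = (\<lambda>(p, q). sq (emb p) (emb (q - p))) z'"
    obtain p q p' q' where zz: "z = (p, q)" "z' = (p', q')" by (metis surj_pair)
    have "emb p = emb p' \<and> emb (q - p) = emb (q' - p')"
      by (rule sq_quadrant_unique) (use z eq in \<open>auto simp: zz B_def based emb_def\<close>)
    then have "p = p' \<and> q - p = q' - p'" unfolding emb_eq_iff .
    then have "p = p'" "q = q'" by (metis, metis diff_add_cancel)
    then show "z = z'" by (simp add: zz)
  qed
  also have "(\<lambda>(p, q). sq (emb p) (emb (q - p))) ` B = sqs (pts Q)"
  proof (intro equalityI subsetI)
    fix S assume "S \<in> (\<lambda>(p, q). sq (emb p) (emb (q - p))) ` B"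
    then obtain p q where pq: "(p, q) \<in> B" and S: "S = sq (emb p) (emb (q - p))" by auto
    have "sq (emb p) (emb (q - p)) = emb ` {p, q, q + irot (q - p), p + irot (q - p)}"
      by (simp add: sq_def emb_hom)
    moreover have "{p, q, q + irot (q - p), p + irot (q - p)} \<subseteq> set Q" using pq by (auto simp: B_def based)
    moreover have "emb (q - p) \<noteq> 0" using pq by (auto simp: B_def based emb_def zero_prod_def)
    ultimately show "S \<in> sqs (pts Q)" unfolding S sqs_def pts_def using is_square_sq by (metis (mono_tags, lifting) image_mono mem_Collect_eq)
  next
    fix S assume "S \<in> sqs (pts Q)"
    then obtain a u where u: "fst u > 0" "snd u \<ge> 0" "S = sq a u" and sub: "S \<subseteq> pts Q"
      using square_quadrant by (auto simp: sqs_def) metis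
    then have "a \<in> pts Q" "a + u \<in> pts Q" by (auto simp: sq_def)
    then obtain p q where p: "p \<in> set Q" "a = emb p" and q: "q \<in> set Q" "a + u = emb q" by (auto simp: pts_def)
    have u': "u = emb (q - p)" using p q by (metis add_diff_cancel_left' emb_hom(2))
    have "sq a u = emb ` {p, q, q + irot (q - p), p + irot (q - p)}"
      unfolding p(2) u' by (simp add: sq_def emb_hom)
    then have "p + irot (q - p) \<in> set Q" "q + irot (q - p) \<in> set Q" using sub u(3) by auto
    then have "(p, q) \<in> B" using u(1,2) p q unfolding u' B_def based by (auto simp: emb_def)
    then show "S \<in> (\<lambda>(p, q). sq (emb p) (emb (q - p))) ` B" using u(3) p(2) u' by force
  qed
  finally show ?thesis by (simp add: num_squares_sqs)
qed

section \<open>Extension by one point\<close>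

lemma num_squares_insert:
  assumes "finite A" "x \<notin> A"
  shows "num_squares (insert x A) = num_squares A + deg (insert x A) x"
  using num_squares_remove[of "insert x A" x] assms by simp

text \<open>The strict increase puts \<open>x\<close> on some square, hence it is an integral
  completion. This turns an unknown real point into one of finitely many candidates.\<close>

lemma one_ext:
  assumes "distinct Q" "x \<notin> pts Q" "num_squares (pts Q) < num_squares (insert x (pts Q))"
    "m \<le> num_squares (insert x (pts Q))"
  obtains v where "x = emb v" "Q @ [v] \<in> set (one_ext m Q)"
proof -
  have d: "num_squares (insert x (pts Q)) = sqcount Q + deg (insert x (pts Q)) x"
    using num_squares_insert[OF finite_pts assms(2)] num_squares_pts[OF assms(1)] by simp
  then have "deg (insert x (pts Q)) x > 0" using assms(3) num_squares_pts[OF assms(1)] by simp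
  then obtain T where "T \<in> sqs (insert x (pts Q))" "x \<in> T"
    unfolding deg_def by (metis (mono_tags, lifting) card.empty empty_Collect_eq less_irrefl)
  then obtain v p q where v: "x = emb v" "(p, q) \<in> completing Q v" using completing_square assms(2) by metis
  then have "0 < count_list (completions Q) v"
    unfolding count_completions[OF assms(1)] using finite_completing card_gt_0_iff by blast
  then have "v \<in> set (completions Q)" by (metis count_list_0_iff less_irrefl)
  moreover have "m \<le> sqcount Q + count_list (completions Q) v"
    using deg_le_count[OF assms(1)] assms(2,4) d v(1) by fastforce
  ultimately show thesis using that[OF v(1)] by (simp add: one_ext_def Let_def)
qed

section \<open>Extension by two points of a common square\<close>

lemma pairs_complete: "p \<in> set Q \<Longrightarrow> q \<in> set Q \<Longrightarrow> p \<noteq> q \<Longrightarrow> (p, q) \<in> set (pairs Q) \<or> (q, p) \<in> set (pairs Q)"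
  by (induction Q) auto

definition half :: "real \<times> real \<Rightarrow> real \<times> real" where
  "half = aff (1/2) 0 1 0 0"

lemma half_simp: "half p = (1/2) *\<^sub>R p"
  by (simp add: half_def aff_def prod_eq_iff)

lemma nice_half: "nice half"
  unfolding half_def by (rule nice_aff) auto

lemma inj_half: "inj half"
  using nice_half by (simp add: nice_def bij_is_inj)

lemma half_pts_dbl: "half ` pts (dbl Q) = pts Q"
  by (auto simp: pts_def dbl_def half_simp emb_def image_image case_prod_unfold)

lemma half_emb_dbl_iff: "half (emb v) \<in> pts Q \<longleftrightarrow> v \<in> set (dbl Q)"
  using half_pts_dbl[of Q] inj_half by (metis emb_in_pts inj_image_mem_iff)

lemma distinct_dbl: "distinct Q \<Longrightarrow> distinct (dbl Q)"
  by (auto simp: dbl_def distinct_map inj_on_def)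

text \<open>The two old vertices of \<open>S\<close> occur in \<open>pairs\<close> in one of the two
  orders. The order of the new points is lost with it, so only the set \<open>{x, y}\<close> is
  recovered.\<close>

lemma new_pairs_complete:
  assumes "x \<noteq> y" "x \<notin> pts Q" "y \<notin> pts Q" "is_square S" "S \<subseteq> pts Q \<union> {x, y}" "x \<in> S" "y \<in> S"
  obtains v w where "(v, w) \<in> set (new_pairs Q)" "{x, y} = {half (emb v), half (emb w)}"
proof -
  have "card (S - {x, y}) = 2" using assms card_square[of S] by (simp add: card_Diff_subset)
  then obtain s t where st: "S - {x, y} = {s, t}" "s \<noteq> t" by (meson card_2_iff)
  then have "s \<in> pts Q" "t \<in> pts Q" using assms by auto
  then obtain p q where "p \<in> set Q" "q \<in> set Q" "s = emb p" "t = emb q" by (auto simp: pts_def)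
  then obtain p q where pq: "(p, q) \<in> set (pairs Q)" and S: "S - {x, y} = {emb p, emb q}" "p \<noteq> q"
    using pairs_complete[of p Q q] st by (metis insert_commute)
  \<comment> \<open>The entries of \<open>new_pairs\<close> are twice the vertices found in
    \<open>square_through_two\<close>.\<close>
  have e: "half (emb (2 * a - 2 * (d - b), 2 * b + 2 * (c - a))) = emb p + rot (emb q - emb p)"
    "half (emb (2 * c - 2 * (d - b), 2 * d + 2 * (c - a))) = emb q + rot (emb q - emb p)"
    "half (emb (2 * a + 2 * (d - b), 2 * b - 2 * (c - a))) = emb p - rot (emb q - emb p)"
    "half (emb (2 * c + 2 * (d - b), 2 * d - 2 * (c - a))) = emb q - rot (emb q - emb p)"
    "half (emb (a + c - (d - b), b + d + (c - a))) = (1/2) *\<^sub>R (emb p + emb q + rot (emb q - emb p))"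
    "half (emb (a + c + (d - b), b + d - (c - a))) = (1/2) *\<^sub>R (emb p + emb q - rot (emb q - emb p))"
    if "p = (a, b)" "q = (c, d)" for a b c d
    by (simp_all add: that half_simp emb_def prod_eq_iff field_simps)
  obtain a b c d where ab: "p = (a, b)" "q = (c, d)" by (metis surj_pair)
  have inS: "emb p \<in> S" "emb q \<in> S" using S by auto
  have "\<exists>v w. (v, w) \<in> {((2 * a - 2 * (d - b), 2 * b + 2 * (c - a)), (2 * c - 2 * (d - b), 2 * d + 2 * (c - a))),
      ((2 * a + 2 * (d - b), 2 * b - 2 * (c - a)), (2 * c + 2 * (d - b), 2 * d - 2 * (c - a))),
      ((a + c - (d - b), b + d + (c - a)), (a + c + (d - b), b + d - (c - a)))}
      \<and> S = {emb p, emb q, half (emb v), half (emb w)}"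
    using square_through_two[OF assms(4) inS] S(2) unfolding e[OF ab, symmetric] by auto
  then obtain v w where vw: "(v, w) \<in> {((2 * a - 2 * (d - b), 2 * b + 2 * (c - a)), (2 * c - 2 * (d - b), 2 * d + 2 * (c - a))),
      ((2 * a + 2 * (d - b), 2 * b - 2 * (c - a)), (2 * c + 2 * (d - b), 2 * d - 2 * (c - a))),
      ((a + c - (d - b), b + d + (c - a)), (a + c + (d - b), b + d - (c - a)))}"
    and Svw: "S = {emb p, emb q, half (emb v), half (emb w)}" by blast
  have xy: "{x, y} = {half (emb v), half (emb w)}"
  proof -
    have "emb p \<noteq> x" "emb p \<noteq> y" "emb q \<noteq> x" "emb q \<noteq> y" using S(1) by auto
    then have "{x, y} \<subseteq> {half (emb v), half (emb w)}" using assms(6,7) Svw by auto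
    then show ?thesis using assms(1) by auto
  qed
  then have "half (emb v) \<notin> pts Q" "half (emb w) \<notin> pts Q" using assms(2,3) by auto
  then have "v \<notin> set (dbl Q)" "w \<notin> set (dbl Q)" by (simp_all add: half_emb_dbl_iff)
  then have "(v, w) \<in> set (new_pairs Q)"
    unfolding new_pairs_def Let_def using vw pq ab
    by (auto simp: mem_iff intro!: bexI[of _ "((a, b), (c, d))"])
  then show thesis using that xy by blast
qed

lemma card_through_two_le_bridges:
  assumes "emb v \<notin> pts Q" "emb w \<notin> pts Q" "v \<noteq> w"
  shows "card {S \<in> sqs (pts Q \<union> {emb v, emb w}). emb v \<in> S \<and> emb w \<in> S} \<le> bridges Q v w"
proof -
  let ?x = "emb v" and ?y = "emb w"
  define T1 where "T1 = {?x, ?y, ?x + rot (?y - ?x), ?y + rot (?y - ?x)}"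
  define T2 where "T2 = {?x, ?y, ?x - rot (?y - ?x), ?y - rot (?y - ?x)}"
  define T3 where "T3 = {?x, ?y, (1/2) *\<^sub>R (?x + ?y + rot (?y - ?x)), (1/2) *\<^sub>R (?x + ?y - rot (?y - ?x))}"
  obtain a b c d where ab: "v = (a, b)" "w = (c, d)" by (metis surj_pair)
  let ?u = "c - a" and ?v = "d - b"
  define B1 where "B1 \<longleftrightarrow> mem (a - ?v) (b + ?u) Q \<and> mem (c - ?v) (d + ?u) Q"
  define B2 where "B2 \<longleftrightarrow> mem (a + ?v) (b - ?u) Q \<and> mem (c + ?v) (d - ?u) Q"
  define B3 where "B3 \<longleftrightarrow> mem (a + c - ?v) (b + d + ?u) (dbl Q) \<and> mem (a + c + ?v) (b + d - ?u) (dbl Q)"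
  \<comment> \<open>The four vertices are distinct, so the two others differ from both new points
    and must be old.\<close>
  have in_Q: "z \<in> pts Q" if "is_square S" "S \<subseteq> pts Q \<union> {?x, ?y}" "S = {?x, ?y, z, z'}" for S z z'
  proof -
    have "card {?x, ?y, z, z'} = 4" using card_square that by metis
    then have "z \<noteq> ?x" "z \<noteq> ?y" by (auto simp: card_insert_if split: if_splits)
    then show ?thesis using that by auto
  qed
  have in_Q': "z' \<in> pts Q" if "is_square S" "S \<subseteq> pts Q \<union> {?x, ?y}" "S = {?x, ?y, z, z'}" for S z z'
    using in_Q[OF that(1,2), of z' z] that(3) by (simp add: insert_commute)
  have "{S \<in> sqs (pts Q \<union> {?x, ?y}). ?x \<in> S \<and> ?y \<in> S}
      \<subseteq> (if B1 then {T1} else {}) \<union> (if B2 then {T2} else {}) \<union> (if B3 then {T3} else {})"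
  proof
    fix S assume "S \<in> {S \<in> sqs (pts Q \<union> {?x, ?y}). ?x \<in> S \<and> ?y \<in> S}"
    then have S: "is_square S" "S \<subseteq> pts Q \<union> {?x, ?y}" "?x \<in> S" "?y \<in> S" by (auto simp: sqs_def)
    have xy: "?x \<noteq> ?y" using assms(3) by simp
    from square_through_two[OF S(1,3,4) xy] consider "S = T1" | "S = T2" | "S = T3"
      unfolding T1_def T2_def T3_def by blast
    then show "S \<in> (if B1 then {T1} else {}) \<union> (if B2 then {T2} else {}) \<union> (if B3 then {T3} else {})"
    proof cases
      case 1
      have "?x + rot (?y - ?x) = emb (a - ?v, b + ?u)" "?y + rot (?y - ?x) = emb (c - ?v, d + ?u)"
        by (simp_all add: ab emb_def prod_eq_iff)
      then have B1 using in_Q[OF S(1,2)] in_Q'[OF S(1,2)] 1 unfolding T1_def B1_def mem_iff by (metis emb_in_pts)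
      then show ?thesis using 1 by simp
    next
      case 2
      have "?x - rot (?y - ?x) = emb (a + ?v, b - ?u)" "?y - rot (?y - ?x) = emb (c + ?v, d - ?u)"
        by (simp_all add: ab emb_def prod_eq_iff)
      then have B2 using in_Q[OF S(1,2)] in_Q'[OF S(1,2)] 2 unfolding T2_def B2_def mem_iff by (metis emb_in_pts)
      then show ?thesis using 2 by simp
    next
      case 3
      have "(1/2) *\<^sub>R (?x + ?y + rot (?y - ?x)) = half (emb (a + c - ?v, b + d + ?u))"
        "(1/2) *\<^sub>R (?x + ?y - rot (?y - ?x)) = half (emb (a + c + ?v, b + d - ?u))"
        by (simp_all add: ab emb_def half_simp prod_eq_iff)
      then have B3 using in_Q[OF S(1,2)] in_Q'[OF S(1,2)] 3 unfolding T3_def B3_def mem_iff by (metis half_emb_dbl_iff)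
      then show ?thesis using 3 by simp
    qed
  qed
  then have "card {S \<in> sqs (pts Q \<union> {?x, ?y}). ?x \<in> S \<and> ?y \<in> S}
      \<le> card ((if B1 then {T1} else {}) \<union> (if B2 then {T2} else {}) \<union> (if B3 then {T3} else {}))"
    by (intro card_mono) auto
  also have "\<dots> \<le> card (if B1 then {T1} else {}) + card (if B2 then {T2} else {}) + card (if B3 then {T3} else {})"
    by (meson add_le_mono card_Un_le le_trans order_refl)
  also have "\<dots> = bridges Q v w"
    by (simp add: bridges_def ab Let_def B1_def B2_def B3_def)
  finally show ?thesis .
qed

text \<open>The squares are split by which of the new points they contain. Those with exactly one of
  them already appear after adding that point alone.\<close>

lemma num_squares_insert_two:
  assumes "finite A" "x \<notin> A" "y \<notin> A" "x \<noteq> y"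
  shows "num_squares (A \<union> {x, y}) = num_squares A + deg (insert x A) x + deg (insert y A) y
    + card {S \<in> sqs (A \<union> {x, y}). x \<in> S \<and> y \<in> S}"
proof -
  have "deg (insert y (insert x A)) y = deg (insert y A) y + card {S \<in> sqs (A \<union> {x, y}). x \<in> S \<and> y \<in> S}"
  proof -
    have "{S \<in> sqs (insert y (insert x A)). y \<in> S}
        = {S \<in> sqs (insert y A). y \<in> S} \<union> {S \<in> sqs (A \<union> {x, y}). x \<in> S \<and> y \<in> S}"
      by (auto simp: sqs_def)
    moreover have "{S \<in> sqs (insert y A). y \<in> S} \<inter> {S \<in> sqs (A \<union> {x, y}). x \<in> S \<and> y \<in> S} = {}"
      using assms by (auto simp: sqs_def)
    ultimately show ?thesis unfolding deg_def using assms(1)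
      by (simp add: card_Un_disjoint finite_sqs)
  qed
  moreover have "A \<union> {x, y} = insert y (insert x A)" by auto
  ultimately show ?thesis using num_squares_insert[of A x] num_squares_insert[of "insert x A" y] assms by simp
qed

text \<open>The converse of \<open>completing_square\<close>: every listed completion closes a
  square. It is what allows \<open>two_ext_iso\<close> to drop candidates.\<close>

lemma deg_pos_completion:
  assumes "distinct Q" "v \<in> set (completions Q)"
  obtains S where "S \<in> sqs (insert (emb v) (pts Q))" "emb v \<in> S"
proof -
  have "completing Q v \<noteq> {}"
    using assms(2) count_completions[OF assms(1), of v] by (metis card.empty count_list_0_iff)
  then obtain p q where pq: "p \<in> set Q" "q \<in> set Q" "p \<noteq> q" "p + irot (q - p) \<in> set Q" "q + irot (q - p) = v"
    by (auto simp: completing_def)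
  have "sq (emb p) (emb (q - p)) = emb ` {p, q, q + irot (q - p), p + irot (q - p)}"
    by (simp add: sq_def emb_hom)
  moreover have "emb (q - p) \<noteq> 0" using pq(3) by (auto simp: emb_def zero_prod_def prod_eq_iff)
  then have "is_square (sq (emb p) (emb (q - p)))" by (rule is_square_sq)
  ultimately have "sq (emb p) (emb (q - p)) \<in> sqs (insert (emb v) (pts Q))" "emb v \<in> sq (emb p) (emb (q - p))"
    using pq by (auto simp: sqs_def)
  then show thesis by (rule that)
qed

text \<open>Coordinates are doubled so that the new vertices stay integral if the given ones form a diagonal.\<close>

lemma two_ext_aux:
  assumes "distinct Q" "is_square S" "card (S - pts Q) = 2" "m \<le> num_squares (pts Q \<union> S)"
  obtains v w where "(v, w) \<in> set (new_pairs Q)" "pts Q \<union> S = half ` pts (dbl Q @ [v, w])"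
    "distinct (dbl Q @ [v, w])"
    "m \<le> sqcount Q + count_list (completions (dbl Q)) v + count_list (completions (dbl Q)) w + bridges (dbl Q) v w"
    "S - pts Q = {half (emb v), half (emb w)}"
proof -
  obtain x y where xy: "S - pts Q = {x, y}" "x \<noteq> y" using assms(3) by (meson card_2_iff)
  then have "x \<notin> pts Q" "y \<notin> pts Q" "S \<subseteq> pts Q \<union> {x, y}" "x \<in> S" "y \<in> S" by auto
  then obtain v w where vw: "(v, w) \<in> set (new_pairs Q)" "{x, y} = {half (emb v), half (emb w)}"
    using new_pairs_complete[OF xy(2) _ _ assms(2)] by metis
  have ne: "v \<noteq> w" using vw(2) xy(2) by auto
  have nin: "v \<notin> set (dbl Q)" "w \<notin> set (dbl Q)"
    using vw(2) \<open>x \<notin> pts Q\<close> \<open>y \<notin> pts Q\<close> unfolding half_emb_dbl_iff[symmetric] by (auto simp: doubleton_eq_iff)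
  have eq: "pts Q \<union> S = half ` pts (dbl Q @ [v, w])"
    using xy vw(2) by (auto simp: image_Un half_pts_dbl)
  have "num_squares (pts Q \<union> S) = num_squares (pts (dbl Q) \<union> {emb v, emb w})"
    unfolding eq num_squares_nice[OF nice_half] by simp
  also have "\<dots> \<le> num_squares (pts (dbl Q)) + count_list (completions (dbl Q)) v
      + count_list (completions (dbl Q)) w + bridges (dbl Q) v w"
    using num_squares_insert_two[of "pts (dbl Q)" "emb v" "emb w"] nin ne
      deg_le_count[OF distinct_dbl[OF assms(1)], of v] deg_le_count[OF distinct_dbl[OF assms(1)], of w]
      card_through_two_le_bridges[of v "dbl Q" w] by simp
  also have "num_squares (pts (dbl Q)) = sqcount Q"
    using num_squares_nice[OF nice_half, of "pts (dbl Q)"] num_squares_pts[OF assms(1)] by (simp add: half_pts_dbl)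
  finally have "m \<le> sqcount Q + count_list (completions (dbl Q)) v + count_list (completions (dbl Q)) w + bridges (dbl Q) v w"
    using assms(4) by simp
  moreover have "distinct (dbl Q @ [v, w])" using nin ne distinct_dbl[OF assms(1)] by simp
  ultimately show thesis using that vw eq xy(1) by metis
qed

lemma two_ext:
  assumes "distinct Q" "is_square S" "card (S - pts Q) = 2" "m \<le> num_squares (pts Q \<union> S)"
  obtains R where "R \<in> set (two_ext m Q)" "pts Q \<union> S = half ` pts R" "distinct R"
proof -
  obtain v w where "(v, w) \<in> set (new_pairs Q)" "pts Q \<union> S = half ` pts (dbl Q @ [v, w])"
    "distinct (dbl Q @ [v, w])"
    "m \<le> sqcount Q + count_list (completions (dbl Q)) v + count_list (completions (dbl Q)) w + bridges (dbl Q) v w"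
    using two_ext_aux[OF assms] by metis
  then show thesis by (intro that[of "dbl Q @ [v, w]"]) (auto simp: two_ext_def Let_def intro!: image_eqI[of _ _ "(v, w)"])
qed

lemma two_ext_iso:
  assumes "distinct Q" "is_square S" "card (S - pts Q) = 2" "m \<le> num_squares (pts Q \<union> S)"
    and iso: "\<And>T. T \<in> sqs (pts Q \<union> S) \<Longrightarrow> \<not> T \<subseteq> pts Q \<Longrightarrow> card (T - pts Q) = 2"
  obtains R where "R \<in> set (two_ext_iso m Q)" "pts Q \<union> S = half ` pts R" "distinct R"
proof -
  obtain v w where vw: "(v, w) \<in> set (new_pairs Q)" "pts Q \<union> S = half ` pts (dbl Q @ [v, w])"
    "distinct (dbl Q @ [v, w])"
    "m \<le> sqcount Q + count_list (completions (dbl Q)) v + count_list (completions (dbl Q)) w + bridges (dbl Q) v w"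
    "S - pts Q = {half (emb v), half (emb w)}"
    using two_ext_aux[OF assms(1-4)] by metis
  \<comment> \<open>If a new point closed a square with old points, this square would have only one
    vertex outside, contrary to \<open>iso\<close>.\<close>
  have "z \<notin> set (completions (dbl Q))" if z: "half (emb z) \<in> S - pts Q" for z
  proof
    assume "z \<in> set (completions (dbl Q))"
    then obtain T where T: "T \<in> sqs (insert (emb z) (pts (dbl Q)))" "emb z \<in> T"
      using deg_pos_completion distinct_dbl[OF assms(1)] by metis
    have "half ` T \<subseteq> half ` insert (emb z) (pts (dbl Q))" using T(1) by (intro image_mono) (simp add: sqs_def)
    then have sub: "half ` T \<subseteq> insert (half (emb z)) (pts Q)" by (simp add: half_pts_dbl)
    moreover have "is_square (half ` T)" using T(1) nice_half by (simp add: sqs_def nice_def)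
    ultimately have "half ` T \<in> sqs (pts Q \<union> S)" using z by (auto simp: sqs_def)
    moreover have "half (emb z) \<in> half ` T - pts Q" using T(2) z by simp
    moreover have "half ` T - pts Q = {half (emb z)}" using sub calculation(2) by blast
    moreover from this have "\<not> half ` T \<subseteq> pts Q" by blast
    ultimately have "card {half (emb z)} = 2" using iso[of "half ` T"] by simp
    then show False by simp
  qed
  then have "count_list (completions (dbl Q)) v = 0" "count_list (completions (dbl Q)) w = 0"
    using vw(5) by (simp_all add: count_list_0_iff)
  then have "dbl Q @ [v, w] \<in> set (two_ext_iso m Q)"
    unfolding two_ext_iso_def Let_def set_map
    by (intro image_eqI[of _ _ "(v, w)"]) (use vw(1,4) in simp_all)
  then show thesis using that vw(2,3) by blast
qed

section \<open>Similar copies of integral lists\<close>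

definition copy :: "(real \<times> real) set \<Rightarrow> ipt list \<Rightarrow> bool" where
  "copy A Q \<longleftrightarrow> distinct Q \<and> (\<exists>g. nice g \<and> A = g ` pts Q)"

lemma copy_card: "copy A Q \<Longrightarrow> card A = length Q"
  unfolding copy_def using card_pts by (metis bij_is_inj card_image inj_on_subset nice_def subset_UNIV)

lemma copy_finite: "copy A Q \<Longrightarrow> finite A"
  by (auto simp: copy_def)

lemma copy_num_squares: "copy A Q \<Longrightarrow> num_squares A = sqcount Q"
  by (auto simp: copy_def num_squares_nice num_squares_pts)

lemma copy_image: "copy A Q \<Longrightarrow> nice g \<Longrightarrow> copy (g ` A) Q"
  unfolding copy_def using nice_comp by (metis image_comp)

lemma copy_pts: "distinct Q \<Longrightarrow> copy (pts Q) Q"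
  unfolding copy_def
  by (intro conjI exI[of _ "aff 1 0 1 0 0"] nice_aff) (auto simp: aff_def)

section \<open>Tables of configurations\<close>

text \<open>The certificate \<open>(i, a, b, s, t, r)\<close> stands for the configuration with number \<open>i\<close> and the similarity
  that, in complex notation, maps \<open>z\<close> to \<open>(a + b \<i>) z + (t + r \<i>)\<close> if \<open>s = 1\<close>, with \<open>z\<close> conjugated if \<open>s = -1\<close>.\<close>

definition matches :: "(int \<Rightarrow> ipt list) \<Rightarrow> int \<Rightarrow> ipt list \<Rightarrow> int \<times> int \<times> int \<times> int \<times> int \<times> int \<Rightarrow> bool" where
  "matches c n Q m = (case m of (i, a, b, s, t, r) \<Rightarrow>
     if 0 \<le> i \<and> i < n \<and> (a \<noteq> 0 \<or> b \<noteq> 0) \<and> (s = 1 \<or> s = -1) then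
       let L = c i in length L = length Q
         \<and> list_all (\<lambda>p. case image_point a b s t r p of (x, y) \<Rightarrow> mem x y Q) L
     else False)"

text \<open>The following predicates are constants, rather than abstractions in the statements below, since
  the simplifier would otherwise evaluate their bodies for symbolic arguments.\<close>

definition config_ok :: "(int \<Rightarrow> ipt list) \<Rightarrow> nat \<Rightarrow> int \<Rightarrow> bool" where
  "config_ok c k i \<longleftrightarrow> distinct (c i) \<and> length (c i) = k"

definition one_ok where
  "one_ok m c c' n' i ms \<longleftrightarrow> list_all2 (matches c' n') (one_ext m (c i)) ms" for i :: int

definition two_ok where
  "two_ok m c c' n' i ms \<longleftrightarrow> list_all2 (matches c' n') (two_ext m (c i)) ms" for i :: int

definition one_match where
  "one_match m c n Q ms \<longleftrightarrow> list_all2 (matches c n) (one_ext m Q) ms"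

definition iso_ok where
  "iso_ok m m' c c' n' i mss \<longleftrightarrow> list_all2 (one_match m' c' n') (two_ext_iso m (c i)) mss" for i :: int

definition no_iso where
  "no_iso m c i \<longleftrightarrow> two_ext_iso m (c i) = []" for i :: int

definition no_one where
  "no_one m c i \<longleftrightarrow> one_ext m (c i) = []" for i :: int

text \<open>Up to similarity, these are all sets with 6, 7, 8 and 9 points that arise from a square by
  2-extension, and those with 10, 11 and 12 points that have at least 6, 7 and 10 squares. The extremal
  ones come first.\<close>

definition configs4 :: "int \<Rightarrow> ipt list" where
  "configs4 i = (if i = 0 then [(0,0), (0,1), (1,0), (1,1)]
    else [])"

definition configs6 :: "int \<Rightarrow> ipt list" where
  "configs6 i = (if i = 0 then [(0,0), (0,1), (1,0), (1,1), (2,0), (2,1)]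
    else if i = 1 then [(0,2), (1,2), (0,1), (1,1), (2,1), (1,0)]
    else [])"

definition configs7 :: "int \<Rightarrow> ipt list" where
  "configs7 i = (if i = 0 then [(0,1), (0,2), (1,1), (1,2), (2,1), (2,2), (1,0)]
    else if i = 1 then [(0,1), (0,2), (1,0), (1,1), (1,2), (2,0), (2,1)]
    else [])"

definition configs8 :: "int \<Rightarrow> ipt list" where
  "configs8 i = (if i = 0 then [(1,0), (1,1), (1,2), (2,0), (2,1), (2,2), (0,1), (3,1)]
    else if i = 1 then [(0,0), (0,1), (0,2), (1,0), (1,1), (1,2), (2,1), (2,2)]
    else if i = 2 then [(0,0), (0,1), (0,2), (0,3), (1,0), (1,1), (1,2), (1,3)]
    else if i = 3 then [(0,0), (0,1), (1,0), (1,1), (1,2), (2,1), (2,3), (3,2)]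
    else if i = 4 then [(0,1), (0,2), (1,1), (1,2), (1,3), (2,0), (2,2), (3,1)]
    else if i = 5 then [(0,0), (0,1), (0,2), (1,0), (1,1), (1,2), (1,3), (2,2)]
    else if i = 6 then [(0,0), (0,1), (0,2), (1,0), (1,1), (1,2), (2,0), (2,2)]
    else if i = 7 then [(0,0), (0,1), (0,2), (1,0), (1,1), (1,2), (3,0), (3,2)]
    else if i = 8 then [(0,0), (0,1), (0,2), (1,0), (1,1), (1,2), (2,3), (3,1)]
    else if i = 9 then [(0,1), (0,2), (1,0), (1,2), (2,1), (2,3), (3,1), (3,2)]
    else if i = 10 then [(0,1), (1,0), (1,1), (1,2), (2,1), (2,2), (2,3), (3,2)]
    else if i = 11 then [(0,0), (0,1), (0,3), (1,0), (1,1), (1,2), (2,1), (2,3)]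
    else if i = 12 then [(0,1), (0,2), (1,0), (1,1), (1,2), (1,4), (2,1), (3,3)]
    else if i = 13 then [(0,1), (1,0), (1,1), (1,2), (1,3), (2,0), (2,1), (3,2)]
    else if i = 14 then [(0,0), (0,1), (0,2), (1,1), (1,3), (2,0), (2,2), (3,2)]
    else if i = 15 then [(0,0), (0,2), (1,0), (1,1), (2,0), (2,1), (2,2), (3,1)]
    else if i = 16 then [(0,0), (0,1), (0,2), (1,0), (1,1), (2,0), (2,2), (3,1)]
    else [])"

definition configs9 :: "int \<Rightarrow> ipt list" where
  "configs9 i = (if i = 0 then [(0,0), (0,1), (0,2), (1,0), (1,1), (1,2), (2,0), (2,1), (2,2)]
    else if i = 1 then [(0,0), (0,1), (1,0), (1,1), (1,2), (2,0), (2,1), (3,0), (3,1)]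
    else if i = 2 then [(0,0), (0,1), (1,0), (1,1), (1,2), (2,1), (2,3), (3,0), (3,2)]
    else if i = 3 then [(0,0), (0,1), (0,2), (1,1), (1,2), (1,3), (2,0), (2,2), (3,1)]
    else if i = 4 then [(0,1), (0,2), (1,1), (1,2), (1,3), (2,0), (2,1), (2,2), (3,1)]
    else if i = 5 then [(0,0), (0,1), (0,2), (1,1), (1,2), (1,3), (2,0), (2,1), (2,2)]
    else if i = 6 then [(0,0), (0,1), (0,2), (1,0), (1,1), (1,2), (2,1), (3,0), (3,2)]
    else if i = 7 then [(0,1), (1,0), (1,1), (1,2), (2,0), (2,1), (2,2), (3,3), (4,1)]
    else if i = 8 then [(0,0), (0,1), (0,2), (1,0), (1,1), (1,2), (2,1), (2,3), (3,1)]
    else if i = 9 then [(0,0), (0,2), (1,0), (1,1), (1,3), (2,0), (2,2), (2,3), (3,1)]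
    else if i = 10 then [(0,0), (0,1), (1,0), (1,1), (1,2), (2,0), (2,1), (2,3), (3,2)]
    else if i = 11 then [(0,0), (0,1), (1,0), (1,1), (1,2), (2,0), (2,1), (2,2), (3,1)]
    else if i = 12 then [(0,1), (0,2), (1,0), (1,1), (1,2), (2,1), (2,3), (3,0), (3,2)]
    else if i = 13 then [(0,1), (0,2), (0,4), (1,0), (1,1), (1,2), (2,1), (2,2), (2,4)]
    else if i = 14 then [(0,1), (0,2), (1,0), (1,1), (1,2), (2,1), (2,2), (2,3), (3,1)]
    else if i = 15 then [(0,0), (0,1), (1,0), (1,1), (1,2), (2,0), (2,1), (3,3), (4,1)]
    else if i = 16 then [(0,1), (0,3), (1,0), (1,1), (1,2), (2,1), (2,3), (2,4), (3,2)]
    else if i = 17 then [(0,0), (0,2), (1,1), (1,2), (1,3), (2,0), (2,1), (2,2), (3,1)]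
    else if i = 18 then [(0,0), (0,1), (0,2), (1,0), (1,1), (1,3), (2,0), (2,2), (3,1)]
    else if i = 19 then [(0,0), (0,1), (0,2), (0,3), (1,0), (1,1), (1,2), (2,1), (2,3)]
    else if i = 20 then [(0,1), (0,2), (1,0), (1,1), (1,2), (2,0), (2,1), (3,0), (3,1)]
    else if i = 21 then [(0,0), (0,1), (1,0), (1,1), (1,2), (2,1), (3,0), (3,2), (4,1)]
    else if i = 22 then [(0,1), (0,2), (1,0), (1,1), (1,2), (2,0), (2,1), (2,3), (3,2)]
    else if i = 23 then [(0,1), (1,0), (1,1), (1,2), (2,0), (2,1), (3,0), (3,2), (4,1)]
    else if i = 24 then [(0,0), (0,1), (1,0), (1,1), (1,2), (2,1), (2,2), (2,3), (3,2)]
    else if i = 25 then [(0,1), (0,2), (1,0), (1,1), (1,2), (1,3), (2,0), (2,1), (3,2)]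
    else if i = 26 then [(0,1), (0,2), (1,0), (1,1), (1,2), (1,4), (2,0), (2,1), (3,3)]
    else if i = 27 then [(0,1), (1,0), (1,2), (1,3), (2,0), (2,1), (3,0), (3,2), (4,1)]
    else if i = 28 then [(0,0), (0,1), (1,0), (1,1), (1,2), (2,1), (2,2), (3,0), (3,2)]
    else if i = 29 then [(0,1), (0,2), (1,0), (1,1), (1,2), (2,0), (2,1), (2,4), (4,2)]
    else if i = 30 then [(0,1), (1,0), (1,1), (1,2), (1,3), (2,0), (2,1), (2,3), (3,2)]
    else if i = 31 then [(0,0), (0,1), (0,2), (1,0), (1,1), (1,2), (1,3), (2,0), (2,2)]
    else if i = 32 then [(0,0), (0,1), (0,2), (1,0), (1,1), (1,2), (2,0), (2,2), (3,1)]
    else if i = 33 then [(0,1), (0,2), (0,3), (1,1), (1,2), (1,3), (2,0), (2,4), (3,2)]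
    else if i = 34 then [(0,0), (0,1), (0,2), (1,1), (1,2), (1,3), (2,0), (2,2), (3,2)]
    else if i = 35 then [(0,0), (0,1), (0,2), (1,0), (1,1), (1,3), (2,0), (2,2), (3,2)]
    else [])"

definition configs10 :: "int \<Rightarrow> ipt list" where
  "configs10 i = (if i = 0 then [(0,0), (0,1), (0,2), (1,0), (1,1), (1,2), (2,0), (2,1), (2,2), (3,1)]
    else if i = 1 then [(0,0), (0,1), (0,2), (0,3), (1,0), (1,1), (1,2), (1,3), (2,1), (2,2)]
    else if i = 2 then [(0,1), (0,2), (1,1), (1,2), (1,3), (2,0), (2,1), (2,2), (3,1), (3,2)]
    else if i = 3 then [(0,1), (0,2), (1,0), (1,1), (1,2), (1,3), (2,0), (2,1), (2,2), (3,1)]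
    else if i = 4 then [(0,1), (0,2), (1,0), (1,1), (1,2), (1,3), (2,0), (2,1), (2,2), (3,2)]
    else if i = 5 then [(0,0), (0,1), (1,0), (1,1), (1,2), (2,0), (2,1), (2,2), (3,1), (3,2)]
    else [])"

definition configs11 :: "int \<Rightarrow> ipt list" where
  "configs11 i = (if i = 0 then [(0,1), (0,2), (1,0), (1,1), (1,2), (1,3), (2,1), (2,2), (2,3), (3,1), (3,2)]
    else if i = 1 then [(0,0), (0,1), (0,2), (1,0), (1,1), (1,2), (2,0), (2,1), (2,2), (3,1), (1,-1)]
    else if i = 2 then [(0,0), (0,1), (0,2), (1,0), (1,1), (1,2), (2,0), (2,1), (2,2), (3,1), (3,2)]
    else if i = 3 then [(0,0), (0,1), (0,2), (1,0), (1,1), (1,2), (2,0), (2,1), (2,2), (3,1), (2,-1)]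
    else if i = 4 then [(0,0), (0,1), (0,2), (1,0), (1,1), (1,2), (2,0), (2,1), (2,2), (-1,1), (3,1)]
    else if i = 5 then [(0,0), (0,1), (0,2), (1,1), (1,2), (1,3), (2,0), (2,1), (2,2), (3,1), (3,2)]
    else if i = 6 then [(0,0), (0,1), (1,0), (1,1), (1,2), (1,3), (2,0), (2,1), (2,2), (2,3), (3,2)]
    else if i = 7 then [(0,1), (0,2), (1,0), (1,1), (1,2), (1,3), (2,0), (2,1), (2,2), (3,1), (3,3)]
    else if i = 8 then [(0,1), (0,2), (0,3), (1,0), (1,1), (1,2), (1,3), (2,0), (2,1), (2,2), (3,1)]
    else if i = 9 then [(0,1), (0,2), (1,0), (1,1), (1,2), (1,3), (2,0), (2,1), (2,2), (3,0), (3,2)]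
    else if i = 10 then [(0,0), (0,1), (1,0), (1,1), (1,2), (1,3), (2,0), (2,1), (2,2), (3,1), (3,2)]
    else if i = 11 then [(0,2), (1,0), (1,1), (1,3), (2,0), (2,1), (2,2), (2,4), (3,1), (3,3), (4,2)]
    else if i = 12 then [(0,0), (0,1), (0,2), (0,4), (1,0), (1,1), (1,2), (2,0), (2,1), (2,2), (2,4)]
    else if i = 13 then [(0,0), (0,1), (0,2), (1,0), (1,1), (1,2), (1,4), (2,0), (2,1), (2,2), (3,3)]
    else if i = 14 then [(0,1), (0,2), (1,1), (1,3), (2,0), (2,2), (2,4), (3,1), (3,2), (3,3), (4,2)]
    else if i = 15 then [(0,0), (0,1), (0,2), (1,0), (1,1), (1,2), (2,0), (2,1), (2,2), (2,4), (4,2)]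
    else if i = 16 then [(0,0), (0,1), (0,2), (1,0), (1,1), (1,2), (2,0), (2,1), (2,2), (2,3), (3,2)]
    else if i = 17 then [(0,2), (1,1), (1,2), (1,3), (2,0), (2,1), (2,2), (2,4), (3,1), (3,3), (4,2)]
    else if i = 18 then [(0,0), (0,1), (0,2), (0,3), (1,0), (1,1), (1,2), (2,0), (2,1), (2,2), (2,3)]
    else if i = 19 then [(0,0), (0,1), (0,2), (1,0), (1,1), (1,2), (1,3), (2,0), (2,2), (2,3), (3,1)]
    else [])"

definition configs12 :: "int \<Rightarrow> ipt list" where
  "configs12 i = (if i = 0 then [(0,1), (0,2), (1,0), (1,1), (1,2), (1,3), (2,0), (2,1), (2,2), (2,3), (3,1), (3,2)]
    else if i = 1 then [(0,0), (0,1), (0,2), (1,0), (1,1), (1,2), (2,0), (2,1), (2,2), (2,3), (3,1), (3,2)]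
    else if i = 2 then [(0,0), (0,1), (0,2), (1,0), (1,1), (1,2), (1,3), (2,0), (2,1), (2,2), (2,3), (3,1)]
    else if i = 3 then [(0,0), (0,1), (0,2), (0,3), (1,0), (1,1), (1,2), (1,3), (2,0), (2,1), (2,2), (2,3)]
    else [])"

section \<open>Computed facts about the tables\<close>

lemma configs_wf:
  "list_all (config_ok configs4 4) [0..1 - 1]"
  "list_all (config_ok configs6 6) [0..2 - 1]"
  "list_all (config_ok configs7 7) [0..2 - 1]"
  "list_all (config_ok configs8 8) [0..17 - 1]"
  "list_all (config_ok configs9 9) [0..36 - 1]"
  "list_all (config_ok configs10 10) [0..6 - 1]"
  "list_all (config_ok configs11 11) [0..20 - 1]"
  "list_all (config_ok configs12 12) [0..4 - 1]"
  by code_simp+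

lemma sqcount_configs:
  "map (sqcount \<circ> configs6) [0..2 - 1] = [2,2]"
  "map (sqcount \<circ> configs7) [0..2 - 1] = [3,3]"
  "map (sqcount \<circ> configs8) [0..17 - 1] = [4,4,3,3,3,3,3,3,3,3,3,3,3,3,3,3,3]"
  "map (sqcount \<circ> configs9) [0..36 - 1] = [6,4,4,4,4,4,4,4,4,4,4,5,4,4,4,4,4,4,4,4,4,4,4,4,4,4,4,4,4,4,4,4,4,4,4,4]"
  "map (sqcount \<circ> configs10) [0..6 - 1] = [7,6,6,6,6,6]"
  "map (sqcount \<circ> configs11) [0..20 - 1] = [8,8,8,8,8,7,7,7,7,7,7,7,7,7,7,7,7,7,7,7]"
  "map (sqcount \<circ> configs12) [0..4 - 1] = [11,10,10,10]"
  by code_simp+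

text \<open>The threshold 0 prunes nothing. Up to nine points all extensions are therefore covered,
  whatever their number of squares.\<close>

lemma step_4_6:
  "list_all2 (two_ok 0 configs4 configs6 2) [0..1 - 1] [[(0,-2,0,-1,2,0), (1,1,-1,-1,1,3),
    (0,0,-2,1,0,2), (1,-1,1,1,3,1), (1,-2,0,1,2,4), (1,0,-2,-1,4,2), (1,0,2,1,4,0),
    (1,-2,0,-1,2,-2), (0,0,2,-1,0,0), (1,-1,-1,-1,3,1), (0,2,0,1,0,0), (1,-1,-1,1,1,3)]]"
  by code_simp

lemma step_6_7:
  "list_all2 (one_ok 0 configs6 configs7 2) [0..2 - 1] [[(0,1,0,-1,0,2), (0,1,0,1,0,-1)],
    [(0,0,-1,-1,2,2), (0,1,0,1,0,0), (1,0,-1,-1,2,2)]]"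
  by code_simp

lemma step_6_8:
  "list_all2 (two_ok 0 configs6 configs8 17) [0..2 - 1] [[(2,0,2,1,4,0), (3,1,1,-1,-1,1),
    (1,0,-2,-1,4,2), (4,1,1,1,2,-2), (5,0,2,1,4,0), (6,0,2,-1,0,0), (7,0,-2,1,0,2), (8,0,2,1,4,0),
    (8,0,-2,1,0,2), (9,1,-1,1,-1,1), (5,0,-2,-1,4,2), (1,0,2,1,4,0), (4,1,-1,-1,2,4),
    (8,0,2,-1,0,0), (8,0,-2,-1,4,2), (9,1,1,-1,-1,1), (7,0,2,-1,0,0), (6,0,-2,1,0,2),
    (10,1,1,-1,-1,1), (1,0,-2,1,0,2), (4,-1,1,-1,2,-2), (5,0,-2,1,0,2), (5,0,2,-1,0,0),
    (1,0,2,-1,0,0), (4,-1,-1,1,2,4), (2,0,2,-1,0,0), (3,-1,1,1,5,1)], [(5,2,0,-1,0,6),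
    (11,-1,-1,1,1,5), (5,0,-2,1,-2,4), (11,1,1,-1,-1,3), (0,0,-2,1,0,6), (0,2,0,-1,-2,4),
    (12,2,0,1,0,0), (13,-2,0,1,4,4), (14,1,1,1,2,0), (13,0,2,-1,0,0), (12,0,-2,-1,4,4),
    (14,-1,-1,-1,4,2), (10,-2,0,-1,4,0), (15,-1,1,1,4,2), (4,2,0,-1,0,6), (11,0,-2,1,0,4),
    (15,2,0,-1,-2,4), (15,-1,1,-1,2,0), (15,0,-2,1,0,6), (11,2,0,-1,0,4), (4,0,-2,1,-2,4),
    (16,-1,1,1,4,2), (16,-1,1,-1,2,0), (3,0,-2,1,0,4)]]"
  by code_simp

lemma step_7_8:
  "list_all2 (one_ok 0 configs7 configs8 17) [0..2 - 1] [[(1,0,-1,-1,2,2), (0,0,1,-1,0,0),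
    (1,0,-1,1,0,2)], [(1,1,0,-1,0,2), (1,0,-1,1,0,2)]]"
  by code_simp

lemma step_7_9:
  "list_all2 (two_ok 0 configs7 configs9 36) [0..2 - 1] [[(1,-2,0,1,4,4), (2,1,-1,1,-1,3),
    (3,1,1,1,2,0), (4,-2,0,1,4,6), (5,2,0,-1,0,6), (6,0,-2,1,0,4), (7,0,2,1,4,0), (8,0,-2,1,0,4),
    (9,1,1,1,2,0), (10,-2,0,1,4,4), (11,-2,0,1,4,4), (11,0,-2,1,0,6), (12,1,-1,1,-1,3),
    (7,0,2,-1,0,0), (8,0,-2,-1,4,4), (9,-1,1,-1,2,0), (13,2,0,1,0,0), (0,2,0,-1,0,4),
    (14,2,0,1,0,0), (15,-2,0,1,4,4), (16,-1,1,1,5,3), (17,1,1,1,2,0), (3,-1,1,-1,2,0),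
    (11,2,0,-1,0,4), (18,-1,1,-1,2,0), (4,2,0,-1,0,6), (11,0,-2,-1,4,6), (12,-1,-1,-1,5,3),
    (19,0,-2,1,0,4), (19,0,-2,-1,4,4), (1,2,0,-1,0,4), (2,-1,-1,-1,5,3), (10,2,0,-1,0,4),
    (15,2,0,-1,0,4), (14,-2,0,-1,4,0), (16,1,1,-1,-1,3)], [(20,-2,0,1,4,4), (21,1,-1,1,-1,3),
    (22,0,-2,-1,4,4), (23,1,-1,1,-1,3), (24,0,2,1,4,0), (25,2,0,1,0,0), (26,-2,0,1,4,4),
    (27,-1,1,1,5,1), (28,0,2,1,4,0), (28,0,-2,1,0,4), (25,0,2,-1,0,0), (26,0,-2,-1,4,4),
    (27,1,-1,-1,1,5), (11,0,2,1,4,0), (11,-2,0,-1,4,0), (20,0,2,-1,0,0), (21,1,-1,-1,1,5),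
    (29,2,0,1,0,0), (29,0,-2,-1,4,4), (0,2,0,-1,0,4), (26,2,0,1,0,0), (25,-2,0,1,4,4),
    (27,1,-1,1,-1,3), (23,-1,1,-1,3,-1), (28,-2,0,-1,4,0), (28,2,0,-1,0,4), (20,0,-2,-1,4,4),
    (21,-1,1,-1,3,-1), (24,2,0,-1,0,4), (23,1,-1,-1,1,5), (11,2,0,-1,0,4), (11,0,-2,1,0,4),
    (23,-1,1,1,5,1), (26,0,2,-1,0,0), (25,0,-2,-1,4,4), (27,-1,1,-1,3,-1), (22,2,0,1,0,0),
    (20,2,0,1,0,0), (21,-1,1,1,5,1)]]"
  by code_simp

lemma step_8_9:
  "list_all2 (one_ok 0 configs8 configs9 36) [0..17 - 1] [[(11,1,0,-1,0,2), (11,1,0,1,0,0),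
    (11,-1,0,-1,3,0), (11,-1,0,1,3,2)], [(0,1,0,1,0,0), (11,-1,0,1,2,2), (0,1,0,1,0,0),
    (11,0,1,-1,0,0)], [(1,0,1,-1,0,0), (1,0,-1,1,0,3), (1,0,1,1,1,0), (1,0,-1,-1,1,3)],
    [(10,1,0,1,0,0), (10,0,1,-1,0,0), (24,1,0,1,0,0), (2,1,0,1,0,0), (2,0,1,-1,0,0)],
    [(30,0,-1,1,0,3), (12,1,0,-1,0,3), (4,1,0,1,0,0), (10,0,-1,1,0,3), (22,1,0,-1,0,3),
    (3,1,0,1,0,0)], [(11,0,1,-1,0,0), (31,1,0,1,0,0), (4,0,1,1,2,0), (11,0,1,-1,0,0),
    (1,0,-1,1,0,3), (20,0,-1,1,0,3)], [(0,1,0,1,0,0), (0,1,0,1,0,0), (31,1,0,-1,0,2),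
    (5,0,1,1,2,0), (32,1,0,1,0,0), (31,1,0,1,0,0), (0,1,0,1,0,0)], [(6,1,0,1,0,0),
    (13,0,1,-1,-1,0)], [(8,1,0,1,0,0), (7,1,0,1,-1,0), (33,1,0,1,0,-1)], [(30,0,1,-1,0,0),
    (9,0,1,1,3,0), (9,0,-1,1,0,3), (30,0,-1,-1,3,3)], [(24,1,0,1,0,0), (4,0,1,1,3,0),
    (4,1,0,-1,0,3), (17,0,1,1,3,0), (17,1,0,-1,0,3), (4,-1,0,-1,3,0), (4,0,-1,1,0,3),
    (24,0,-1,-1,3,3)], [(6,0,1,-1,0,0), (19,1,0,1,0,0), (28,0,1,-1,0,0), (12,0,1,1,2,0),
    (2,0,1,-1,0,0), (21,0,1,-1,0,0)], [(15,0,1,-1,0,0), (26,1,0,1,0,0), (7,0,1,-1,0,0)],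
    [(8,0,1,-1,0,0), (25,1,0,1,0,0), (14,0,1,-1,0,0), (34,0,1,1,3,0), (30,1,0,1,0,0)],
    [(35,1,0,1,0,0), (34,1,0,1,0,0), (27,0,-1,1,0,3), (16,0,1,-1,-1,0), (9,0,1,-1,0,0)],
    [(31,0,1,-1,0,0), (34,0,1,-1,0,0), (17,1,0,-1,0,2), (23,-1,0,-1,3,0), (3,0,1,-1,0,0),
    (19,0,1,1,3,0), (5,0,1,-1,0,0), (28,-1,0,1,3,2)], [(32,1,0,1,0,0), (31,0,1,-1,0,0),
    (35,0,1,-1,0,0), (3,1,0,-1,0,2), (23,1,0,1,-1,0), (18,1,0,1,0,0)]]"
  by code_simp

lemma step_9_10:
  "list_all2 (one_ok 6 configs9 configs10 6) [0..36 - 1] [[(0,0,-1,1,0,2), (0,-1,0,-1,2,0),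
    (0,1,0,1,0,0), (0,0,1,-1,0,0)], [(1,0,1,-1,0,0), (2,1,0,1,0,-1), (1,0,1,-1,0,0),
    (2,1,0,1,0,-1)], [], [], [(2,1,0,1,0,0), (3,1,0,1,0,0), (3,1,0,1,0,0), (2,1,0,1,0,0)],
    [(0,0,1,-1,0,0), (0,0,1,-1,0,0), (0,0,1,-1,0,0)], [], [], [], [], [], [(3,1,0,-1,0,2),
    (0,1,0,1,0,0), (4,0,-1,1,0,2), (0,1,0,1,0,0), (1,0,1,-1,0,0), (5,1,0,1,0,0)], [], [],
    [(4,0,1,-1,0,0), (4,1,0,-1,0,3), (2,1,0,-1,0,3), (2,1,0,-1,0,3), (4,0,1,-1,0,0),
    (4,1,0,-1,0,3)], [], [], [], [], [], [(5,1,0,-1,0,2), (5,1,0,-1,0,2)], [], [], [], [],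
    [(4,1,0,1,0,0), (4,1,0,1,0,0)], [], [], [], [], [(2,0,-1,1,0,3), (2,0,-1,1,0,3)],
    [(0,0,1,-1,0,0), (0,0,1,-1,0,0), (0,0,1,-1,0,0)], [(0,1,0,1,0,0), (0,1,0,1,0,0),
    (0,1,0,1,0,0)], [], [], []]"
  by code_simp

lemma step_9_11:
  "list_all2 (two_ok 7 configs9 configs11 20) [0..36 - 1] [[(2,-2,0,1,4,4), (11,1,-1,1,-2,2),
    (12,0,2,1,4,0), (2,0,-2,-1,4,4), (11,-1,1,-1,2,-2), (13,0,2,1,4,0), (3,2,0,1,0,0),
    (14,1,-1,1,-2,2), (12,2,0,-1,0,4), (3,0,2,-1,0,0), (13,2,0,-1,0,4), (14,-1,1,-1,2,-2),
    (15,0,2,1,4,0), (15,2,0,-1,0,4), (2,-2,0,-1,4,0), (11,1,1,-1,-2,2), (16,0,-2,-1,4,4),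
    (17,1,1,-1,-2,2), (16,0,2,1,4,0), (3,0,2,1,4,0), (13,-2,0,1,4,4), (14,1,1,1,2,-2),
    (18,2,0,1,0,0), (18,2,0,-1,0,4), (13,-2,0,-1,4,0), (3,0,-2,-1,4,4), (14,1,-1,-1,2,6),
    (3,2,0,-1,0,4), (13,0,-2,-1,4,4), (14,1,1,-1,-2,2), (2,0,2,1,4,0), (11,-1,-1,1,2,6),
    (15,2,0,1,0,0), (15,0,-2,-1,4,4), (13,2,0,1,0,0), (3,0,-2,1,0,4), (14,-1,-1,1,2,6),
    (12,2,0,1,0,0), (17,1,1,1,2,-2), (18,0,2,1,4,0), (18,0,2,-1,0,0), (2,0,-2,1,0,4),
    (11,1,1,1,2,-2), (16,2,0,-1,0,4), (3,-2,0,1,4,4), (13,0,-2,1,0,4), (14,-1,1,1,6,2),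
    (17,1,-1,-1,2,6), (17,-1,1,1,6,2), (13,0,2,-1,0,0), (3,-2,0,-1,4,0), (14,-1,-1,-1,6,2),
    (16,2,0,1,0,0), (2,0,2,-1,0,0), (11,1,-1,-1,2,6), (2,2,0,-1,0,4), (11,-1,-1,-1,6,2),
    (12,0,2,-1,0,0), (2,2,0,1,0,0), (11,-1,1,1,6,2)], [(2,2,0,-1,0,4), (5,2,0,1,0,-2),
    (0,2,0,1,0,-2), (0,2,0,-1,0,4), (6,0,2,1,6,-2), (2,-2,0,1,6,4)], [(11,0,2,-1,0,-2)],
    [(1,2,0,-1,0,4), (19,2,0,1,0,0), (1,2,0,-1,0,4), (17,0,-2,1,-2,6), (5,2,0,1,0,0)],
    [(1,2,0,-1,0,4), (16,2,0,-1,0,6), (0,0,2,1,6,0), (0,-2,0,-1,6,0)], [(5,-2,0,-1,4,0),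
    (9,0,-2,-1,4,6), (18,2,0,-1,0,6), (9,0,-2,1,0,6), (5,2,0,1,0,0)], [(18,0,2,-1,0,0)],
    [(13,0,2,-1,0,0)], [(3,2,0,-1,0,4), (10,0,2,-1,0,0), (3,2,0,-1,0,4), (10,0,2,-1,0,0),
    (6,0,2,-1,0,0)], [(19,2,0,1,0,0), (5,0,2,-1,0,0), (14,0,-2,-1,6,6)], [(16,2,0,1,0,0),
    (8,0,2,1,6,0), (6,2,0,1,0,0), (8,0,2,1,6,0)], [(8,2,0,-1,0,4), (4,2,0,1,0,0), (10,2,0,1,0,0),
    (9,0,-2,1,0,4), (0,2,0,1,0,-2), (2,-2,0,1,6,4), (0,0,-2,-1,6,4), (0,-2,0,-1,6,-2),
    (3,2,0,-1,0,4), (1,0,2,1,4,0), (7,2,0,-1,0,4), (8,0,2,1,6,0)], [(11,0,-2,1,0,6),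
    (7,2,0,-1,0,6), (7,2,0,-1,0,6), (19,0,2,1,6,0), (5,-2,0,-1,6,0)], [(12,2,0,1,0,0)],
    [(3,0,-2,-1,4,6), (3,2,0,-1,0,4), (5,-2,0,-1,6,0), (9,2,0,-1,0,6), (10,-2,0,-1,6,0),
    (6,0,-2,-1,6,6)], [(13,0,2,-1,0,0)], [(14,0,-2,-1,6,8)], [(1,2,0,-1,0,4), (5,0,2,-1,0,0),
    (7,0,-2,-1,6,6), (1,2,0,-1,0,4), (5,2,0,1,0,0), (17,0,-2,-1,6,6)], [(1,2,0,-1,0,4),
    (1,2,0,-1,0,4), (19,2,0,1,0,0), (17,2,0,1,-2,-2), (19,0,2,-1,0,0)], [(18,2,0,1,0,0),
    (5,0,-2,-1,4,6), (7,0,2,-1,-2,0), (2,0,-2,-1,4,6), (9,0,2,1,4,0), (2,0,-2,-1,4,6)],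
    [(10,2,0,-1,0,4), (8,0,2,-1,0,0), (2,2,0,-1,0,4), (19,0,2,1,6,0), (6,0,-2,1,0,4),
    (2,-2,0,-1,6,0)], [(11,0,2,-1,0,-2)], [(0,0,-2,-1,6,6), (19,2,0,-1,0,6), (16,2,0,1,0,0),
    (0,-2,0,1,6,6), (0,0,-2,-1,6,6), (19,0,2,1,6,0), (0,-2,0,1,6,6)], [(17,2,0,1,0,-2),
    (4,2,0,1,2,0), (4,2,0,1,2,0)], [(16,2,0,1,0,0), (6,2,0,1,0,0), (6,0,2,-1,0,0), (8,2,0,-1,0,6),
    (8,0,2,1,6,0)], [(19,2,0,-1,0,6), (3,0,2,1,4,0), (0,2,0,-1,0,6), (0,0,-2,-1,6,6),
    (0,2,0,-1,0,6)], [(13,2,0,1,0,0)], [(14,0,-2,1,0,6)], [(9,2,0,-1,0,4), (19,0,-2,-1,6,4),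
    (18,0,2,-1,0,0), (2,-2,0,1,6,4), (2,-2,0,1,6,4)], [(15,2,0,1,0,0)], [(0,0,-2,-1,6,6),
    (0,0,2,-1,0,0), (19,2,0,-1,0,6), (0,0,2,-1,0,0), (6,-2,0,1,6,6)], [(3,0,2,-1,0,0),
    (19,2,0,1,0,0), (5,0,2,1,4,0)], [(19,2,0,-1,0,4), (19,2,0,1,0,0), (2,2,0,-1,0,4),
    (2,2,0,1,0,0)], [], [(3,0,2,1,4,0), (3,0,2,1,4,0), (9,0,-2,1,0,6), (5,2,0,1,0,0)],
    [(3,0,2,1,4,0), (3,0,2,1,4,0), (19,0,2,-1,0,0)]]"
  by code_simp

lemma step_10_11:
  "list_all2 (one_ok 7 configs10 configs11 20) [0..6 - 1] [[(3,1,0,-1,0,2), (1,1,0,1,0,0),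
    (4,1,0,1,0,0), (1,1,0,-1,0,2), (3,1,0,1,0,0), (2,1,0,-1,0,2), (2,1,0,1,0,0)],
    [(2,0,-1,-1,2,3), (2,0,1,1,2,0), (0,0,1,-1,-1,0), (2,0,1,1,2,0), (0,0,-1,1,-1,3),
    (2,0,-1,-1,2,3), (0,0,-1,1,-1,3), (0,0,1,-1,-1,0)], [(5,-1,0,1,3,3), (0,1,0,-1,0,3),
    (6,0,-1,1,0,3), (0,-1,0,-1,3,0), (0,1,0,-1,0,3), (6,0,1,1,3,0), (0,-1,0,-1,3,0),
    (5,1,0,1,0,0)], [(0,1,0,-1,0,3), (0,0,1,1,3,0), (1,1,0,-1,0,2), (7,1,0,1,0,0), (8,1,0,1,0,0),
    (0,0,1,1,3,0), (8,0,1,-1,0,0), (0,1,0,-1,0,3), (1,1,0,-1,0,2)], [(3,0,1,1,2,0),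
    (0,1,0,-1,0,3), (9,1,0,1,0,0), (10,0,-1,1,0,3), (0,0,-1,-1,3,3), (0,0,-1,-1,3,3),
    (3,0,1,1,2,0), (0,1,0,-1,0,3)], [(8,0,-1,1,0,2), (2,1,0,1,0,0), (10,-1,0,1,3,2),
    (2,-1,0,1,3,2), (2,1,0,1,0,0), (10,1,0,1,0,0), (2,-1,0,1,3,2), (8,0,1,1,3,0)]]"
  by code_simp

text \<open>Only the extremal ten-point set has to be extended by two points. An
  \<open>almost11\<close> set consists of it and a point on no square, and a twelfth point can form
  squares with that point.\<close>

lemma step_10_12:
  "list_all2 (two_ok 10 configs10 configs12 4) [0..1 - 1] [[(2,0,2,-1,0,0), (2,0,-2,1,0,4),
    (3,0,2,-1,0,0), (2,2,0,-1,0,4), (1,2,0,-1,0,4), (1,2,0,1,0,0), (2,2,0,1,0,0)]]"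
  by code_simp

lemma step_11_12:
  "list_all2 (one_ok 10 configs11 configs12 4) [0..20 - 1] [[(0,1,0,1,0,0), (1,-1,0,1,3,3),
    (2,0,-1,1,0,3), (0,1,0,1,0,0), (2,0,-1,1,0,3), (0,1,0,1,0,0), (1,-1,0,1,3,3)],
    [(2,0,-1,1,0,2), (2,1,0,-1,0,2), (2,1,0,-1,0,2), (2,0,-1,1,0,2)], [(1,1,0,1,0,0),
    (2,0,1,-1,0,0), (3,0,1,-1,0,0), (2,0,1,-1,0,0), (3,0,1,-1,0,0), (1,1,0,1,0,0)],
    [(1,1,0,-1,0,2), (2,1,0,-1,0,2), (2,1,0,-1,0,2), (1,1,0,-1,0,2)], [], [(2,0,1,-1,0,0),
    (2,0,1,-1,0,0), (2,0,1,-1,0,0)], [(1,0,1,-1,0,0), (1,0,1,-1,0,0), (1,0,1,-1,0,0)], [],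
    [(1,0,-1,1,0,3), (1,0,-1,1,0,3), (1,0,-1,1,0,3)], [(1,-1,0,-1,3,0), (1,-1,0,-1,3,0),
    (1,-1,0,-1,3,0)], [(2,0,1,-1,0,0), (2,0,1,-1,0,0), (2,0,1,-1,0,0)], [], [], [], [], [],
    [(1,1,0,1,0,0), (1,1,0,1,0,0), (1,0,1,-1,0,0), (1,0,1,-1,0,0), (1,1,0,1,0,0), (1,0,1,-1,0,0)],
    [], [(3,1,0,1,0,0), (3,1,0,1,0,0), (3,1,0,1,0,0)], [(2,1,0,1,0,0), (2,1,0,1,0,0),
    (2,1,0,1,0,0)]]"
  by code_simp

text \<open>This refutes the second case of \<open>linked10_cases\<close> for ten points with at
  least six squares.\<close>

lemma step_8_10: "list_all (no_iso 6 configs8) [0..17 - 1]"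
  by code_simp

text \<open>The ten-point sets with five squares that arise here are not tabulated. Each is extended
  at once by an eleventh point to at least seven squares, whence the two thresholds and the doubly
  nested certificates.\<close>

lemma step_8_11:
  "list_all2 (iso_ok 5 7 configs8 configs11 20) [0..17 - 1] [[[], [], [(0,0,-2,1,0,4),
    (0,0,-2,-1,6,4), (0,0,-2,-1,6,4), (0,0,-2,1,0,4), (0,0,-2,1,0,4), (0,0,-2,-1,6,4)], [], [],
    [], [], [], [], [], [], [], [], [(7,0,2,-1,0,0), (9,0,2,1,6,0), (7,0,2,-1,0,0),
    (9,0,2,1,6,0)], [(7,0,-2,1,0,4), (7,0,-2,1,0,4), (9,0,-2,-1,6,4), (9,0,-2,-1,6,4)], [], [],
    [], [(0,0,2,1,6,0), (0,0,2,-1,0,0), (0,0,2,-1,0,0), (0,0,2,1,6,0), (0,0,2,-1,0,0),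
    (0,0,2,1,6,0)], [], [], [], [], [], [], [], [], [], [], [(7,0,-2,-1,6,4), (9,0,-2,1,0,4),
    (7,0,-2,-1,6,4), (9,0,-2,1,0,4)], [(9,0,2,-1,0,0), (7,0,2,1,6,0), (7,0,2,1,6,0),
    (9,0,2,-1,0,0)], [], [], [], [], [], [], []], [[(11,1,-1,1,-2,2), (11,1,-1,1,-2,2)],
    [(12,0,-2,-1,4,4), (12,0,-2,-1,4,4)], [(2,0,-2,-1,4,4), (2,0,-2,-1,4,4), (6,-2,0,1,4,4),
    (2,0,-2,-1,4,4), (6,-2,0,1,4,4)], [(11,-1,1,-1,2,-2), (11,-1,1,-1,2,-2)], [(13,0,2,1,4,0),
    (13,0,2,1,4,0)], [(3,2,0,1,0,0), (3,2,0,1,0,0), (3,2,0,1,0,0)], [(14,1,-1,1,-2,2),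
    (14,1,-1,1,-2,2)], [(13,2,0,-1,0,4), (13,2,0,-1,0,4)], [(14,-1,1,-1,2,-2), (14,-1,1,-1,2,-2)],
    [(15,0,2,1,4,0), (15,0,2,1,4,0)], [(15,2,0,-1,0,4), (15,2,0,-1,0,4)], [(11,1,1,-1,-2,2),
    (11,1,1,-1,-2,2)], [(8,0,-2,1,-2,4), (6,-2,0,1,4,4), (16,0,-2,-1,4,4), (6,-2,0,1,4,4),
    (8,0,-2,1,-2,4), (16,0,-2,-1,4,4)], [(17,1,1,-1,-2,2), (17,1,1,-1,-2,2)], [(0,0,-2,1,-2,6),
    (16,0,2,1,4,0), (0,0,-2,1,-2,6), (0,2,0,-1,-2,6), (0,2,0,-1,-2,6), (16,0,2,1,4,0),
    (0,0,-2,1,-2,6), (0,2,0,-1,-2,6)], [(18,2,0,1,0,0), (2,0,-2,-1,4,6), (9,0,2,1,4,0),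
    (18,2,0,1,0,0), (2,0,-2,-1,4,6), (9,0,2,1,4,0), (2,0,-2,-1,4,6)], [(18,2,0,-1,0,4),
    (18,2,0,-1,0,4)], [(13,-2,0,-1,4,0), (13,-2,0,-1,4,0)], [(3,0,-2,-1,4,4), (3,0,-2,-1,4,4),
    (3,0,-2,-1,4,4)], [(14,1,-1,-1,2,6), (14,1,-1,-1,2,6)], [(3,2,0,-1,0,4), (3,2,0,-1,0,4),
    (10,0,2,-1,0,0), (6,0,2,-1,0,0), (6,0,2,-1,0,0), (3,2,0,-1,0,4), (10,0,2,-1,0,0)],
    [(13,0,-2,-1,4,4), (13,0,-2,-1,4,4)], [(14,1,1,-1,-2,2), (14,1,1,-1,-2,2)], [(11,-1,-1,1,2,6),
    (11,-1,-1,1,2,6)], [(13,2,0,1,0,0), (13,2,0,1,0,0)], [(10,-2,0,1,4,4), (3,0,-2,1,0,4),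
    (6,-2,0,1,4,4), (3,0,-2,1,0,4), (6,-2,0,1,4,4), (10,-2,0,1,4,4), (3,0,-2,1,0,4)],
    [(14,-1,-1,1,2,6), (14,-1,-1,1,2,6)], [(12,2,0,1,0,0), (12,2,0,1,0,0)], [(17,1,1,1,2,-2),
    (17,1,1,1,2,-2)], [(2,2,0,1,-2,0), (9,-2,0,-1,4,0), (18,0,-2,-1,4,4), (2,2,0,1,-2,0),
    (2,2,0,1,-2,0), (18,0,-2,-1,4,4), (9,-2,0,-1,4,0)], [(18,0,2,-1,0,0), (18,0,2,-1,0,0)],
    [(16,2,0,-1,0,4), (16,2,0,-1,0,4)], [(13,0,-2,1,0,4), (13,0,-2,1,0,4)], [(14,-1,1,1,6,2),
    (14,-1,1,1,6,2)], [(17,1,-1,-1,2,6), (17,1,-1,-1,2,6)], [(17,-1,-1,-1,6,2),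
    (17,-1,-1,-1,6,2)], [(16,2,0,1,0,0), (6,0,2,-1,0,0), (16,2,0,1,0,0), (8,2,0,-1,0,6),
    (6,0,2,-1,0,0), (8,2,0,-1,0,6)], [(11,1,-1,-1,2,6), (11,1,-1,-1,2,6)], [(2,2,0,1,0,0),
    (6,0,2,-1,0,0), (2,2,0,1,0,0), (6,0,2,-1,0,0), (2,2,0,1,0,0)], [(11,-1,1,1,6,2),
    (11,-1,1,1,6,2)]], [], [], [], [], [], [], [[(3,2,0,-1,0,4), (3,2,0,-1,0,4), (19,2,0,1,0,0),
    (3,2,0,-1,0,4), (19,2,0,1,0,0)], [(10,0,2,-1,0,0), (19,2,0,1,0,0), (10,0,2,-1,0,0),
    (19,2,0,1,0,0)], [(3,2,0,-1,0,4), (3,2,0,-1,0,4), (19,2,0,1,0,0), (3,2,0,-1,0,4),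
    (19,2,0,1,0,0)], [(10,0,2,-1,0,0), (19,2,0,1,0,0), (10,0,2,-1,0,0), (19,2,0,1,0,0)]], [], [],
    [], [[], []], [], [], [], []]"
  by code_simp

lemma step_12_13: "list_all (no_one 14 configs12) [0..4 - 1]"
  by code_simp

section \<open>Extending listed configurations\<close>

definition listed :: "(int \<Rightarrow> ipt list) \<Rightarrow> int \<Rightarrow> (real \<times> real) set \<Rightarrow> bool" where
  "listed c n A \<longleftrightarrow> (\<exists>i. 0 \<le> i \<and> i < n \<and> copy A (c i))"

text \<open>The test checks one inclusion and equal lengths. As the similarity is injective and both
  lists are distinct, the image is then the whole set.\<close>

lemma matches_listed:
  assumes "matches c n Q m" "\<And>i. 0 \<le> i \<Longrightarrow> i < n \<Longrightarrow> distinct (c i)" "distinct Q" "copy A Q"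
  shows "listed c n A"
proof -
  obtain i a b s t r where m: "m = (i, a, b, s, t, r)" by (metis surj_pair)
  have i: "0 \<le> i" "i < n" "length (c i) = length Q" "a \<noteq> 0 \<or> b \<noteq> 0" "s = 1 \<or> s = -1"
    and pt: "\<forall>p\<in>set (c i). image_point a b s t r p \<in> set Q"
    using assms(1) by (simp_all add: matches_def m Let_def list_all_iff mem_iff case_prod_beta split: if_splits)
  define g where "g = aff (of_int a) (of_int b) (of_int s) (of_int t) (of_int r)"
  have g: "nice g" unfolding g_def by (rule nice_aff) (use i in auto)
  have ge: "g (emb p) = emb (image_point a b s t r p)" for p
    by (cases p) (simp add: g_def aff_def emb_def image_point_def)
  have d: "distinct (c i)" using assms(2) i(1,2) by blast
  have "g ` pts (c i) \<subseteq> pts Q" using pt by (auto simp: pts_def ge)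
  moreover have "card (g ` pts (c i)) = card (pts Q)"
    using g card_pts[OF d] card_pts[OF assms(3)] i(3)
    by (metis bij_is_inj card_image inj_on_subset nice_def subset_UNIV)
  ultimately have "pts Q = g ` pts (c i)" by (metis card_subset_eq finite_pts)
  then have "copy (pts Q) (c i)" using copy_image[OF copy_pts[OF d] g] by simp
  moreover obtain h where "nice h" "A = h ` pts Q" using assms(4) copy_def by blast
  ultimately have "copy A (c i)" using copy_image by blast
  then show ?thesis using i(1,2) by (auto simp: listed_def)
qed

lemma list_all_upto: "list_all Q [0..n - 1] \<Longrightarrow> 0 \<le> i \<Longrightarrow> i < n \<Longrightarrow> Q i"
  by (simp add: list_all_iff)

lemma list_all2_ex: "list_all2 Q xs ys \<Longrightarrow> x \<in> set xs \<Longrightarrow> \<exists>y. Q x y"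
  by (metis in_set_conv_nth list_all2_conv_all_nth)

lemma list_all2_upto: "list_all2 Q [0..n - 1] ys \<Longrightarrow> 0 \<le> i \<Longrightarrow> i < n \<Longrightarrow> \<exists>y. Q i y"
  using list_all2_ex[of Q "[0..n - 1]" ys i] by simp

lemma num_squares_less:
  assumes "finite B" "A \<subseteq> B" "S \<in> sqs B" "\<not> S \<subseteq> A"
  shows "num_squares A < num_squares B"
proof -
  have "sqs A \<subset> sqs B" using assms by (auto simp: sqs_def)
  then show ?thesis unfolding num_squares_sqs using finite_sqs[OF assms(1)] psubset_card_mono by blast
qed

lemma nice_image_inv: "nice g \<Longrightarrow> g ` inv g ` B = B"
  by (simp add: nice_def bij_is_surj image_f_inv_f)

lemma nice_image_Diff: "nice g \<Longrightarrow> g ` (A - B) = g ` A - g ` B"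
  by (simp add: nice_def bij_is_inj image_set_diff)

lemma nice_card: "nice g \<Longrightarrow> card (g ` A) = card A"
  by (metis bij_is_inj card_image inj_on_subset nice_def subset_UNIV)

lemma copy_one_ext:
  assumes "copy A Q" "x \<notin> A" "num_squares A < num_squares (insert x A)" "m \<le> num_squares (insert x A)"
  obtains R where "R \<in> set (one_ext m Q)" "copy (insert x A) R"
proof -
  obtain g where g: "nice g" "A = g ` pts Q" and Q: "distinct Q" using assms(1) by (auto simp: copy_def)
  define y where "y = inv g x"
  have x: "x = g y" using g(1) by (simp add: y_def nice_def bij_is_surj surj_f_inv_f)
  have eq: "insert x A = g ` insert y (pts Q)" by (simp add: x g(2))
  have y: "y \<notin> pts Q" using assms(2) x g(2) by blast
  obtain v where v: "y = emb v" "Q @ [v] \<in> set (one_ext m Q)"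
    using one_ext[OF Q y] assms(3,4) unfolding eq unfolding g(2) num_squares_nice[OF g(1)] by metis
  have "v \<notin> set Q" using y v(1) by simp
  then have "copy (insert x A) (Q @ [v])"
    unfolding copy_def using Q g(1) eq v(1) by (intro conjI exI[of _ g]) auto
  then show thesis using that v(2) by blast
qed

lemma copy_two_ext:
  assumes "copy A Q" "is_square S" "card (S - A) = 2" "m \<le> num_squares (A \<union> S)"
  obtains R where "R \<in> set (two_ext m Q)" "copy (A \<union> S) R"
proof -
  obtain g where g: "nice g" "A = g ` pts Q" and Q: "distinct Q" using assms(1) by (auto simp: copy_def)
  define T where "T = inv g ` S"
  have S: "S = g ` T" using nice_image_inv[OF g(1)] by (simp add: T_def)
  have eq: "A \<union> S = g ` (pts Q \<union> T)" using g(2) S by (simp add: image_Un)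
  have "card (g ` (T - pts Q)) = 2" using assms(3) unfolding nice_image_Diff[OF g(1)] S g(2) .
  then have "card (T - pts Q) = 2" using nice_card[OF g(1)] by simp
  moreover have "is_square T" using assms(2) g(1) unfolding S nice_def by blast
  moreover have "m \<le> num_squares (pts Q \<union> T)" using assms(4) unfolding eq num_squares_nice[OF g(1)] .
  ultimately obtain R where R: "R \<in> set (two_ext m Q)" "pts Q \<union> T = half ` pts R" "distinct R"
    using two_ext[OF Q] by metis
  have "A \<union> S = (g \<circ> half) ` pts R" unfolding eq R(2) by (simp add: image_comp)
  then have "copy (A \<union> S) R" unfolding copy_def using R(3) nice_comp[OF g(1) nice_half] by blast
  then show thesis using that R(1) by blast
qed

lemma copy_two_ext_iso:
  assumes "copy A Q" "is_square S" "card (S - A) = 2" "m \<le> num_squares (A \<union> S)"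
    and iso: "\<And>T. T \<in> sqs (A \<union> S) \<Longrightarrow> \<not> T \<subseteq> A \<Longrightarrow> card (T - A) = 2"
  obtains R where "R \<in> set (two_ext_iso m Q)" "copy (A \<union> S) R"
proof -
  obtain g where g: "nice g" "A = g ` pts Q" and Q: "distinct Q" using assms(1) by (auto simp: copy_def)
  define T where "T = inv g ` S"
  have S: "S = g ` T" using nice_image_inv[OF g(1)] by (simp add: T_def)
  have eq: "A \<union> S = g ` (pts Q \<union> T)" using g(2) S by (simp add: image_Un)
  have "card (g ` (T - pts Q)) = 2" using assms(3) unfolding nice_image_Diff[OF g(1)] S g(2) .
  then have "card (T - pts Q) = 2" using nice_card[OF g(1)] by simp
  moreover have "is_square T" using assms(2) g(1) unfolding S nice_def by blast
  moreover have "m \<le> num_squares (pts Q \<union> T)" using assms(4) unfolding eq num_squares_nice[OF g(1)] .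
  moreover have "card (X - pts Q) = 2" if X: "X \<in> sqs (pts Q \<union> T)" "\<not> X \<subseteq> pts Q" for X
  proof -
    have "g ` X \<in> sqs (A \<union> S)" using X(1) g(1) unfolding eq sqs_def nice_def by blast
    moreover have "\<not> g ` X \<subseteq> A" using X(2) g unfolding nice_def by (metis bij_is_inj inj_image_subset_iff)
    ultimately have "card (g ` X - A) = 2" by (rule iso)
    then have "card (g ` (X - pts Q)) = 2" unfolding nice_image_Diff[OF g(1)] g(2) .
    then show ?thesis using nice_card[OF g(1)] by simp
  qed
  ultimately obtain R where R: "R \<in> set (two_ext_iso m Q)" "pts Q \<union> T = half ` pts R" "distinct R"
    using two_ext_iso[OF Q] by metis
  have "A \<union> S = (g \<circ> half) ` pts R" unfolding eq R(2) by (simp add: image_comp)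
  then have "copy (A \<union> S) R" unfolding copy_def using R(3) nice_comp[OF g(1) nice_half] by blast
  then show thesis using that R(1) by blast
qed

lemma listed_one_ext:
  assumes check: "list_all2 (\<lambda>i. list_all2 (matches c' n') (one_ext m (c i))) [0..n - 1] ms"
    and wf: "list_all (\<lambda>i. distinct (c' i) \<and> length (c' i) = k) [0..n' - 1]"
    and "listed c n A" "x \<notin> A" "num_squares A < num_squares (insert x A)" "m \<le> num_squares (insert x A)"
  shows "listed c' n' (insert x A)"
proof -
  obtain i where i: "0 \<le> i" "i < n" "copy A (c i)" using assms(3) by (auto simp: listed_def)
  obtain R where R: "R \<in> set (one_ext m (c i))" "copy (insert x A) R"
    using copy_one_ext[OF i(3) assms(4-6)] by metis
  obtain ys where "list_all2 (matches c' n') (one_ext m (c i)) ys" using list_all2_upto[OF check i(1,2)] by blast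
  then obtain y where "matches c' n' R y" using list_all2_ex R(1) by metis
  then show ?thesis
    using matches_listed[of c' n' R y] list_all_upto[OF wf] R(2) copy_def by blast
qed

lemma listed_two_ext:
  assumes check: "list_all2 (\<lambda>i. list_all2 (matches c' n') (two_ext m (c i))) [0..n - 1] ms"
    and wf: "list_all (\<lambda>i. distinct (c' i) \<and> length (c' i) = k) [0..n' - 1]"
    and "listed c n A" "is_square S" "card (S - A) = 2" "m \<le> num_squares (A \<union> S)"
  shows "listed c' n' (A \<union> S)"
proof -
  obtain i where i: "0 \<le> i" "i < n" "copy A (c i)" using assms(3) by (auto simp: listed_def)
  obtain R where R: "R \<in> set (two_ext m (c i))" "copy (A \<union> S) R"
    using copy_two_ext[OF i(3) assms(4-6)] by metis
  obtain ys where "list_all2 (matches c' n') (two_ext m (c i)) ys" using list_all2_upto[OF check i(1,2)] by blast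
  then obtain y where "matches c' n' R y" using list_all2_ex R(1) by metis
  then show ?thesis
    using matches_listed[of c' n' R y] list_all_upto[OF wf] R(2) copy_def by blast
qed

lemma listed_facts:
  assumes "list_all (\<lambda>i. distinct (c i) \<and> length (c i) = k) [0..n - 1]" "listed c n A"
  shows "card A = k" "finite A"
  using assms list_all_upto[OF assms(1)] copy_card copy_finite by (auto simp: listed_def)

lemma listed_num_squares:
  assumes "map (\<lambda>i. sqcount (c i)) [0..n - 1] = ns" "listed c n A"
  shows "num_squares A \<in> set ns"
proof -
  obtain i where "0 \<le> i" "i < n" "copy A (c i)" using assms(2) by (auto simp: listed_def)
  then show ?thesis using assms(1) copy_num_squares by force
qed

section \<open>Classification\<close>

lemma config_ok_wf: "list_all (config_ok c k) [0..n - 1] \<Longrightarrow> list_all (\<lambda>i. distinct (c i) \<and> length (c i) = k) [0..n - 1]"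
  by (simp add: config_ok_def list_all_iff)

lemmas wf4 = config_ok_wf[OF configs_wf(1)] and wf6 = config_ok_wf[OF configs_wf(2)]
  and wf7 = config_ok_wf[OF configs_wf(3)] and wf8 = config_ok_wf[OF configs_wf(4)]
  and wf9 = config_ok_wf[OF configs_wf(5)] and wf10 = config_ok_wf[OF configs_wf(6)]
  and wf11 = config_ok_wf[OF configs_wf(7)] and wf12 = config_ok_wf[OF configs_wf(8)]

abbreviation "listed4 \<equiv> listed configs4 1"
abbreviation "listed6 \<equiv> listed configs6 2"
abbreviation "listed7 \<equiv> listed configs7 2"
abbreviation "listed8 \<equiv> listed configs8 17"
abbreviation "listed9 \<equiv> listed configs9 36"
abbreviation "listed10 \<equiv> listed configs10 6"
abbreviation "listed11 \<equiv> listed configs11 20"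
abbreviation "listed12 \<equiv> listed configs12 4"

lemmas card6 = listed_facts[OF wf6] and card7 = listed_facts[OF wf7] and card8 = listed_facts[OF wf8]
  and card9 = listed_facts[OF wf9] and card10 = listed_facts[OF wf10]
  and card11 = listed_facts[OF wf11] and card12 = listed_facts[OF wf12] and card4 = listed_facts[OF wf4]

lemma num6: "listed6 A \<Longrightarrow> num_squares A = 2"
  using listed_num_squares[OF sqcount_configs(1)[unfolded o_def]] by fastforce
lemma num7: "listed7 A \<Longrightarrow> num_squares A = 3"
  using listed_num_squares[OF sqcount_configs(2)[unfolded o_def]] by fastforce
lemma num8: "listed8 A \<Longrightarrow> num_squares A = 3 \<or> num_squares A = 4"
  using listed_num_squares[OF sqcount_configs(3)[unfolded o_def]] by fastforce
lemma num9: "listed9 A \<Longrightarrow> num_squares A = 4 \<or> num_squares A = 5 \<or> num_squares A = 6"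
  using listed_num_squares[OF sqcount_configs(4)[unfolded o_def]] by fastforce
lemma num10: "listed10 A \<Longrightarrow> num_squares A = 6 \<or> num_squares A = 7"
  using listed_num_squares[OF sqcount_configs(5)[unfolded o_def]] by fastforce
lemma num11: "listed11 A \<Longrightarrow> num_squares A = 7 \<or> num_squares A = 8"
  using listed_num_squares[OF sqcount_configs(6)[unfolded o_def]] by fastforce
lemma num12: "listed12 A \<Longrightarrow> num_squares A = 10 \<or> num_squares A = 11"
  using listed_num_squares[OF sqcount_configs(7)[unfolded o_def]] by fastforce

lemma one_ok_check: "list_all2 (one_ok m c c' n') xs ys \<Longrightarrow> list_all2 (\<lambda>i. list_all2 (matches c' n') (one_ext m (c i))) xs ys"
  by (simp add: one_ok_def list_all2_conv_all_nth)

lemma two_ok_check: "list_all2 (two_ok m c c' n') xs ys \<Longrightarrow> list_all2 (\<lambda>i. list_all2 (matches c' n') (two_ext m (c i))) xs ys"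
  by (simp add: two_ok_def list_all2_conv_all_nth)

lemmas to7 = listed_one_ext[OF one_ok_check[OF step_6_7] wf7]
  and to8 = listed_one_ext[OF one_ok_check[OF step_7_8] wf8]
  and to9 = listed_one_ext[OF one_ok_check[OF step_8_9] wf9]
  and to10 = listed_one_ext[OF one_ok_check[OF step_9_10] wf10]
  and to11 = listed_one_ext[OF one_ok_check[OF step_10_11] wf11]
  and to12 = listed_one_ext[OF one_ok_check[OF step_11_12] wf12]
  and two_to6 = listed_two_ext[OF two_ok_check[OF step_4_6] wf6]
  and two_to8 = listed_two_ext[OF two_ok_check[OF step_6_8] wf8]
  and two_to9 = listed_two_ext[OF two_ok_check[OF step_7_9] wf9]
  and two_to11 = listed_two_ext[OF two_ok_check[OF step_9_11] wf11]
  and two_to12 = listed_two_ext[OF two_ok_check[OF step_10_12] wf12]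

section \<open>Adding a square to a listed set\<close>

lemma sqs_subset: "S \<in> sqs P \<Longrightarrow> S \<subseteq> P" and sqs_square: "S \<in> sqs P \<Longrightarrow> is_square S"
  by (auto simp: sqs_def)

lemma card_square_Diff: "is_square S \<Longrightarrow> card (S - A) + card (S \<inter> A) = 4"
  using card_Diff_subset_Int[of S A] card_square[of S] finite_square[of S] card_mono[of S "S \<inter> A"] by fastforce

lemma card_Diff_pos: "is_square S \<Longrightarrow> \<not> S \<subseteq> A \<Longrightarrow> 1 \<le> card (S - A)"
  using finite_square by (metis Diff_eq_empty_iff One_nat_def Suc_leI card_gt_0_iff finite_Diff)

text \<open>The predicate \<open>L\<close> stands for membership in the next table. The square
  \<open>S\<close> provides the strict increase that the one-point extension asks for.\<close>

lemma listed_add_square: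
  assumes "card (S - A) = 1" "is_square S" "finite A"
    and step: "\<And>x. x \<notin> A \<Longrightarrow> num_squares A < num_squares (insert x A) \<Longrightarrow> L (insert x A)"
  shows "L (A \<union> S)"
proof -
  obtain x where x: "S - A = {x}" using assms(1) by (auto simp: card_1_singleton_iff)
  then have eq: "A \<union> S = insert x A" by auto
  have "num_squares A < num_squares (insert x A)"
    by (rule num_squares_less[of _ _ S]) (use x assms(2,3) in \<open>auto simp: sqs_def\<close>)
  then show ?thesis unfolding eq using step x by blast
qed

lemma card_Diff_one_or_two:
  assumes "is_square S" "\<not> S \<subseteq> A" "2 \<le> card (S \<inter> A)"
  shows "card (S - A) = 1 \<or> card (S - A) = 2"
  using card_square_Diff[OF assms(1), of A] card_Diff_pos[OF assms(1,2)] assms(3) by arith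

lemma add6:
  assumes "listed6 A" "is_square S" "\<not> S \<subseteq> A" "2 \<le> card (S \<inter> A)"
  shows "listed7 (A \<union> S) \<or> listed8 (A \<union> S)"
  using card_Diff_one_or_two[OF assms(2-4)]
    listed_add_square[OF _ assms(2) card6(2)[OF assms(1)], of listed7] to7[OF assms(1)]
    two_to8[OF assms(1,2)] by auto

lemma add7:
  assumes "listed7 A" "is_square S" "\<not> S \<subseteq> A" "2 \<le> card (S \<inter> A)"
  shows "listed8 (A \<union> S) \<or> listed9 (A \<union> S)"
  using card_Diff_one_or_two[OF assms(2-4)]
    listed_add_square[OF _ assms(2) card7(2)[OF assms(1)], of listed8] to8[OF assms(1)]
    two_to9[OF assms(1,2)] by auto

lemma add8:
  assumes "listed8 A" "is_square S" "card (S - A) = 1"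
  shows "listed9 (A \<union> S)"
  using listed_add_square[OF assms(3,2) card8(2)[OF assms(1)], of listed9] to9[OF assms(1)] by auto

lemma copy_square:
  assumes "is_square S"
  shows "listed4 S"
proof -
  obtain p u where u: "u \<noteq> 0" "S = sq p u" using assms is_square_iff by blast
  define g where "g = aff (fst u) (snd u) 1 (fst p) (snd p)"
  have "nice g" unfolding g_def using u(1) by (intro nice_aff) (auto simp: prod_eq_iff)
  moreover have "S = g ` pts (configs4 0)"
    unfolding u(2) sq_def g_def configs4_def
    by (simp add: aff_def emb_def rot_def prod_eq_iff insert_commute) (auto simp: prod_eq_iff)
  ultimately have "copy S (configs4 0)" using list_all_upto[OF wf4, of 0] by (auto simp: copy_def)
  then show ?thesis unfolding listed_def by (intro exI[of _ 0]) simp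
qed

lemma linked_squares_listed6:
  assumes "is_square S" "is_square T" "S \<noteq> T" "2 \<le> card (S \<inter> T)"
  shows "listed6 (S \<union> T)"
proof -
  have "card (T - S) = 2"
    using card_square_Int[OF assms(1-3)] assms(4) card_square_Diff[OF assms(2), of S] by (simp add: Int_commute)
  then show ?thesis using two_to6[OF copy_square[OF assms(1)] assms(2)] by simp
qed

lemma linked_listed6:
  assumes "linked P"
  obtains A where "A \<subseteq> P" "listed6 A"
  using assms linked_squares_listed6 unfolding linked_def sqs_def by (metis (no_types, lifting) Un_least mem_Collect_eq)

section \<open>Squares not contained in a subset\<close>

lemma card_ge_two:
  assumes "2 \<le> card X"
  obtains x y where "x \<in> X" "y \<in> X" "x \<noteq> y"
proof -
  obtain Y where "Y \<subseteq> X" "card Y = 2" using assms obtain_subset_with_card_n by metis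
  then show thesis using that by (auto simp: card_2_iff)
qed

lemma card_outside:
  assumes "finite P" "A \<subseteq> P"
  shows "card {S \<in> sqs P. \<not> S \<subseteq> A} = num_squares P - num_squares A"
proof -
  have "{S \<in> sqs P. \<not> S \<subseteq> A} = sqs P - sqs A" by (auto simp: sqs_def)
  moreover have "sqs A \<subseteq> sqs P" using assms(2) by (auto simp: sqs_def)
  ultimately show ?thesis unfolding num_squares_sqs
    using finite_sqs assms by (metis card_Diff_subset finite_subset)
qed

lemma ex_outside:
  assumes "finite P" "A \<subseteq> P" "num_squares A < num_squares P"
  obtains S where "S \<in> sqs P" "\<not> S \<subseteq> A"
proof -
  have "card {S \<in> sqs P. \<not> S \<subseteq> A} \<noteq> 0" using card_outside[OF assms(1,2)] assms(3) by simp
  then have "{S \<in> sqs P. \<not> S \<subseteq> A} \<noteq> {}" by (metis card.empty)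
  then show thesis using that by blast
qed

lemma card_sq_Diff_le:
  assumes "finite P" "A \<subseteq> P" "S \<in> sqs P"
  shows "card (S - A) \<le> card P - card A"
  using assms by (metis Diff_mono card_Diff_subset card_mono finite_Diff finite_subset order_refl sqs_subset)

text \<open>At most two of the four vertices fit outside \<open>A\<close>.\<close>

lemma touching_two:
  assumes "finite P" "A \<subseteq> P" "card P \<le> card A + 2" "S \<in> sqs P"
  shows "2 \<le> card (S \<inter> A)"
  using card_sq_Diff_le[OF assms(1,2,4)] assms(3) card_square_Diff[OF sqs_square[OF assms(4)], of A] by arith

text \<open>If only three points are left, two squares with at most one vertex in \<open>A\<close> would share these
  three points.\<close>

lemma touching_three:
  assumes "finite P" "A \<subseteq> P" "card P \<le> card A + 3" "num_squares A + 2 \<le> num_squares P"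
  obtains S where "S \<in> sqs P" "\<not> S \<subseteq> A" "2 \<le> card (S \<inter> A)"
proof -
  have "2 \<le> card {S \<in> sqs P. \<not> S \<subseteq> A}" using card_outside[OF assms(1,2)] assms(4) by simp
  then obtain S T where ST: "S \<in> sqs P" "\<not> S \<subseteq> A" "T \<in> sqs P" "\<not> T \<subseteq> A" "S \<noteq> T"
    using card_ge_two by (metis (mono_tags, lifting) mem_Collect_eq)
  have touch: "2 \<le> card (S \<inter> A) \<or> 2 \<le> card (T \<inter> A)"
  proof (rule ccontr)
    assume "\<not> ?thesis"
    then have c: "3 \<le> card (S - A)" "3 \<le> card (T - A)"
      using card_square_Diff[OF sqs_square[OF ST(1)], of A] card_square_Diff[OF sqs_square[OF ST(3)], of A] by auto
    have fin: "finite (P - A)" "card (P - A) \<le> 3"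
      using assms(1-3) by (auto simp: card_Diff_subset finite_subset)
    have "S - A \<subseteq> P - A" "T - A \<subseteq> P - A" using sqs_subset[OF ST(1)] sqs_subset[OF ST(3)] by auto
    then have "S - A = P - A" "T - A = P - A" using c fin(2) card_seteq[OF fin(1)] by auto
    then have "S - A \<subseteq> S \<inter> T" by blast
    then have "card (S - A) \<le> card (S \<inter> T)"
      using finite_square[OF sqs_square[OF ST(1)]] by (intro card_mono) auto
    then show False
      using c(1) card_square_Int[OF sqs_square[OF ST(1)] sqs_square[OF ST(3)] ST(5)] by simp
  qed
  show thesis using touch that[OF ST(1,2)] that[OF ST(3,4)] by metis
qed

text \<open>Listed eight-point sets have at most four squares, so a fifth square must pass through
  the ninth point.\<close>

lemma grow8:
  assumes "finite P" "A \<subseteq> P" "listed8 A" "card P = 9" "5 \<le> num_squares P"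
  shows "listed9 P"
proof -
  have lt_S: "num_squares A < num_squares P" using num8[OF assms(3)] assms(5) by auto
    obtain S where S: "S \<in> sqs P" "\<not> S \<subseteq> A"
      using ex_outside[OF assms(1,2) lt_S] by metis
  have "card (S - A) = 1"
    using card_sq_Diff_le[OF assms(1,2) S(1)] card_Diff_pos[OF sqs_square[OF S(1)] S(2)] card8[OF assms(3)] assms(4) by simp
  then have "listed9 (A \<union> S)" using add8[OF assms(3) sqs_square[OF S(1)]] by simp
  moreover have "A \<union> S \<subseteq> P" using assms(2) sqs_subset[OF S(1)] by simp
  ultimately show ?thesis using card9(1) assms(1,4) by (metis card_subset_eq)
qed

section \<open>Classification for six to nine points\<close>

lemma classify6:
  assumes "finite P" "card P = 6" "2 \<le> num_squares P"
  shows "listed6 P"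
proof -
  \<comment> \<open>Here and below, \<open>k\<close> is next to the average degree
    \<open>4 * m / n\<close>, so that the degrees cannot all be far from \<open>k\<close> and
    \<open>k + 1\<close>. In this case the condition reads 22 < 24.\<close>
  have "linked P" by (rule linked_if_many[OF assms, of 1]) simp
  then obtain A where "A \<subseteq> P" "listed6 A" using linked_listed6 by blast
  then show ?thesis using card6(1) assms(1,2) by (metis card_subset_eq)
qed

lemma classify7:
  assumes "finite P" "card P = 7" "3 \<le> num_squares P"
  shows "listed7 P"
proof -
  have "linked P" by (rule linked_if_many[OF assms, of 1]) simp
  then obtain A where A: "A \<subseteq> P" "listed6 A" using linked_listed6 by blast
  have lt_S: "num_squares A < num_squares P" using num6[OF A(2)] assms(3) by auto
    obtain S where S: "S \<in> sqs P" "\<not> S \<subseteq> A"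
      using ex_outside[OF assms(1) A(1) lt_S] by metis
  have "2 \<le> card (S \<inter> A)" using touching_two[OF assms(1) A(1) _ S(1)] card6(1)[OF A(2)] assms(2) by simp
  then have "listed7 (A \<union> S) \<or> listed8 (A \<union> S)" using add6[OF A(2) sqs_square[OF S(1)] S(2)] by simp
  moreover have "A \<union> S \<subseteq> P" using A(1) sqs_subset[OF S(1)] by simp
  moreover have "card (A \<union> S) \<le> 7" using card_mono[OF assms(1) calculation(2)] assms(2) by simp
  ultimately show ?thesis using card7(1) card8(1) assms(1,2) by (metis card_subset_eq numeral_le_iff semiring_norm(69,71,72))
qed

lemma classify8:
  assumes "finite P" "card P = 8" "4 \<le> num_squares P"
  shows "listed8 P"
proof -
  have "linked P" by (rule linked_if_many[OF assms, of 1]) simp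
  then obtain A where A: "A \<subseteq> P" "listed6 A" using linked_listed6 by blast
  have lt_S: "num_squares A < num_squares P" using num6[OF A(2)] assms(3) by auto
    obtain S where S: "S \<in> sqs P" "\<not> S \<subseteq> A"
      using ex_outside[OF assms(1) A(1) lt_S] by metis
  have "2 \<le> card (S \<inter> A)" using touching_two[OF assms(1) A(1) _ S(1)] card6(1)[OF A(2)] assms(2) by simp
  then have "listed7 (A \<union> S) \<or> listed8 (A \<union> S)" using add6[OF A(2) sqs_square[OF S(1)] S(2)] by simp
  moreover have AS: "A \<union> S \<subseteq> P" using A(1) sqs_subset[OF S(1)] by simp
  moreover have "listed8 P" if "listed8 (A \<union> S)"
    using that AS card8(1) assms(1,2) by (metis card_subset_eq)
  moreover have "listed8 P" if B: "listed7 (A \<union> S)"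
  proof -
    have lt_T: "num_squares (A \<union> S) < num_squares P" using num7[OF B] assms(3) by auto
    obtain T where T: "T \<in> sqs P" "\<not> T \<subseteq> A \<union> S"
      using ex_outside[OF assms(1) AS lt_T] by metis
    have "card (T - (A \<union> S)) = 1"
      using card_sq_Diff_le[OF assms(1) AS T(1)] card_Diff_pos[OF sqs_square[OF T(1)] T(2)] card7[OF B] assms(2) by simp
    then have "listed8 (A \<union> S \<union> T)"
      using listed_add_square[OF _ sqs_square[OF T(1)] card7(2)[OF B], of listed8] to8[OF B] by auto
    moreover have "A \<union> S \<union> T \<subseteq> P" using AS sqs_subset[OF T(1)] by simp
    ultimately show ?thesis using card8(1) assms(1,2) by (metis card_subset_eq)
  qed
  ultimately show ?thesis by blast
qed

text \<open>The bound 5 is sharp: an eight-point set with four squares and a free ninth point has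
  four squares and is not determined up to similarity.\<close>

lemma classify9:
  assumes "finite P" "card P = 9" "5 \<le> num_squares P"
  shows "listed9 P"
proof -
  have "linked P" by (rule linked_if_many[OF assms, of 2]) simp
  then obtain A where A: "A \<subseteq> P" "listed6 A" using linked_listed6 by blast
  obtain S where S: "S \<in> sqs P" "\<not> S \<subseteq> A" "2 \<le> card (S \<inter> A)"
    using touching_three[OF assms(1) A(1)] card6(1)[OF A(2)] num6[OF A(2)] assms(2,3) by auto
  then have "listed7 (A \<union> S) \<or> listed8 (A \<union> S)" using add6[OF A(2) sqs_square[OF S(1)]] by simp
  moreover have AS: "A \<union> S \<subseteq> P" using A(1) sqs_subset[OF S(1)] by simp
  moreover have "listed9 P" if B: "listed7 (A \<union> S)"
  proof -
    have lt_T: "num_squares (A \<union> S) < num_squares P" using num7[OF B] assms(3) by auto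
    obtain T where T: "T \<in> sqs P" "\<not> T \<subseteq> A \<union> S"
      using ex_outside[OF assms(1) AS lt_T] by metis
    have "2 \<le> card (T \<inter> (A \<union> S))" using touching_two[OF assms(1) AS _ T(1)] card7(1)[OF B] assms(2) by simp
    then have "listed8 (A \<union> S \<union> T) \<or> listed9 (A \<union> S \<union> T)" using add7[OF B sqs_square[OF T(1)] T(2)] by simp
    moreover have AST: "A \<union> S \<union> T \<subseteq> P" using AS sqs_subset[OF T(1)] by simp
    ultimately show ?thesis using grow8[OF assms(1) AST _ assms(2,3)] card9(1) assms(1,2) by (metis card_subset_eq)
  qed
  ultimately show ?thesis using grow8[OF assms(1) AS _ assms(2,3)] by blast
qed

section \<open>Ten points\<close>

text \<open>If the three squares outside a six-point set \<open>A\<close> all meet \<open>A\<close> at most once, then they have three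
  vertices each among the remaining four points, and together they span a seven-point set.\<close>

lemma add6_one:
  assumes "listed6 A" "is_square S" "card (S - A) = 1"
  shows "listed7 (A \<union> S)"
  using listed_add_square[OF assms(3,2) card6(2)[OF assms(1)], of listed7] to7[OF assms(1)] by auto

lemma seven_of_three:
  assumes P: "finite P" "card P = 10" and A: "A \<subseteq> P" "card A = 6"
    and F: "F \<subseteq> sqs P" "card F = 3" "\<And>S. S \<in> F \<Longrightarrow> card (S \<inter> A) \<le> 1"
  obtains B where "B \<subseteq> P" "listed7 B"
proof -
  obtain S T U where STU: "F = {S, T, U}" "S \<noteq> T" "S \<noteq> U" "T \<noteq> U" using F(2) by (auto simp: card_3_iff)
  then have sq: "is_square S" "is_square T" "is_square U" and sub: "S \<subseteq> P" "T \<subseteq> P" "U \<subseteq> P"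
    using F(1) by (auto simp: sqs_def)
  have c: "3 \<le> card (S - A)" "3 \<le> card (T - A)" "3 \<le> card (U - A)"
    using F(3)[of S] F(3)[of T] F(3)[of U] STU(1)
      card_square_Diff[OF sq(1), of A] card_square_Diff[OF sq(2), of A] card_square_Diff[OF sq(3), of A] by auto
  have fin: "finite (S - A)" "finite (T - A)" "finite (S \<inter> T)" using finite_square sq by auto
  have R: "card (P - A) = 4" "finite (P - A)" using P A by (auto simp: card_Diff_subset finite_subset)
  have i2: "card (S \<inter> T) \<le> 2" using card_square_Int sq STU by blast
  have le: "card ((S - A) \<inter> (T - A)) \<le> card (S \<inter> T)" using fin by (intro card_mono) auto
  have un: "card ((S - A) \<union> (T - A)) + card ((S - A) \<inter> (T - A)) = card (S - A) + card (T - A)"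
    using card_Un_Int[OF fin(1,2)] by simp
  have un_le: "card ((S - A) \<union> (T - A)) \<le> 4" using card_mono[OF R(2), of "(S - A) \<union> (T - A)"] sub R(1) by auto
  \<comment> \<open>Two subsets of a four-point set with at least three elements each have at least
    two elements in common.\<close>
  then have "2 \<le> card (S \<inter> T)" using un c le by linarith
  then have B6: "listed6 (S \<union> T)" using linked_squares_listed6 sq STU(2) by blast
  \<comment> \<open>The overlap is at most 2, so the union has at least 3 + 3 - 2 points. Thus
    \<open>S\<close> and \<open>T\<close> use up all points outside \<open>A\<close>, and the
    vertices of \<open>U\<close> outside \<open>A\<close> lie on
    \<open>S \<union> T\<close>.\<close>
  have "card ((S - A) \<union> (T - A)) = 4" using un un_le c le i2 by linarith
  then have "(S - A) \<union> (T - A) = P - A" using R sub by (intro card_subset_eq) auto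
  then have "U - A \<subseteq> U \<inter> (S \<union> T)" using sub by blast
  then have "3 \<le> card (U \<inter> (S \<union> T))"
    using c(3) card_mono[of "U \<inter> (S \<union> T)" "U - A"] finite_square[OF sq(3)] by simp
  \<comment> \<open>A listed six-point set contains only two squares, so a third one does not
    fit.\<close>
  moreover have nU: "\<not> U \<subseteq> S \<union> T"
  proof
    assume "U \<subseteq> S \<union> T"
    then have "{S, T, U} \<subseteq> sqs (S \<union> T)" using sq by (auto simp: sqs_def)
    then have "card {S, T, U} \<le> num_squares (S \<union> T)"
      unfolding num_squares_sqs using finite_sqs finite_square sq by (intro card_mono) auto
    then show False using num6[OF B6] F(2) STU(1) by simp
  qed
  ultimately have "card (U - (S \<union> T)) = 1"
    using card_square_Diff[OF sq(3), of "S \<union> T"] card_Diff_pos[OF sq(3) nU] by linarith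
  then have "listed7 (S \<union> T \<union> U)"
    using add6_one[OF B6 sq(3)] by metis
  then show thesis using sub by (intro that[of "S \<union> T \<union> U"]) simp_all
qed

text \<open>The extensions starting from six points get stuck only at eight points, and only if no
  further square uses a single one of the two remaining points. This exceptional case is recorded in
  full because it is settled by computation.\<close>

lemma linked10:
  assumes P: "finite P" "card P = 10" "linked P" "5 \<le> num_squares P"
  shows "(\<exists>A. A \<subseteq> P \<and> listed9 A) \<or>
    (\<exists>A S. A \<subseteq> P \<and> listed8 A \<and> S \<in> sqs P \<and> P = A \<union> S \<and> card (S - A) = 2
      \<and> (\<forall>T\<in>sqs P. \<not> T \<subseteq> A \<longrightarrow> card (T - A) = 2))" (is "?nine \<or> ?eight")
proof -
  have from8: "?nine \<or> ?eight" if A: "A \<subseteq> P" "listed8 A" for A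
  proof (cases "\<exists>T\<in>sqs P. \<not> T \<subseteq> A \<and> card (T - A) \<noteq> 2")
    case True
    then obtain T where T: "T \<in> sqs P" "\<not> T \<subseteq> A" "card (T - A) \<noteq> 2" by blast
    have "card (T - A) = 1"
      using card_sq_Diff_le[OF P(1) A(1) T(1)] card_Diff_pos[OF sqs_square[OF T(1)] T(2)] card8[OF A(2)] P(2) T(3) by simp
    then have "listed9 (A \<union> T)" using add8[OF A(2) sqs_square[OF T(1)]] by simp
    moreover have "A \<union> T \<subseteq> P" using A(1) sqs_subset[OF T(1)] by simp
    ultimately have ?nine by metis
    then show ?thesis ..
  next
    case False
    have lt: "num_squares A < num_squares P" using num8[OF A(2)] P(4) by auto
    obtain S where S: "S \<in> sqs P" "\<not> S \<subseteq> A" using ex_outside[OF P(1) A(1) lt] by metis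
    have c: "card (S - A) = 2" using S False by blast
    have "card (A \<union> S) = card A + card (S - A)"
      using card_Un_disjoint[of A "S - A"] card8(2)[OF A(2)] finite_square[OF sqs_square[OF S(1)]] by (simp add: Un_Diff_cancel)
    then have "card (A \<union> S) = card P" using c card8(1)[OF A(2)] P(2) by simp
    then have "P = A \<union> S" using A(1) sqs_subset[OF S(1)] P(1) by (metis Un_least card_subset_eq)
    moreover have "\<forall>T\<in>sqs P. \<not> T \<subseteq> A \<longrightarrow> card (T - A) = 2" using False by metis
    ultimately have ?eight using A S(1) c by metis
    then show ?thesis ..
  qed
  have from7: "?nine \<or> ?eight" if A: "A \<subseteq> P" "listed7 A" for A
  proof -
    obtain S where S: "S \<in> sqs P" "\<not> S \<subseteq> A" "2 \<le> card (S \<inter> A)"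
      using touching_three[OF P(1) A(1)] card7(1)[OF A(2)] num7[OF A(2)] P(2,4) by auto
    then have "listed8 (A \<union> S) \<or> listed9 (A \<union> S)" using add7[OF A(2) sqs_square[OF S(1)]] by simp
    moreover have "A \<union> S \<subseteq> P" using A(1) sqs_subset[OF S(1)] by simp
    moreover have ?nine if "listed9 (A \<union> S)" using that \<open>A \<union> S \<subseteq> P\<close> by metis
    ultimately show ?thesis using from8[of "A \<union> S"] by argo
  qed
  obtain A where A: "A \<subseteq> P" "listed6 A" using linked_listed6[OF P(3)] by metis
  show ?thesis
  proof (cases "\<exists>S\<in>sqs P. \<not> S \<subseteq> A \<and> 2 \<le> card (S \<inter> A)")
    case True
    then obtain S where S: "S \<in> sqs P" "\<not> S \<subseteq> A" "2 \<le> card (S \<inter> A)" by blast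
    then have "listed7 (A \<union> S) \<or> listed8 (A \<union> S)" using add6[OF A(2) sqs_square[OF S(1)]] by simp
    moreover have "A \<union> S \<subseteq> P" using A(1) sqs_subset[OF S(1)] by simp
    ultimately show ?thesis using from7[of "A \<union> S"] from8[of "A \<union> S"] by argo
  next
    case False
    \<comment> \<open>Two of the at least five squares lie in \<open>A\<close>. The others meet
      \<open>A\<close> at most once and lead to a different seven-point set, from which the
      extension starts afresh.\<close>
    have "3 \<le> card {S \<in> sqs P. \<not> S \<subseteq> A}" using card_outside[OF P(1) A(1)] num6[OF A(2)] P(4) by simp
    then obtain F where F: "F \<subseteq> {S \<in> sqs P. \<not> S \<subseteq> A}" "card F = 3"
      by (erule_tac obtain_subset_with_card_n) metis
    have "card (S \<inter> A) \<le> 1" if "S \<in> F" for S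
    proof -
      have "S \<in> sqs P" "\<not> S \<subseteq> A" using F(1) that by auto
      then have "\<not> 2 \<le> card (S \<inter> A)" using False by metis
      then show ?thesis by simp
    qed
    moreover have "F \<subseteq> sqs P" using F(1) by blast
    ultimately obtain B where "B \<subseteq> P" "listed7 B"
      using seven_of_three[OF P(1,2) A(1) card6(1)[OF A(2)] _ F(2)] by metis
    then show ?thesis by (rule from7)
  qed
qed

lemma linked10_cases:
  assumes "finite P" "card P = 10" "linked P" "5 \<le> num_squares P"
  obtains (nine) A where "A \<subseteq> P" "listed9 A"
    | (eight) A S where "A \<subseteq> P" "listed8 A" "S \<in> sqs P" "P = A \<union> S" "card (S - A) = 2"
      "\<forall>T\<in>sqs P. \<not> T \<subseteq> A \<longrightarrow> card (T - A) = 2"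
  using linked10[OF assms]
proof (elim disjE exE conjE)
  fix A assume "A \<subseteq> P" "listed9 A"
  then show thesis by (rule nine)
next
  fix A S assume "A \<subseteq> P" "listed8 A" "S \<in> sqs P" "P = A \<union> S" "card (S - A) = 2"
      "\<forall>T\<in>sqs P. \<not> T \<subseteq> A \<longrightarrow> card (T - A) = 2"
  then show thesis by (rule eight)
qed

lemma remove_one_point:
  assumes "finite P" "A \<subseteq> P" "card P = card A + 1"
  obtains x where "x \<in> P" "x \<notin> A" "P = insert x A" "P - {x} = A"
proof -
  have "card (P - A) = 1" using assms by (simp add: card_Diff_subset finite_subset)
  then obtain x where "P - A = {x}" by (auto simp: card_1_singleton_iff)
  then show thesis using that[of x] assms(2) by blast
qed

text \<open>The second alternative cannot be avoided: to the nine-point set with six squares one may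
  add any point that closes no square.\<close>

lemma classify10:
  assumes P: "finite P" "card P = 10" "6 \<le> num_squares P"
  shows "listed10 P \<or> (num_squares P = 6 \<and> (\<exists>x\<in>P. listed9 (P - {x}) \<and> num_squares (P - {x}) = 6))"
proof -
  have l: "linked P" by (rule linked_if_many[OF P, of 2]) simp
  have "5 \<le> num_squares P" using P(3) by simp
  from P(1,2) l this show ?thesis
  proof (cases rule: linked10_cases)
    case (nine A)
    obtain x where x: "x \<in> P" "x \<notin> A" "P = insert x A" "P - {x} = A"
      using remove_one_point[OF P(1) nine(1)] card9(1)[OF nine(2)] P(2) by auto
    show ?thesis
    proof (cases "num_squares A < num_squares P")
      case True
      then have "listed10 P" using to10[OF nine(2) x(2)] x(3) P(3) by simp
      then show ?thesis ..
    next
      case False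
      then have "num_squares A = num_squares P" using num_squares_mono[OF P(1) nine(1)] by simp
      then show ?thesis using num9[OF nine(2)] P(3) x(1,4) nine(2) by auto
    qed
  next
    case (eight A S)
    obtain i where i: "0 \<le> i" "i < 17" "copy A (configs8 i)" using eight(2) by (auto simp: listed_def)
    have "two_ext_iso 6 (configs8 i) = []" using list_all_upto[OF step_8_10 i(1,2)] by (simp add: no_iso_def)
    moreover obtain R where "R \<in> set (two_ext_iso 6 (configs8 i))"
      using copy_two_ext_iso[OF i(3) sqs_square[OF eight(3)] eight(5), of 6] eight(6) P(3)
      unfolding eight(4)[symmetric] by metis
    ultimately show ?thesis by simp
  qed
qed

section \<open>Eleven points\<close>

text \<open>Among eleven points with seven squares and all degrees at least 2, one can delete a point of degree 2
  without destroying all linked pairs. Let \<open>S, T\<close> be linked. If all five points outside \<open>S \<union> T\<close> have degree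
  at least 3, then the other five squares have at least 15 incidences with these points, so that two of
  them are linked, too.\<close>

lemma keep_linked:
  assumes P: "finite P" "card P = 11" "num_squares P = 7" "linked P" and deg2: "\<And>p. p \<in> P \<Longrightarrow> 2 \<le> deg P p"
  obtains v where "v \<in> P" "deg P v = 2" "linked (P - {v})"
proof -
  note delete = that
  obtain S T where ST: "S \<in> sqs P" "T \<in> sqs P" "S \<noteq> T" "2 \<le> card (S \<inter> T)" using P(4) by (auto simp: linked_def)
  have sixu: "card (X \<union> Y) = 6" if "X \<in> sqs P" "Y \<in> sqs P" "X \<noteq> Y" "2 \<le> card (X \<inter> Y)" for X Y
    using card6(1) linked_squares_listed6 sqs_square that by metis
  have keep: thesis if v: "v \<in> P" "v \<notin> X \<union> Y" "deg P v = 2" and XY: "X \<in> sqs P" "Y \<in> sqs P" "X \<noteq> Y" "2 \<le> card (X \<inter> Y)" for v X Y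
  proof -
    have "X \<in> sqs (P - {v})" "Y \<in> sqs (P - {v})" using v(2) XY(1,2) by (auto simp: sqs_def)
    then have "linked (P - {v})" using XY(3,4) by (auto simp: linked_def)
    then show thesis using delete v(1,3) by metis
  qed
  define U where "U = S \<union> T"
  define R where "R = P - U"
  have U: "U \<subseteq> P" "card U = 6" "finite U" using sixu[OF ST] ST(1,2) P(1) unfolding U_def by (auto simp: sqs_def finite_subset)
  have R: "card R = 5" "finite R" using U P by (auto simp: R_def card_Diff_subset)
  show thesis
  proof (cases "\<exists>v\<in>R. deg P v \<le> 2")
    case True
    then obtain v where "v \<in> P" "v \<notin> S \<union> T" "deg P v = 2" using deg2 by (force simp: R_def U_def)
    then show thesis using keep ST by blast
  next
    case False
    have deg3: "3 \<le> deg P p" if "p \<in> R" for p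
    proof -
      have "\<not> deg P p \<le> 2" using that False by metis
      then show ?thesis by simp
    qed
    \<comment> \<open>Of the 4 * 7 = 28 incidences at least 5 * 3 = 15 belong to points of
      \<open>R\<close>.\<close>
    have sum_U: "(\<Sum>p\<in>U. deg P p) \<le> 13"
    proof -
      have "(\<Sum>p\<in>P. deg P p) = (\<Sum>p\<in>R. deg P p) + (\<Sum>p\<in>U. deg P p)"
        unfolding R_def using U(1) P(1) by (rule sum.subset_diff)
      moreover have "(\<Sum>p\<in>R. 3) \<le> (\<Sum>p\<in>R. deg P p)" using deg3 by (rule sum_mono)
      ultimately show ?thesis using sum_deg[OF P(1)] P(3) R(1) by simp
    qed
    define F where "F = sqs P - {S, T}"
    have F: "finite F" "card F = 5"
      using finite_sqs[OF P(1)] ST P(3) by (auto simp: F_def num_squares_sqs)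
    define d where "d p = card {X \<in> F. p \<in> X}" for p
    have d: "3 \<le> d p" if "p \<in> R" for p
    proof -
      have "{X \<in> F. p \<in> X} = {X \<in> sqs P. p \<in> X}" using that by (auto simp: F_def R_def U_def)
      then show ?thesis using deg3[OF that] by (simp add: d_def deg_def)
    qed
    have "\<exists>X\<in>F. \<exists>Y\<in>F. X \<noteq> Y \<and> 2 \<le> card (X \<inter> Y \<inter> R)"
    proof (rule ccontr)
      assume "\<not> ?thesis"
      then have le1: "card (X \<inter> Y \<inter> R) \<le> 1" if "X \<in> F" "Y \<in> F" "X \<noteq> Y" for X Y
        using that by (metis Suc_1 not_less_eq_eq One_nat_def)
      have "(\<Sum>p\<in>R. (d p)\<^sup>2) = (\<Sum>X\<in>F. \<Sum>Y\<in>F. card (X \<inter> Y \<inter> R))"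
        unfolding d_def by (rule sum_sq_incidence[OF R(2) F(1)])
      also have "\<dots> \<le> (\<Sum>X\<in>F. card (X \<inter> X \<inter> R)) + card F * (card F - 1)"
        using le1 by (rule sum_pairs_le[OF F(1)])
      also have "(\<Sum>X\<in>F. card (X \<inter> X \<inter> R)) = (\<Sum>p\<in>R. d p)"
        unfolding d_def using sum_card_incidence[OF R(2) F(1)] by simp
      finally have "(\<Sum>p\<in>R. (d p)\<^sup>2) \<le> (\<Sum>p\<in>R. d p) + 20" using F(2) by simp
      \<comment> \<open>For \<open>d \<ge> 3\<close> the square exceeds \<open>d\<close> by at least
        6. Five points give an excess of 30, but the ordered pairs of distinct squares account for
        at most 5 * 4 = 20.\<close>
      moreover have "(\<Sum>p\<in>R. d p + 6) \<le> (\<Sum>p\<in>R. (d p)\<^sup>2)"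
      proof (rule sum_mono)
        fix p assume "p \<in> R"
        then obtain e where "d p = 3 + e" using d le_Suc_ex by blast
        then show "d p + 6 \<le> (d p)\<^sup>2" by (simp add: power2_eq_square algebra_simps)
      qed
      ultimately show False using R(1) by (simp add: sum.distrib)
    qed
    then obtain X Y where XY: "X \<in> F" "Y \<in> F" "X \<noteq> Y" "2 \<le> card (X \<inter> Y \<inter> R)" by blast
    then have XYP: "X \<in> sqs P" "Y \<in> sqs P" by (auto simp: F_def)
    have finXY: "finite (X \<union> Y)" using XYP finite_square sqs_square by auto
    have "card (X \<inter> Y \<inter> R) \<le> card (X \<inter> Y)" using finXY by (intro card_mono) auto
    then have two: "2 \<le> card (X \<inter> Y)" using XY(4) by simp
    \<comment> \<open>The new linked pair spans six points, at least two of them in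
      \<open>R\<close>. So it misses at least two points of \<open>U\<close>, and one of these can
      be deleted.\<close>
    have "card (X \<inter> Y \<inter> R) + card (U \<inter> (X \<union> Y)) \<le> card (X \<union> Y)"
    proof -
      have "card (X \<inter> Y \<inter> R) + card (U \<inter> (X \<union> Y)) = card ((X \<inter> Y \<inter> R) \<union> (U \<inter> (X \<union> Y)))"
        using finXY by (intro card_Un_disjoint[symmetric]) (auto simp: R_def)
      also have "\<dots> \<le> card (X \<union> Y)" using finXY by (intro card_mono) auto
      finally show ?thesis .
    qed
    then have "card (U \<inter> (X \<union> Y)) \<le> 4" using XY(4) sixu[OF XYP XY(3) two] by simp
    moreover have "card (U - (X \<union> Y)) + card (U \<inter> (X \<union> Y)) = card U"
      using card_Diff_subset_Int[of U "X \<union> Y"] U(3) card_mono[of U "U \<inter> (X \<union> Y)"] by simp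
    ultimately have "2 \<le> card (U - (X \<union> Y))" using U(2) by simp
    then obtain p q where pq: "p \<in> U - (X \<union> Y)" "q \<in> U - (X \<union> Y)" "p \<noteq> q" using card_ge_two by metis
    \<comment> \<open>Otherwise the degrees in \<open>U\<close> would add up to at least 3 + 3 + 4 *
      2 = 14, more than the 13 available.\<close>
    have "deg P p = 2 \<or> deg P q = 2"
    proof (rule ccontr)
      assume "\<not> ?thesis"
      then have "3 \<le> deg P p" "3 \<le> deg P q" using deg2[of p] deg2[of q] pq U(1) by auto
      moreover have "(\<Sum>r\<in>U. deg P r) = deg P p + (deg P q + (\<Sum>r\<in>U - {p} - {q}. deg P r))"
        using pq U(3) sum.remove[of U p "deg P"] sum.remove[of "U - {p}" q "deg P"] by simp
      moreover have "(\<Sum>r\<in>U - {p} - {q}. 2) \<le> (\<Sum>r\<in>U - {p} - {q}. deg P r)" using deg2 U(1) by (intro sum_mono) auto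
      moreover have "card (U - {p} - {q}) = 4" using pq U(2,3) by simp
      then have "(\<Sum>r\<in>U - {p} - {q}. 2) = (8 :: nat)" by simp
      ultimately show False using sum_U by linarith
    qed
    moreover have "p \<in> P" "q \<in> P" "p \<notin> X \<union> Y" "q \<notin> X \<union> Y" using pq U(1) by auto
    ultimately show thesis using keep[OF _ _ _ XYP XY(3) two] by metis
  qed
qed

text \<open>In the second alternative a point may be added freely to the extremal ten-point set, which is why
  \<open>num_squares P = 7\<close> does not determine \<open>P\<close> up to similarity.\<close>

definition almost11 :: "(real \<times> real) set \<Rightarrow> bool" where
  "almost11 P \<longleftrightarrow> num_squares P = 7 \<and> (\<exists>x\<in>P. listed10 (P - {x}) \<and> num_squares (P - {x}) = 7)"

lemma grow10:
  assumes "finite P" "x \<in> P" "listed10 (P - {x})" "7 \<le> num_squares P"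
  shows "listed11 P \<or> almost11 P"
proof (cases "num_squares (P - {x}) < num_squares P")
  case True
  have "insert x (P - {x}) = P" using assms(2) by blast
  then have "listed11 P" using to11[OF assms(3), of x] assms(4) True by simp
  then show ?thesis ..
next
  case False
  then have "num_squares (P - {x}) = num_squares P" using num_squares_mono[OF assms(1), of "P - {x}"] by simp
  then have "num_squares P = 7 \<and> num_squares (P - {x}) = 7" using num10[OF assms(3)] assms(4) by auto
  then show ?thesis unfolding almost11_def using assms(2,3) by metis
qed

lemma grow9:
  assumes P: "finite P" "card P = 11" "7 \<le> num_squares P"
    and A: "A \<subseteq> P" "listed9 A" and S: "S \<in> sqs P" "card (S - A) = 2"
  shows "listed11 P"
proof -
  have "card (A \<union> S) = card A + card (S - A)"
    using card_Un_disjoint[of A "S - A"] card9(2)[OF A(2)] finite_square[OF sqs_square[OF S(1)]] by (simp add: Un_Diff_cancel)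
  then have "card (A \<union> S) = card P" using S(2) card9(1)[OF A(2)] P(2) by simp
  then have "P = A \<union> S" using A(1) sqs_subset[OF S(1)] P(1) by (metis Un_least card_subset_eq)
  then show ?thesis using two_to11[OF A(2) sqs_square[OF S(1)] S(2)] P(3) by simp
qed

text \<open>The delicate case is that \<open>P - {y}\<close> is a nine-point set with six squares
  and a free point \<open>x\<close>. Some square passes through \<open>y\<close>. If it also uses
  \<open>x\<close>, the two points extend the nine-point set together; if not, \<open>x\<close>
  should have been deleted in place of \<open>y\<close>.\<close>

lemma grow10_six:
  assumes P: "finite P" "card P = 11" "7 \<le> num_squares P" and y: "y \<in> P" "6 \<le> num_squares (P - {y})"
  shows "listed11 P \<or> almost11 P"
proof -
  have fin: "finite (P - {y})" "card (P - {y}) = 10" using P y by auto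
  from classify10[OF fin y(2)] show ?thesis
  proof
    assume "listed10 (P - {y})"
    then show ?thesis by (rule grow10[OF P(1) y(1) _ P(3)])
  next
    assume "num_squares (P - {y}) = 6 \<and> (\<exists>x\<in>P - {y}. listed9 (P - {y} - {x}) \<and> num_squares (P - {y} - {x}) = 6)"
    then obtain x where n6: "num_squares (P - {y}) = 6" and x: "x \<in> P" "x \<noteq> y"
      and A: "listed9 (P - {y} - {x})" "num_squares (P - {y} - {x}) = 6" by auto
    have lt: "num_squares (P - {y}) < num_squares P" using n6 P(3) by simp
    obtain S where S: "S \<in> sqs P" "\<not> S \<subseteq> P - {y}" using ex_outside[OF P(1) _ lt] by blast
    then have yS: "y \<in> S" using sqs_subset[OF S(1)] by blast
    show ?thesis
    proof (cases "x \<in> S")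
      case True
      have "S - (P - {y} - {x}) = {x, y}" using True yS sqs_subset[OF S(1)] by blast
      then have "card (S - (P - {y} - {x})) = 2" using x(2) by simp
      then have "listed11 P" using grow9[OF P _ A(1) S(1)] by blast
      then show ?thesis ..
    next
      case False
      have fx: "finite (P - {x})" "card (P - {x}) = 10" using P x(1) by auto
      have "num_squares (P - {y} - {x}) < num_squares (P - {x})"
        by (rule num_squares_less[OF fx(1), of _ S]) (use False yS sqs_square[OF S(1)] sqs_subset[OF S(1)] in \<open>auto simp: sqs_def\<close>)
      \<comment> \<open>With seven squares the free-point alternative of \<open>classify10\<close>
        is ruled out.\<close>
      then have "7 \<le> num_squares (P - {x})" using A(2) by simp
      then have "listed10 (P - {x})" using classify10[OF fx] by auto
      then show ?thesis by (rule grow10[OF P(1) x(1) _ P(3)])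
    qed
  qed
qed

lemma classify11:
  assumes P: "finite P" "card P = 11" "7 \<le> num_squares P"
  shows "listed11 P \<or> almost11 P"
proof (cases "\<exists>y\<in>P. 6 \<le> num_squares (P - {y})")
  case True
  then show ?thesis using grow10_six[OF P] by metis
next
  case False
  have le5: "num_squares (P - {y}) \<le> 5" if "y \<in> P" for y
  proof -
    have "\<not> 6 \<le> num_squares (P - {y})" using that False by metis
    then show ?thesis by simp
  qed
  have rem: "num_squares P = num_squares (P - {y}) + deg P y" for y by (rule num_squares_remove[OF P(1)])
  have deg2: "2 \<le> deg P y" if "y \<in> P" for y using le5[OF that] rem[of y] P(3) by simp
  have "P \<noteq> {}" using P(2) by auto
  then obtain w where w: "w \<in> P" "card P * deg P w \<le> 4 * num_squares P" using low_degree[OF P(1)] by metis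
  \<comment> \<open>For the degree \<open>D\<close> of \<open>w\<close> there are at most
    \<open>5 + D\<close> squares, and \<open>11 * D \<le> 4 * (5 + D)\<close> gives
    \<open>D \<le> 2\<close>.\<close>
  have n7: "num_squares P = 7" using w le5[OF w(1)] rem[of w] P(2,3) by simp
  have "linked P" by (rule linked_if_many[OF P, of 2]) simp
  then obtain v where v: "v \<in> P" "deg P v = 2" "linked (P - {v})" using keep_linked[OF P(1,2) n7 _ deg2] by metis
  have Pv: "finite (P - {v})" "card (P - {v}) = 10" using P v(1) by auto
  have n5: "num_squares (P - {v}) = 5" using rem[of v] v(2) n7 by simp
  have "5 \<le> num_squares (P - {v})" using n5 by simp
  from Pv v(3) this show ?thesis
  proof (cases rule: linked10_cases)
    case (nine A)
    obtain x where x: "x \<in> P - {v}" "x \<notin> A" "P - {v} = insert x A" "P - {v} - {x} = A"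
      using remove_one_point[OF Pv(1) nine(1)] card9(1)[OF nine(2)] Pv(2) by auto
    have "num_squares (P - {v}) = num_squares A + deg (P - {v}) x"
      using num_squares_remove[OF Pv(1), of x] x(4) by simp
    \<comment> \<open>The nine-point set already has at least four of the five squares. As
      \<open>x\<close> has degree at least 2 in \<open>P\<close>, deleting \<open>v\<close> has
      destroyed a square through \<open>x\<close>, and this square contains both \<open>x\<close>
      and \<open>v\<close>.\<close>
    then have "deg (P - {v}) x \<le> 1" using n5 num9[OF nine(2)] by auto
    moreover have "2 \<le> deg P x" using deg2 x(1) by simp
    ultimately have "deg (P - {v}) x \<noteq> deg P x" by simp
    then have "{S \<in> sqs (P - {v}). x \<in> S} \<noteq> {S \<in> sqs P. x \<in> S}" unfolding deg_def by metis
    moreover have "{S \<in> sqs (P - {v}). x \<in> S} \<subseteq> {S \<in> sqs P. x \<in> S}" by (auto simp: sqs_def)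
    ultimately obtain S where S: "S \<in> sqs P" "x \<in> S" "S \<notin> sqs (P - {v})" by blast
    then have "v \<in> S" by (auto simp: sqs_def)
    then have "S - A = {x, v}" using x S(2) sqs_subset[OF S(1)] nine(1) by blast
    then have "card (S - A) = 2" using x(1) by simp
    moreover have "A \<subseteq> P" using nine(1) by blast
    ultimately have "listed11 P" using grow9[OF P _ nine(2) S(1)] by blast
    then show ?thesis ..
  next
    case (eight A S)
    obtain i where i: "0 \<le> i" "i < 17" "copy A (configs8 i)" using eight(2) by (auto simp: listed_def)
    obtain R where R: "R \<in> set (two_ext_iso 5 (configs8 i))" "copy (P - {v}) R"
      using copy_two_ext_iso[OF i(3) sqs_square[OF eight(3)] eight(5), of 5] eight(6) n5
      unfolding eight(4)[symmetric] by (metis order_refl)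
    have Pe: "insert v (P - {v}) = P" using v(1) by blast
    \<comment> \<open>Restoring \<open>v\<close> raises the number of squares from 5 to 7, so it is
      a one-point extension of the candidate \<open>R\<close> and is covered by the nested
      table.\<close>
    obtain R' where R': "R' \<in> set (one_ext 7 R)" "copy P R'"
      using copy_one_ext[OF R(2), of v 7] n5 n7 unfolding Pe by auto
    obtain mss where "list_all2 (one_match 7 configs11 20) (two_ext_iso 5 (configs8 i)) mss"
      using list_all2_upto[OF step_8_11 i(1,2)] by (auto simp: iso_ok_def)
    then obtain ms where "list_all2 (matches configs11 20) (one_ext 7 R) ms"
      using list_all2_ex[OF _ R(1)] by (metis one_match_def)
    then obtain m where "matches configs11 20 R' m" using list_all2_ex[OF _ R'(1)] by metis
    moreover have "distinct R'" using R'(2) by (simp add: copy_def)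
    ultimately have "listed11 P" using matches_listed list_all_upto[OF wf11] R'(2) by blast
    then show ?thesis ..
  qed
qed

lemma num_squares_almost11: "almost11 P \<Longrightarrow> num_squares P = 7"
  by (simp add: almost11_def)

lemma le11: "finite P \<Longrightarrow> card P = 11 \<Longrightarrow> num_squares P \<le> 8"
  using classify11[of P] num11[of P] num_squares_almost11[of P] by (cases "7 \<le> num_squares P") auto

section \<open>Twelve and thirteen points\<close>

lemma listed10_max:
  assumes "listed10 A" "num_squares A = 7"
  shows "listed configs10 1 A"
proof -
  obtain i where i: "0 \<le> i" "i < 6" "copy A (configs10 i)" using assms(1) by (auto simp: listed_def)
  have "map (sqcount \<circ> configs10) [0..6 - 1] ! nat i = (sqcount \<circ> configs10) i"
    using i by (subst nth_map) (simp_all del: upto_rec_numeral)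
  then have "[7,6,6,6,6,6] ! nat i = (7 :: nat)"
    using copy_num_squares[OF i(3)] assms(2) unfolding sqcount_configs(5) by simp
  then have "i = 0" using i by (cases "nat i = 0") (auto simp: nth_Cons split: nat.splits)
  then show ?thesis using i by (auto simp: listed_def)
qed

lemma classify12:
  assumes P: "finite P" "card P = 12" "10 \<le> num_squares P"
  shows "listed12 P"
proof -
  have "P \<noteq> {}" using P(2) by auto
  then obtain w where w: "w \<in> P" "card P * deg P w \<le> 4 * num_squares P" using low_degree[OF P(1)] by metis
  have rem: "num_squares P = num_squares (P - {w}) + deg P w" by (rule num_squares_remove[OF P(1)])
  have Pw: "finite (P - {w})" "card (P - {w}) = 11" "insert w (P - {w}) = P" using P w(1) by auto
  \<comment> \<open>The deletion removes at most a third of the squares, and two thirds of 10 exceed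
    6.\<close>
  have "7 \<le> num_squares (P - {w})" using w(2) rem P(2,3) by simp
  with Pw(1,2) have "listed11 (P - {w}) \<or> almost11 (P - {w})" by (rule classify11)
  then show ?thesis
  proof
    assume L: "listed11 (P - {w})"
    then have "num_squares (P - {w}) < num_squares P" using num11 P(3) by fastforce
    then show ?thesis using to12[OF L, of w] P(3) unfolding Pw(3) by simp
  next
    assume "almost11 (P - {w})"
    then obtain x where n7: "num_squares (P - {w}) = 7" and x: "x \<in> P" "x \<noteq> w"
      and B: "listed10 (P - {w} - {x})" "num_squares (P - {w} - {x}) = 7" by (auto simp: almost11_def)
    show ?thesis
    proof (cases "\<exists>S\<in>sqs P. x \<in> S \<and> w \<in> S")
      case True
      then obtain S where S: "S \<in> sqs P" "x \<in> S" "w \<in> S" by blast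
      then have "S - (P - {w} - {x}) = {x, w}" "P - {w} - {x} \<union> S = P"
        using sqs_subset[OF S(1)] x(1) w(1) by blast+
      then show ?thesis
        using two_to12[OF listed10_max[OF B] sqs_square[OF S(1)]] x(2) P(3) by simp
    next
      case False
      \<comment> \<open>The point \<open>x\<close> lies on no square of \<open>P - {w}\<close>, and
        now also on none through \<open>w\<close>. Deleting it would keep at least ten squares on
        eleven points, which is more than 8.\<close>
      have "S \<in> sqs (P - {x})" if S: "S \<in> sqs P" for S
      proof (rule ccontr)
        assume "S \<notin> sqs (P - {x})"
        then have "x \<in> S" using S by (auto simp: sqs_def)
        then have "w \<notin> S" using False S by blast
        then have "S \<in> sqs (P - {w})" using S by (auto simp: sqs_def)
        moreover have "\<not> S \<subseteq> P - {w} - {x}" using \<open>x \<in> S\<close> by blast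
        ultimately have "num_squares (P - {w} - {x}) < num_squares (P - {w})"
          by (intro num_squares_less[OF Pw(1)]) auto
        then show False using n7 B(2) by simp
      qed
      then have "sqs P \<subseteq> sqs (P - {x})" by blast
      then have "num_squares P \<le> num_squares (P - {x})"
        unfolding num_squares_sqs using P(1) by (intro card_mono finite_sqs) auto
      also have "\<dots> \<le> 8" by (rule le11) (use P x(1) in auto)
      finally show ?thesis using P(3) by simp
    qed
  qed
qed

lemma le12: "finite P \<Longrightarrow> card P = 12 \<Longrightarrow> num_squares P \<le> 11"
  using classify12[of P] num12[of P] by (cases "10 \<le> num_squares P") auto

lemma le13:
  assumes P: "finite P" "card P = 13"
  shows "num_squares P \<le> 13"
proof (rule ccontr)
  assume "\<not> ?thesis"
  then have n: "14 \<le> num_squares P" by simp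
  have "P \<noteq> {}" using P(2) by auto
  then obtain w where w: "w \<in> P" "card P * deg P w \<le> 4 * num_squares P" using low_degree[OF P(1)] by metis
  have rem: "num_squares P = num_squares (P - {w}) + deg P w" by (rule num_squares_remove[OF P(1)])
  have Pw: "finite (P - {w})" "card (P - {w}) = 12" "insert w (P - {w}) = P" using P w(1) by auto
  \<comment> \<open>At most 4/13 of the squares are removed, and 14 * 9/13 exceeds 9.\<close>
  have "10 \<le> num_squares (P - {w})" using w(2) rem P(2) n by simp
  with Pw(1,2) have L: "listed12 (P - {w})" by (rule classify12)
  then obtain i where i: "0 \<le> i" "i < 4" "copy (P - {w}) (configs12 i)" by (auto simp: listed_def)
  have "num_squares (P - {w}) < num_squares P" using le12[OF Pw(1,2)] n by simp
  then obtain R where "R \<in> set (one_ext 14 (configs12 i))"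
    using copy_one_ext[OF i(3), of w 14] n unfolding Pw(3) by auto
  moreover have "one_ext 14 (configs12 i) = []"
    using list_all_upto[OF step_12_13 i(1,2)] by (simp add: no_one_def)
  ultimately show False by simp
qed

section \<open>Extremal configurations\<close>

text \<open>A sequence of 2-extensions written as a list of directed edges, each adding the square
  on its left; the square on the right is reached by reversing the edge. An illegal step yields the
  empty list, which \<open>grows_to\<close> rejects.\<close>

fun grow :: "ipt list \<Rightarrow> (ipt \<times> ipt) list \<Rightarrow> ipt list" where
  "grow Q [] = Q"
| "grow Q ((p, q) # es) = (if p \<in> set Q \<and> q \<in> set Q \<and> p \<noteq> q
     then grow ((q + irot (q - p)) # (p + irot (q - p)) # Q) es else [])"

definition grows_to :: "(int \<Rightarrow> ipt list) \<Rightarrow> int \<Rightarrow> ipt \<times> (ipt \<times> ipt) list \<Rightarrow> bool" where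
  "grows_to c i g = (case g of (p, es) \<Rightarrow>
     set (grow [p, p + (1, 0), p + (1, 1), p + (0, 1)] es) = set (c i) \<and> c i \<noteq> [])"

lemma recursively_extended_grow:
  "recursively_extended (pts Q) \<Longrightarrow> grow Q es \<noteq> [] \<Longrightarrow> recursively_extended (pts (grow Q es))"
proof (induction Q es rule: grow.induct)
  case (2 Q p q es)
  then have pq: "p \<in> set Q" "q \<in> set Q" "p \<noteq> q" by (auto split: if_splits)
  let ?R = "(q + irot (q - p)) # (p + irot (q - p)) # Q"
  have ne: "emb (q - p) \<noteq> 0" using pq(3) by (auto simp: emb_def zero_prod_def prod_eq_iff)
  have S: "sq (emb p) (emb (q - p)) = emb ` {p, q, q + irot (q - p), p + irot (q - p)}"
    by (simp add: sq_def emb_hom)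
  have eq: "pts ?R = pts Q \<union> sq (emb p) (emb (q - p))" unfolding S using pq by auto
  have "two_extension_step (pts Q) (pts ?R)"
    unfolding two_extension_step_def eq
    using pq is_square_sq[OF ne, of "emb p"]
    by (intro bexI[of _ "emb p"] bexI[of _ "emb q"] exI[of _ "sq (emb p) (emb (q - p))"])
      (auto simp: S)
  then have "recursively_extended (pts ?R)" using 2(2) recursively_extended.step by blast
  then show ?case using 2(1,3) pq by simp
qed simp

lemma grows_to_recursively_extended:
  assumes "grows_to c i g"
  shows "recursively_extended (pts (c i))"
proof -
  obtain p es where g: "g = (p, es)" by (rule prod.exhaust)
  let ?Q = "[p, p + (1, 0), p + (1, 1), p + (0, 1)]"
  have e: "set (grow ?Q es) = set (c i)" "c i \<noteq> []" using assms by (simp_all add: grows_to_def g)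
  have "is_unit_square (pts ?Q)"
    unfolding is_unit_square_def
    by (intro exI[of _ "emb p"] exI[of _ "(1, 0)"] exI[of _ "(0, 1)"])
      (auto simp: emb_hom emb_def norm_prod_def)
  then have "recursively_extended (pts ?Q)" by (rule recursively_extended.start)
  moreover have "grow ?Q es \<noteq> []" using e by auto
  ultimately have "recursively_extended (pts (grow ?Q es))" by (rule recursively_extended_grow)
  then show ?thesis using e(1) by (simp add: pts_def)
qed

section \<open>Distance counts as a similarity invariant\<close>

definition sqdist :: "ipt \<Rightarrow> ipt \<Rightarrow> int" where
  "sqdist p q = (fst p - fst q) * (fst p - fst q) + (snd p - snd q) * (snd p - snd q)"

definition at_dist :: "int \<Rightarrow> ipt \<Rightarrow> ipt \<Rightarrow> bool" where
  "at_dist k p q \<longleftrightarrow> sqdist p q = k"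

definition dist_count :: "ipt list \<Rightarrow> int \<Rightarrow> nat" where
  "dist_count Q k = length (concat (map (\<lambda>p. filter (at_dist k p) Q) Q))"

text \<open>The numbers of ordered pairs at the squared distances 1, 2, 4 and 8. These four numbers
  separate all extremal sets of equal size, and the first one shows that distance 1 occurs.\<close>

definition signature :: "ipt list \<Rightarrow> nat list" where
  "signature Q = map (dist_count Q) [1, 2, 4, 8]"

lemma dist_emb: "dist (emb p) (emb q) = sqrt (of_int (sqdist p q))"
  by (simp add: emb_def dist_prod_def dist_real_def sqdist_def power2_eq_square)

lemma dist_count_card:
  assumes "distinct Q"
  shows "dist_count Q k = card {(x, y). x \<in> pts Q \<and> y \<in> pts Q \<and> dist x y = sqrt (of_int k)}"
proof -
  have "dist_count Q k = (\<Sum>p\<in>set Q. card {q \<in> set Q. sqdist p q = k})"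
    using assms unfolding dist_count_def
    by (simp add: length_concat sum_list_distinct_conv_sum_set o_def distinct_length_filter at_dist_def Int_def conj_commute)
  also have "\<dots> = card (SIGMA p:set Q. {q \<in> set Q. sqdist p q = k})" by (simp add: card_SigmaI)
  also have "\<dots> = card (map_prod emb emb ` (SIGMA p:set Q. {q \<in> set Q. sqdist p q = k}))"
    by (rule card_image[symmetric]) (auto simp: inj_on_def)
  also have "map_prod emb emb ` (SIGMA p:set Q. {q \<in> set Q. sqdist p q = k})
      = {(x, y). x \<in> pts Q \<and> y \<in> pts Q \<and> dist x y = sqrt (of_int k)}"
    by (auto simp: pts_def dist_emb) 
  finally show ?thesis .
qed

lemma dist_count_1:
  assumes "distinct Q" "dist_count Q 1 > 0"
  obtains x y where "x \<in> pts Q" "y \<in> pts Q" "dist x y = 1"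
proof -
  have "{(x, y). x \<in> pts Q \<and> y \<in> pts Q \<and> dist x y = sqrt (of_int 1)} \<noteq> {}"
    using assms dist_count_card[OF assms(1), of 1] by (metis card.empty less_irrefl)
  then show thesis using that by auto
qed

lemma dist_pts_ge_1:
  assumes "x \<in> pts Q" "y \<in> pts Q" "x \<noteq> y"
  shows "1 \<le> dist x y"
proof -
  obtain p q where pq: "x = emb p" "y = emb q" using assms by (auto simp: pts_def)
  have "sqdist p q \<ge> 0" unfolding sqdist_def by simp
  moreover have "dist x y > 0" using assms(3) by simp
  then have "sqdist p q > 0" unfolding pq dist_emb by simp
  ultimately show ?thesis unfolding pq dist_emb by simp
qed

text \<open>In both integral sets 1 is the smallest distance and is attained. Comparing the smallest
  distances in both directions forces the similarity factor to be 1, so all distances are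
  preserved.\<close>

lemma similar_signature:
  assumes "similar (pts Q) (pts R)" "distinct Q" "distinct R" "dist_count Q 1 > 0" "dist_count R 1 > 0"
  shows "signature Q = signature R"
proof -
  obtain f c where f: "f ` pts Q = pts R" and c: "c > 0" "\<And>x y. dist (f x) (f y) = c * dist x y"
    using assms(1) unfolding similar_def similarity_def by metis
  have inj: "f x = f y \<longleftrightarrow> x = y" for x y
    using c(1) c(2)[of x y] by (metis dist_eq_0_iff mult_eq_0_iff less_irrefl)
  have "c \<ge> 1"
  proof -
    obtain x y where xy: "x \<in> pts Q" "y \<in> pts Q" "dist x y = 1" using dist_count_1[OF assms(2,4)] by metis
    then have "f x \<in> pts R" "f y \<in> pts R" "f x \<noteq> f y" using f inj by auto
    then show ?thesis using dist_pts_ge_1[of "f x" R "f y"] c(2)[of x y] xy(3) by simp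
  qed
  moreover have "c \<le> 1"
  proof -
    obtain x y where xy: "x \<in> pts R" "y \<in> pts R" "dist x y = 1" using dist_count_1[OF assms(3,5)] by metis
    then obtain a b where ab: "a \<in> pts Q" "b \<in> pts Q" "x = f a" "y = f b" using f by (metis imageE)
    then have "1 \<le> dist a b" using dist_pts_ge_1[of a Q b] xy(3) by fastforce
    moreover have "c * dist a b = 1" using c(2)[of a b] ab xy(3) by simp
    ultimately show ?thesis using c(1) by (metis mult.right_neutral mult_le_cancel_left_pos)
  qed
  ultimately have iso: "dist (f x) (f y) = dist x y" for x y using c(2) by simp
  have "dist_count Q k = dist_count R k" for k
  proof -
    let ?C = "\<lambda>Q. {(x, y). x \<in> pts Q \<and> y \<in> pts Q \<and> dist x y = sqrt (of_int k)}"
    have "?C R = map_prod f f ` ?C Q"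
    proof (intro equalityI subsetI)
      fix z assume "z \<in> ?C R"
      then obtain x y where z: "z = (x, y)" "x \<in> pts R" "y \<in> pts R" "dist x y = sqrt (of_int k)" by auto
      then obtain a b where "a \<in> pts Q" "b \<in> pts Q" "x = f a" "y = f b" using f by (metis imageE)
      then show "z \<in> map_prod f f ` ?C Q" using z iso by (intro image_eqI[of _ _ "(a, b)"]) auto
    next
      fix z assume "z \<in> map_prod f f ` ?C Q"
      then show "z \<in> ?C R" using iso f by auto
    qed
    moreover have "inj_on (map_prod f f) (?C Q)" using inj by (auto simp: inj_on_def)
    ultimately show ?thesis unfolding dist_count_card[OF assms(2)] dist_count_card[OF assms(3)]
      by (simp add: card_image)
  qed
  then show ?thesis by (simp add: signature_def)
qed

lemma grows_configs:
  "list_all2 (grows_to configs4) [0..1 - 1]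
    [((0, 0), [])]"
  "list_all2 (grows_to configs6) [0..2 - 1]
    [((0, 0), [((1, 1), (1, 0))]),
     ((0, 1), [((1, 2), (0, 1))])]"
  "list_all2 (grows_to configs7) [0..2 - 1]
    [((0, 1), [((1, 2), (0, 1)), ((1, 1), (2, 1))]),
     ((0, 1), [((1, 2), (0, 1)), ((1, 1), (1, 0))])]"
  "list_all2 (grows_to configs8) [0..2 - 1]
    [((1, 0), [((1, 0), (2, 1)), ((1, 1), (2, 0))]),
     ((0, 0), [((0, 1), (1, 0)), ((0, 1), (1, 1)), ((1, 1), (2, 1))])]"
  "list_all2 (grows_to configs9) [0..1 - 1]
    [((0, 0), [((0, 1), (1, 0)), ((0, 1), (1, 1)), ((0, 2), (0, 0))])]"
  "list_all2 (grows_to configs10) [0..1 - 1]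
    [((0, 0), [((0, 1), (1, 0)), ((0, 1), (1, 1)), ((0, 2), (0, 0)), ((1, 1), (2, 0))])]"
  "list_all2 (grows_to configs11) [0..5 - 1]
    [((0, 1), [((0, 2), (1, 1)), ((1, 2), (0, 1)), ((0, 2), (1, 0)), ((1, 2), (2, 1))]),
     ((0, 0), [((0, 1), (1, 0)), ((1, 1), (0, 0)), ((0, 0), (2, 0)), ((1, 1), (2, 0))]),
     ((0, 0), [((0, 1), (1, 0)), ((0, 1), (1, 1)), ((0, 2), (0, 0)), ((2, 2), (2, 1))]),
     ((0, 0), [((0, 1), (1, 0)), ((1, 2), (0, 0)), ((0, 1), (1, 1)), ((0, 2), (0, 0))]),
     ((0, 0), [((0, 0), (1, 1)), ((0, 1), (1, 0)), ((0, 2), (0, 0)), ((1, 1), (2, 0))])]"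
  "list_all2 (grows_to configs12) [0..1 - 1]
    [((0, 1), [((0, 2), (1, 1)), ((1, 2), (0, 1)), ((0, 2), (1, 0)), ((1, 3), (0, 1))])]"
  by code_simp+

lemma signature_configs:
  "map (signature \<circ> configs4) [0..1 - 1] = [[8, 4, 0, 0]]"
  "map (signature \<circ> configs6) [0..2 - 1] = [[14, 8, 4, 0], [12, 10, 4, 0]]"
  "map (signature \<circ> configs7) [0..2 - 1] = [[16, 12, 6, 0], [16, 12, 4, 2]]"
  "map (signature \<circ> configs8) [0..2 - 1] = [[18, 16, 8, 0], [20, 14, 8, 2]]"
  "map (signature \<circ> configs9) [0..1 - 1] = [[24, 16, 12, 4]]"
  "map (signature \<circ> configs10) [0..1 - 1] = [[26, 20, 14, 4]]"
  "map (signature \<circ> configs11) [0..5 - 1]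
    = [[28, 24, 14, 6], [28, 24, 16, 6], [30, 22, 16, 6], [28, 22, 16, 6], [28, 24, 16, 4]]"
  "map (signature \<circ> configs12) [0..1 - 1] = [[32, 28, 16, 8]]"
  by code_simp+

lemma similar_if_copy:
  assumes "copy P Q"
  shows "similar P (pts Q)"
proof -
  obtain g where g: "nice g" "P = g ` pts Q" using assms by (auto simp: copy_def)
  then have "inv g ` P = pts Q" by (simp add: nice_def bij_is_inj image_inv_f_f)
  then show ?thesis using nice_inv[OF g(1)] unfolding similar_def nice_def by blast
qed

lemma map_upto_nth:
  "map f [0..n - 1] = ys \<Longrightarrow> 0 \<le> i \<Longrightarrow> i < n \<Longrightarrow> f i = ys ! nat i"
  by auto

lemma sqcount_configs4: "map (sqcount \<circ> configs4) [0..1 - 1] = [1]"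
  by code_simp

text \<open>The tables begin with the extremal sets. If the value \<open>m\<close> is absent from
  the remaining entries, a set with \<open>m\<close> squares must be a copy of one of the first
  \<open>k\<close>.\<close>

lemma top_listed:
  assumes "map (sqcount \<circ> c) [0..n - 1] = ns" "listed c n A" "num_squares A = m" "m \<notin> set (drop k ns)"
  shows "listed c (int k) A"
proof -
  obtain i where i: "0 \<le> i" "i < n" "copy A (c i)" using assms(2) by (auto simp: listed_def)
  have len: "length ns = nat n" using assms(1) i by (auto simp flip: assms(1))
  have "ns ! nat i = sqcount (c i)" using i by (simp flip: assms(1))
  then have m: "ns ! nat i = m" using copy_num_squares[OF i(3)] assms(3) by simp
  have "nat i < k"
  proof (rule ccontr)
    assume "\<not> nat i < k"
    then have "drop k ns ! (nat i - k) = m" "nat i - k < length (drop k ns)" using m len i by simp_all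
    then show False using assms(4) nth_mem by metis
  qed
  then show ?thesis using i by (auto simp: listed_def)
qed

section \<open>The maxima\<close>

lemma max_squares_eqI:
  assumes "\<And>P. finite P \<Longrightarrow> card P = n \<Longrightarrow> num_squares P \<le> k" "finite P" "card P = n" "num_squares P = k"
  shows "max_squares n = k"
  unfolding max_squares_def
  by (rule Max_eqI) (use max_squares_wf(1)[of n] assms in auto)

lemma max_squares_pts:
  assumes "\<And>P. finite P \<Longrightarrow> card P = n \<Longrightarrow> num_squares P \<le> sqcount Q" "distinct Q" "length Q = n"
  shows "max_squares n = sqcount Q"
  by (rule max_squares_eqI[OF assms(1) finite_pts[of Q]]) (use assms card_pts num_squares_pts in auto)

lemma num_squares_le_3: "finite P \<Longrightarrow> card P \<le> 3 \<Longrightarrow> num_squares P = 0"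
proof -
  assume P: "finite P" "card P \<le> 3"
  have "S \<notin> sqs P" for S
    using card_mono[OF P(1) sqs_subset, of S] card_square[OF sqs_square, of S P] P(2) by auto
  then have "sqs P = {}" by blast
  then show ?thesis by (simp add: num_squares_sqs)
qed

text \<open>Two squares share at most two vertices, so together they need at least six
  points.\<close>

lemma num_squares_le_5:
  assumes "finite P" "card P \<le> 5"
  shows "num_squares P \<le> 1"
proof (rule ccontr)
  assume "\<not> ?thesis"
  then have "2 \<le> card (sqs P)" by (simp add: num_squares_sqs)
  then obtain S T where ST: "S \<in> sqs P" "T \<in> sqs P" "S \<noteq> T" using card_ge_two by metis
  have "card (S \<union> T) \<le> 5" using card_mono[OF assms(1), of "S \<union> T"] ST(1,2)[THEN sqs_subset] assms(2) by simp
  moreover have "card (S \<union> T) + card (S \<inter> T) = 8"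
    using card_Un_Int[of S T] ST(1,2)[THEN sqs_square] card_square finite_square by auto
  ultimately show False using card_square_Int[OF ST(1,2)[THEN sqs_square] ST(3)] by simp
qed

lemma le6: "finite P \<Longrightarrow> card P = 6 \<Longrightarrow> num_squares P \<le> 2"
  using classify6[of P] num6[of P] by (cases "2 \<le> num_squares P") auto

lemma le7: "finite P \<Longrightarrow> card P = 7 \<Longrightarrow> num_squares P \<le> 3"
  using classify7[of P] num7[of P] by (cases "3 \<le> num_squares P") auto

lemma le8: "finite P \<Longrightarrow> card P = 8 \<Longrightarrow> num_squares P \<le> 4"
  using classify8[of P] num8[of P] by (cases "4 \<le> num_squares P") auto

lemma le9: "finite P \<Longrightarrow> card P = 9 \<Longrightarrow> num_squares P \<le> 6"
  using classify9[of P] num9[of P] by (cases "5 \<le> num_squares P") auto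

lemma le10: "finite P \<Longrightarrow> card P = 10 \<Longrightarrow> num_squares P \<le> 7"
  using classify10[of P] num10[of P] by (cases "6 \<le> num_squares P") auto

text \<open>Witnesses for the sizes without a table: a square with a fifth point, and the grid of
  side 4 without its corners, with one corner put back.\<close>

lemma examples:
  "sqcount [(0, 0), (1, 0), (0, 1), (1, 1), (2, 0)] = 1"
  "sqcount ((0, 0) # configs12 0) = 13" "distinct ((0, 0) # configs12 0)" "length ((0, 0) # configs12 0) = 13"
  by code_simp+

lemma max_squares_small: "n \<le> 3 \<Longrightarrow> max_squares n = 0"
proof -
  assume n: "n \<le> 3"
  obtain P :: "(real \<times> real) set" where P: "finite P" "card P = n" using max_squares_wf(2)[of n] by auto
  show ?thesis by (rule max_squares_eqI[OF _ P]) (use num_squares_le_3 n P in auto)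
qed

lemma max_squares_configs:
  assumes "\<And>P. finite P \<Longrightarrow> card P = n \<Longrightarrow> num_squares P \<le> m"
    and "list_all (\<lambda>i. distinct (c i) \<and> length (c i) = n) [0..k - 1]"
    and "map (sqcount \<circ> c) [0..k - 1] = ns" "ns ! 0 = m" "0 < k"
  shows "max_squares n = m"
  using max_squares_pts[of n "c 0"] list_all_upto[OF assms(2), of 0] map_upto_nth[OF assms(3), of 0] assms(1,4,5)
  by auto

lemma max_squares_values:
  "max_squares 4 = 1" "max_squares 5 = 1" "max_squares 6 = 2" "max_squares 7 = 3" "max_squares 8 = 4"
  "max_squares 9 = 6" "max_squares 10 = 7" "max_squares 11 = 8" "max_squares 12 = 11" "max_squares 13 = 13"
proof -
  show "max_squares 4 = 1"
    by (rule max_squares_configs[OF _ wf4 sqcount_configs4]) (use num_squares_le_5 in auto)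
  show "max_squares 5 = 1"
    using max_squares_pts[of 5 "[(0, 0), (1, 0), (0, 1), (1, 1), (2, 0)]"] num_squares_le_5 examples(1) by simp
  show "max_squares 6 = 2" by (rule max_squares_configs[OF le6 wf6 sqcount_configs(1)]) simp_all
  show "max_squares 7 = 3" by (rule max_squares_configs[OF le7 wf7 sqcount_configs(2)]) simp_all
  show "max_squares 8 = 4" by (rule max_squares_configs[OF le8 wf8 sqcount_configs(3)]) simp_all
  show "max_squares 9 = 6" by (rule max_squares_configs[OF le9 wf9 sqcount_configs(4)]) simp_all
  show "max_squares 10 = 7" by (rule max_squares_configs[OF le10 wf10 sqcount_configs(5)]) simp_all
  show "max_squares 11 = 8" by (rule max_squares_configs[OF le11 wf11 sqcount_configs(6)]) simp_all
  show "max_squares 12 = 11" by (rule max_squares_configs[OF le12 wf12 sqcount_configs(7)]) simp_all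
  show "max_squares 13 = 13"
    using max_squares_pts[of 13 "(0, 0) # configs12 0"] le13 examples(2-4) by simp
qed

lemma upto_lists: "[0..1 - 1] = [0 :: int]" "[0..2 - 1] = [0, 1 :: int]" "[0..5 - 1] = [0, 1, 2, 3, 4 :: int]"
  by code_simp+

section \<open>The extremal sets of each size\<close>

lemma extremal_configs_pts:
  "extremal_configs 4 = map (pts \<circ> configs4) [0..1 - 1]"
  "extremal_configs 6 = map (pts \<circ> configs6) [0..2 - 1]"
  "extremal_configs 7 = map (pts \<circ> configs7) [0..2 - 1]"
  "extremal_configs 8 = map (pts \<circ> configs8) [0..2 - 1]"
  "extremal_configs 9 = map (pts \<circ> configs9) [0..1 - 1]"
  "extremal_configs 10 = map (pts \<circ> configs10) [0..1 - 1]"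
  "extremal_configs 11 = map (pts \<circ> configs11) [0..5 - 1]"
  "extremal_configs 12 = map (pts \<circ> configs12) [0..1 - 1]"
  unfolding upto_lists
  by (auto simp: extremal_configs_def pts_def emb_def configs4_def configs6_def configs7_def configs8_def
      configs9_def configs10_def configs11_def configs12_def)

definition extremal_at :: "nat \<Rightarrow> bool" where
  "extremal_at n \<longleftrightarrow>
     (\<forall>P. finite P \<and> card P = n \<and> num_squares P = max_squares n \<longrightarrow>
        (\<exists>Q. recursively_extended Q \<and> similar P Q)
        \<and> (\<exists>C\<in>set (extremal_configs n). similar P C))
     \<and> (\<forall>C\<in>set (extremal_configs n).
          finite C \<and> card C = n \<and> num_squares C = max_squares n)
     \<and> (\<forall>i<length (extremal_configs n). \<forall>j<i.
          \<not> similar (extremal_configs n ! i) (extremal_configs n ! j))"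

text \<open>Of the \<open>k'\<close> entries of the table the first \<open>k\<close> are extremal.
  Their counts, growth sequences and signatures are all computed, so \<open>cls\<close> is the only
  assumption about arbitrary point sets.\<close>

lemma extremal_atI:
  assumes E: "extremal_configs n = map (pts \<circ> c) [0..k - 1]"
    and max: "max_squares n = m"
    and cls: "\<And>P. finite P \<Longrightarrow> card P = n \<Longrightarrow> num_squares P = m \<Longrightarrow> listed c k P"
    and wf: "list_all (\<lambda>i. distinct (c i) \<and> length (c i) = n) [0..k' - 1]" "k \<le> k'"
    and sqc: "map (sqcount \<circ> c) [0..k' - 1] = ns" "list_all ((=) m) (take (nat k) ns)"
    and grows: "list_all2 (grows_to c) [0..k - 1] gs"
    and sig: "map (signature \<circ> c) [0..k - 1] = sigs" "distinct sigs" "\<forall>s\<in>set sigs. hd s > 0"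
  shows "extremal_at n"
proof -
  have c: "distinct (c i)" "length (c i) = n" "sqcount (c i) = m" "recursively_extended (pts (c i))" "0 < dist_count (c i) 1"
    if i: "0 \<le> i" "i < k" for i
  proof -
    show "distinct (c i)" "length (c i) = n" using list_all_upto[OF wf(1) i(1)] i(2) wf(2) by auto
    have "sqcount (c i) = ns ! nat i" using map_upto_nth[OF sqc(1) i(1)] i(2) wf(2) by simp
    also have "\<dots> = take (nat k) ns ! nat i" using i by simp
    finally have "sqcount (c i) = take (nat k) ns ! nat i" .
    moreover have "nat i < length (take (nat k) ns)" using i wf(2) by (simp flip: sqc(1))
    then have "take (nat k) ns ! nat i = m" using sqc(2) unfolding list_all_length by metis
    ultimately show "sqcount (c i) = m" by metis
    show "recursively_extended (pts (c i))"
      using list_all2_upto[OF grows i] grows_to_recursively_extended by blast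
    have "signature (c i) \<in> set sigs" using i by (auto simp flip: sig(1))
    then show "0 < dist_count (c i) 1" using sig(3) by (auto simp: signature_def)
  qed
  have nth: "extremal_configs n ! i = pts (c (int i))" if "i < nat k" for i
    unfolding E using that by simp
  have 1: "(\<exists>Q. recursively_extended Q \<and> similar P Q) \<and> (\<exists>C\<in>set (extremal_configs n). similar P C)"
    if P: "finite P" "card P = n" "num_squares P = max_squares n" for P
  proof -
    obtain i where i: "0 \<le> i" "i < k" "copy P (c i)" using cls[OF P(1,2)] P(3) max by (auto simp: listed_def)
    have "similar P (pts (c i))" using similar_if_copy[OF i(3)] .
    moreover have "pts (c i) \<in> set (extremal_configs n)" unfolding E using i by auto
    ultimately show ?thesis using c(4)[OF i(1,2)] by blast
  qed
  have 2: "finite C \<and> card C = n \<and> num_squares C = max_squares n" if C: "C \<in> set (extremal_configs n)" for C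
  proof -
    obtain i where i: "0 \<le> i" "i < k" "C = pts (c i)" using C unfolding E by auto
    then show ?thesis using c(1-3)[OF i(1,2)] card_pts num_squares_pts max by simp
  qed
  have 3: "\<not> similar (extremal_configs n ! i) (extremal_configs n ! j)"
    if ij: "i < length (extremal_configs n)" "j < i" for i j
  proof
    have i: "i < nat k" "j < nat k" using ij by (simp_all add: E)
    assume "similar (extremal_configs n ! i) (extremal_configs n ! j)"
    then have "signature (c (int i)) = signature (c (int j))"
      unfolding nth[OF i(1)] nth[OF i(2)] using i c by (intro similar_signature) auto
    moreover have "sigs ! i = signature (c (int i))" "sigs ! j = signature (c (int j))"
      using i by (simp_all flip: sig(1))
    moreover have "i < length sigs" "j < length sigs" using i by (simp_all flip: sig(1))
    ultimately show False using nth_eq_iff_index_eq[OF sig(2), of i j] ij(2) by simp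
  qed
  show ?thesis unfolding extremal_at_def
    by (intro conjI; (intro ballI)?; (intro allI impI)?; (elim conjE)?) (rule 1 2 3; assumption)+
qed

text \<open>At the maximum the alternatives with a free point disappear: those sets have only six
  squares on ten points, or seven on eleven.\<close>

lemma classify10_max: "finite P \<Longrightarrow> card P = 10 \<Longrightarrow> num_squares P = 7 \<Longrightarrow> listed configs10 1 P"
  using classify10[of P] top_listed[OF sqcount_configs(5), of P 7 1] by auto

lemma classify11_max: "finite P \<Longrightarrow> card P = 11 \<Longrightarrow> num_squares P = 8 \<Longrightarrow> listed configs11 5 P"
  using classify11[of P] num_squares_almost11[of P] top_listed[OF sqcount_configs(6), of P 8 5] by auto

lemma classify12_max: "finite P \<Longrightarrow> card P = 12 \<Longrightarrow> num_squares P = 11 \<Longrightarrow> listed configs12 1 P"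
  using classify12[of P] top_listed[OF sqcount_configs(7), of P 11 1] by auto

lemma extremal_all:
  "extremal_at 4" "extremal_at 6" "extremal_at 7" "extremal_at 8" "extremal_at 9"
  "extremal_at 10" "extremal_at 11" "extremal_at 12"
proof -
  show "extremal_at 4"
  proof (rule extremal_atI[OF extremal_configs_pts(1) max_squares_values(1) _ wf4 _ sqcount_configs4 _ grows_configs(1) signature_configs(1)])
    fix P :: "(real \<times> real) set" assume P: "finite P" "card P = 4" "num_squares P = 1"
    then obtain S where S: "S \<in> sqs P" by (auto simp: num_squares_sqs card_1_singleton_iff)
    then have "S = P" using card_subset_eq[OF P(1) sqs_subset[OF S]] card_square[OF sqs_square[OF S]] P(2) by simp
    then show "listed4 P" using copy_square[OF sqs_square[OF S]] by simp
  qed auto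
  show "extremal_at 6"
    by (rule extremal_atI[OF extremal_configs_pts(2) max_squares_values(3) _ wf6 _ sqcount_configs(1) _ grows_configs(2) signature_configs(2)])
      (use classify6 in auto)
  show "extremal_at 7"
    by (rule extremal_atI[OF extremal_configs_pts(3) max_squares_values(4) _ wf7 _ sqcount_configs(2) _ grows_configs(3) signature_configs(3)])
      (use classify7 in auto)
  show "extremal_at 8"
    by (rule extremal_atI[OF extremal_configs_pts(4) max_squares_values(5) _ wf8 _ sqcount_configs(3) _ grows_configs(4) signature_configs(4)])
      (use classify8 top_listed[OF sqcount_configs(3), of _ 4 2] in auto)
  show "extremal_at 9"
    by (rule extremal_atI[OF extremal_configs_pts(5) max_squares_values(6) _ wf9 _ sqcount_configs(4) _ grows_configs(5) signature_configs(5)])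
      (use classify9 top_listed[OF sqcount_configs(4), of _ 6 1] in auto)
  show "extremal_at 10"
    by (rule extremal_atI[OF extremal_configs_pts(6) max_squares_values(7) _ wf10 _ sqcount_configs(5) _ grows_configs(6) signature_configs(6)])
      (use classify10_max in auto)
  show "extremal_at 11"
    by (rule extremal_atI[OF extremal_configs_pts(7) max_squares_values(8) _ wf11 _ sqcount_configs(6) _ grows_configs(7) signature_configs(7)])
      (use classify11_max in auto)
  show "extremal_at 12"
    by (rule extremal_atI[OF extremal_configs_pts(8) max_squares_values(9) _ wf12 _ sqcount_configs(7) _ grows_configs(8) signature_configs(8)])
      (use classify12_max in auto)
qed

theorem theorem39:
  shows "(\<forall>n\<le>3. max_squares n = 0)
    \<and> max_squares 4 = 1 \<and> max_squares 5 = 1 \<and> max_squares 6 = 2 \<and> max_squares 7 = 3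
    \<and> max_squares 8 = 4 \<and> max_squares 9 = 6 \<and> max_squares 10 = 7 \<and> max_squares 11 = 8
    \<and> max_squares 12 = 11 \<and> max_squares 13 = 13
    \<and> (\<forall>n\<in>{4, 6, 7, 8, 9, 10, 11, 12}.
         (\<forall>P. finite P \<and> card P = n \<and> num_squares P = max_squares n \<longrightarrow>
            (\<exists>Q. recursively_extended Q \<and> similar P Q)
            \<and> (\<exists>C\<in>set (extremal_configs n). similar P C))
         \<and> (\<forall>C\<in>set (extremal_configs n).
              finite C \<and> card C = n \<and> num_squares C = max_squares n)
         \<and> (\<forall>i<length (extremal_configs n). \<forall>j<i.
              \<not> similar (extremal_configs n ! i) (extremal_configs n ! j)))"
  unfolding extremal_at_def[symmetric]
  using max_squares_small max_squares_values extremal_all by blast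

end
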